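(* Let $\Omega\subset\mathbb{R}^2$ be open, $T>0$, and let $u\in L^\infty_{\rm loc}(0,T;L^2_{\rm loc}(\Omega))$ be a weak solution in $\Omega_T=\Omega\times(0,T]$ of the two-dimensional incompressible Euler equations $$\partial_t u+(u\cdot\nabla)u+\nabla p=0,\qquad \operatorname{div}u=0,$$ satisfying the vorticity estimates (VE) with constant $V_o>0$ (weak solutions and (VE) are defined in the context). Let $\omega=\partial_{x_1}u_2-\partial_{x_2}u_1$. If $u\in L^{2+\varepsilon}_{\rm loc}(\Omega_T)$ for some $\varepsilon>0$, then there exists a constant $C=C(\varepsilon,V_o)>0$ such that for every cylinder $Q_{4r}=B_{4r}\times I_{4r}\Subset\Omega_T$ we have $$u\in L^\infty\big(I_r;\exp\big(\sqrt[\gamma]{L(B_r)}\big)\big),$$ where $$\gamma := C\left[\left(r^2\frac{1}{|Q_{4r}|}\int_{Q_{4r}}|\omega|^2\,dx\,dt+1\right)^{\frac12}\left(\frac{1}{|Q_{4r}|}\int_{Q_{4r}}|u|^{2+\varepsilon}\,dx\,dt+1\right)^{\frac1{2+\varepsilon}}+\operatorname*{ess\,sup}_{t\in I_{4r}}\frac{1}{|B_{4r}|}\int_{B_{4r}}|u(x,t)|\,dx\right].$$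
   Context: **Cylinders.** For $r>0$, $Q_r=B_r\times I_r$ with $B_r=B_r(x_o)$ the open ball of radius $r$ and $I_r=(t_o-r,t_o)$, for a centre $(x_o,t_o)$ (by translation one may take $x_o=0$, $t_o=0$). In one statement all cylinders share the same centre $(x_o,t_o)$. The parabolic boundary is $\partial_p\Omega_T=(\partial\Omega\times[0,T])\cup(\Omega\times\{0\})$. **Weak solution.** A vector field $u\in L^2_{\rm loc}(\Omega_T)$ is a weak solution of the Euler equations in $\Omega_T$ if $\int_\Omega u(x,t)\cdot\nabla\psi(x)\,dx=0$ for every $\psi\in H^1_0(\Omega)$ and almost every $t\in[0,T]$, and $$\int_0^T\int_\Omega \Big(u\cdot\partial_t\phi+\sum_{i=1}^2 u_i\,(u\cdot\nabla)\phi_i\Big)\,dx\,dt=0$$ for every smooth vector-valued test function $\phi$ with compact support in space-time such that $\nabla\cdot\phi=0$. **Vorticity estimates (VE).** A weak solution $u$ satisfies the vorticity estimates with constant $V_o>0$ if $\omega=\partial_{x_1}u_2-\partial_{x_2}u_1\in L^2_{\rm loc}(\Omega_T)$ and $$\operatorname*{ess\,sup}_{0\le t\le T}\int_\Omega|\omega|^{1+\alpha}\zeta(x,t)\,dx\le V_o\int_0^T\int_\Omega|\omega|^{1+\alpha}\big[|u||\nabla\zeta|+|\partial_t\zeta|\big]\,dx\,dt$$ for every $\alpha\in[0,1)$ and every non-negative $\zeta\in C^\infty(\Omega_T)$ vanishing in a neighbourhood of $\partial_p\Omega_T$. **Exponential class.** For $\gamma>0$, a function $v$ belongs to $\exp(\sqrt[\gamma]{L(B)})$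 if $\int_B e^{|v(x)|^{1/\gamma}}\,dx<\infty$. The membership $u\in L^\infty(I;\exp(\sqrt[\gamma]{L(B)}))$ means $\operatorname*{ess\,sup}_{t\in I}\int_B e^{|u(x,t)|^{1/\gamma}}\,dx<\infty$. *)

theory Defs
  imports "HOL-Probability.Essential_Supremum"
begin

text \<open>
  Space-time points are pairs \<open>z = (x, t)\<close> of type \<open>(real^2) \<times> real\<close>. Measurability is Lebesgue
  measurability, double integrals \<open>dx dt\<close> are Lebesgue integrals over space-time, and functions
  are total, only their values on the domain at hand being used.
\<close>

subsection \<open>Derivatives and smooth functions\<close>

definition grad :: "(real^2 \<Rightarrow> real) \<Rightarrow> real^2 \<Rightarrow> real^2" where
  "grad f x = (\<chi> i. frechet_derivative f (at x) (axis i 1))"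

definition grad_x :: "((real^2) \<times> real \<Rightarrow> real) \<Rightarrow> (real^2) \<times> real \<Rightarrow> real^2" where
  "grad_x f z = grad (\<lambda>y. f (y, snd z)) (fst z)"

definition d_t :: "((real^2) \<times> real \<Rightarrow> 'b::real_normed_vector) \<Rightarrow> (real^2) \<times> real \<Rightarrow> 'b" where
  "d_t f z = vector_derivative (\<lambda>s. f (fst z, s)) (at (snd z))"

definition div_x :: "((real^2) \<times> real \<Rightarrow> real^2) \<Rightarrow> (real^2) \<times> real \<Rightarrow> real" where
  "div_x \<phi> z = (\<Sum>i\<in>UNIV. grad_x (\<lambda>w. \<phi> w $ i) z $ i)"

text \<open>
  To be used on open sets of finite-dimensional spaces, where continuity of all iterated
  directional derivatives amounts to continuity of the iterated Frechet derivatives.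
\<close>

primrec Ck_on :: "nat \<Rightarrow> ('a::real_normed_vector \<Rightarrow> 'b::real_normed_vector) \<Rightarrow> 'a set \<Rightarrow> bool" where
  "Ck_on 0 f S = continuous_on S f"
| "Ck_on (Suc k) f S =
     ((\<forall>x\<in>S. f differentiable (at x)) \<and> (\<forall>v. Ck_on k (\<lambda>x. frechet_derivative f (at x) v) S))"

definition smooth_on :: "('a::real_normed_vector \<Rightarrow> 'b::real_normed_vector) \<Rightarrow> 'a set \<Rightarrow> bool" where
  "smooth_on f S \<longleftrightarrow> (\<forall>k. Ck_on k f S)"

definition test_functions :: "'a::euclidean_space set \<Rightarrow> ('a \<Rightarrow> 'b::euclidean_space) set" where
  "test_functions U =
     {\<phi>. smooth_on \<phi> UNIV \<and> compact (closure {z. \<phi> z \<noteq> 0}) \<and> closure {z. \<phi> z \<noteq> 0} \<subseteq> U}"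

subsection \<open>Function spaces\<close>

definition Lp :: "real \<Rightarrow> 'a::euclidean_space set \<Rightarrow> ('a \<Rightarrow> 'b::euclidean_space) \<Rightarrow> bool" where
  "Lp p S f \<longleftrightarrow> set_borel_measurable lebesgue S f \<and> set_integrable lebesgue S (\<lambda>z. norm (f z) powr p)"

definition Lp_loc :: "real \<Rightarrow> 'a::euclidean_space set \<Rightarrow> ('a \<Rightarrow> 'b::euclidean_space) \<Rightarrow> bool" where
  "Lp_loc p S f \<longleftrightarrow> (\<forall>K. compact K \<and> K \<subseteq> S \<longrightarrow> Lp p K f)"

definition weak_gradient :: "(real^2) set \<Rightarrow> (real^2 \<Rightarrow> real) \<Rightarrow> (real^2 \<Rightarrow> real^2) \<Rightarrow> bool" where
  "weak_gradient \<Omega> \<psi> g \<longleftrightarrow> Lp_loc 1 \<Omega> \<psi> \<and> Lp_loc 1 \<Omega> g \<and>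
     (\<forall>\<eta>\<in>test_functions \<Omega>. \<forall>i.
        (LINT x:\<Omega>|lebesgue. \<psi> x * grad \<eta> x $ i) = - (LINT x:\<Omega>|lebesgue. g x $ i * \<eta> x))"

text \<open>The closure of the test functions in the \<open>H\<^sup>1\<close> norm.\<close>

definition H10 :: "(real^2) set \<Rightarrow> (real^2 \<Rightarrow> real) set" where
  "H10 \<Omega> = {\<psi>. \<exists>g. Lp 2 \<Omega> \<psi> \<and> Lp 2 \<Omega> g \<and> weak_gradient \<Omega> \<psi> g \<and>
     (\<exists>\<phi>. (\<forall>n::nat. \<phi> n \<in> test_functions \<Omega>) \<and>
       (\<lambda>n. LINT x:\<Omega>|lebesgue. (\<phi> n x - \<psi> x)\<^sup>2 + (norm (grad (\<phi> n) x - g x))\<^sup>2) \<longlonglongrightarrow> 0)}"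

subsection \<open>Domains and cylinders\<close>

definition Omega_T :: "(real^2) set \<Rightarrow> real \<Rightarrow> ((real^2) \<times> real) set" where
  "Omega_T \<Omega> T = \<Omega> \<times> {0<..T}"

definition parabolic_boundary :: "(real^2) set \<Rightarrow> real \<Rightarrow> ((real^2) \<times> real) set" where
  "parabolic_boundary \<Omega> T = (frontier \<Omega> \<times> {0..T}) \<union> (\<Omega> \<times> {0})"

definition time_interval :: "real \<Rightarrow> real \<Rightarrow> real set" where
  "time_interval t0 r = {t0 - r<..<t0}"

definition cylinder :: "real^2 \<Rightarrow> real \<Rightarrow> real \<Rightarrow> ((real^2) \<times> real) set" where
  "cylinder x0 t0 r = ball x0 r \<times> time_interval t0 r"

definition compactly_contained :: "'a::topological_space set \<Rightarrow> 'a set \<Rightarrow> bool" where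
  "compactly_contained A B \<longleftrightarrow> compact (closure A) \<and> closure A \<subseteq> B"

definition average :: "'a::euclidean_space set \<Rightarrow> ('a \<Rightarrow> real) \<Rightarrow> real" where
  "average A f = (1 / measure lebesgue A) * (LINT z:A|lebesgue. f z)"

definition Linfty_loc_L2_loc :: "(real^2) set \<Rightarrow> real \<Rightarrow> ((real^2) \<times> real \<Rightarrow> real^2) \<Rightarrow> bool" where
  "Linfty_loc_L2_loc \<Omega> T u \<longleftrightarrow> set_borel_measurable lebesgue (Omega_T \<Omega> T) u \<and>
     (\<forall>K a b. compact K \<and> K \<subseteq> \<Omega> \<and> 0 < a \<and> a \<le> b \<and> b < T \<longrightarrow>
        esssup (lebesgue_on {a..b})
          (\<lambda>t. \<integral>\<^sup>+x\<in>K. ennreal ((norm (u (x, t)))\<^sup>2) \<partial>lebesgue) < \<infinity>)"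

definition Linfty_exp ::
  "real \<Rightarrow> real set \<Rightarrow> (real^2) set \<Rightarrow> ((real^2) \<times> real \<Rightarrow> real^2) \<Rightarrow> bool" where
  "Linfty_exp \<gamma> I B u \<longleftrightarrow>
     esssup (lebesgue_on I)
       (\<lambda>t. \<integral>\<^sup>+x\<in>B. ennreal (exp (norm (u (x, t)) powr (1 / \<gamma>))) \<partial>lebesgue) < \<infinity>"

subsection \<open>Weak solutions and vorticity estimates\<close>

text \<open>
  As \<open>u\<close> is only locally square integrable, \<open>u(\<cdot>, t) \<bullet> g\<close> need not be integrable over \<open>\<Omega>\<close>
  unless \<open>\<psi>\<close> has compact support. The Bochner integral of a non-integrable function is 0, so
  solenoidality is tested exactly when the integral makes sense.
  The test functions of the momentum equation have compact support in the open set
  \<open>\<Omega> \<times> (0, T)\<close>, so that there is no boundary term at time \<open>T\<close>.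
\<close>

definition weak_solution :: "(real^2) set \<Rightarrow> real \<Rightarrow> ((real^2) \<times> real \<Rightarrow> real^2) \<Rightarrow> bool" where
  "weak_solution \<Omega> T u \<longleftrightarrow>
     Lp_loc 2 (Omega_T \<Omega> T) u \<and>
     (\<forall>\<psi>\<in>H10 \<Omega>. \<forall>g. weak_gradient \<Omega> \<psi> g \<longrightarrow>
        (AE t in lebesgue_on {0..T}. (LINT x:\<Omega>|lebesgue. u (x, t) \<bullet> g x) = 0)) \<and>
     (\<forall>\<phi>\<in>test_functions (\<Omega> \<times> {0<..<T}). (\<forall>z. div_x \<phi> z = 0) \<longrightarrow>
        (LINT z:Omega_T \<Omega> T|lebesgue.
           u z \<bullet> d_t \<phi> z + (\<Sum>i\<in>UNIV. u z $ i * (u z \<bullet> grad_x (\<lambda>w. \<phi> w $ i) z))) = 0)"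

text \<open>\<open>\<omega> = \<partial>\<^sub>1 u\<^sub>2 - \<partial>\<^sub>2 u\<^sub>1\<close> in the sense of distributions on \<open>\<Omega> \<times> (0, T)\<close>.\<close>

definition is_vorticity ::
  "(real^2) set \<Rightarrow> real \<Rightarrow> ((real^2) \<times> real \<Rightarrow> real^2) \<Rightarrow> ((real^2) \<times> real \<Rightarrow> real) \<Rightarrow> bool" where
  "is_vorticity \<Omega> T u \<omega> \<longleftrightarrow>
     (\<forall>\<eta>\<in>test_functions (\<Omega> \<times> {0<..<T}).
        (LINT z:Omega_T \<Omega> T|lebesgue. \<omega> z * \<eta> z) =
        (LINT z:Omega_T \<Omega> T|lebesgue. u z $ 1 * grad_x \<eta> z $ 2 - u z $ 2 * grad_x \<eta> z $ 1))"

text \<open>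
  \<open>C\<^sup>\<infinity>(\<Omega>\<^sub>T)\<close> means smooth up to and including time \<open>T\<close>: there is a smooth extension to an open
  neighbourhood of \<open>\<Omega>\<^sub>T\<close>. The cut-off functions are not required to have bounded support, so
  both sides of the estimate may be infinite.
\<close>

definition VE_cutoffs :: "(real^2) set \<Rightarrow> real \<Rightarrow> ((real^2) \<times> real \<Rightarrow> real) set" where
  "VE_cutoffs \<Omega> T = {\<zeta>.
     (\<exists>W. open W \<and> Omega_T \<Omega> T \<subseteq> W \<and> smooth_on \<zeta> W) \<and>
     (\<forall>z\<in>Omega_T \<Omega> T. 0 \<le> \<zeta> z) \<and>
     (\<exists>N. open N \<and> parabolic_boundary \<Omega> T \<subseteq> N \<and> (\<forall>z\<in>N \<inter> Omega_T \<Omega> T. \<zeta> z = 0))}"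

definition vorticity_estimates ::
  "(real^2) set \<Rightarrow> real \<Rightarrow> ((real^2) \<times> real \<Rightarrow> real^2) \<Rightarrow> ((real^2) \<times> real \<Rightarrow> real) \<Rightarrow> real \<Rightarrow> bool" where
  "vorticity_estimates \<Omega> T u \<omega> Vo \<longleftrightarrow>
     is_vorticity \<Omega> T u \<omega> \<and> Lp_loc 2 (Omega_T \<Omega> T) \<omega> \<and>
     (\<forall>\<alpha>\<in>{0..<1}. \<forall>\<zeta>\<in>VE_cutoffs \<Omega> T.
        esssup (lebesgue_on {0..T})
          (\<lambda>t. \<integral>\<^sup>+x\<in>\<Omega>. ennreal (\<bar>\<omega> (x, t)\<bar> powr (1 + \<alpha>) * \<zeta> (x, t)) \<partial>lebesgue)
        \<le> ennreal Vo *
          (\<integral>\<^sup>+z\<in>Omega_T \<Omega> T. ennreal (\<bar>\<omega> z\<bar> powr (1 + \<alpha>) *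
             (norm (u z) * norm (grad_x \<zeta> z) + \<bar>d_t \<zeta> z\<bar>)) \<partial>lebesgue))"

end

theory Submission
  imports Defs "HOL-Probability.Distribution_Functions" "HOL-Probability.Sinc_Integral"
begin

text \<open>
  The vorticity estimate with exponent \<open>1 + \<alpha> = 2 - 2 / q\<close> pairs \<open>\<omega> \<in> L\<^sup>2\<close> with \<open>u \<in> L\<^sup>q\<close> by
  Hoelder's inequality and bounds \<open>\<omega>\<close> in \<open>L\<^sup>\<infinity>\<close> in time with values in \<open>L\<^bsup>2 - 2/q\<^esup>\<close> on a smaller
  cylinder. Since \<open>u\<close> is locally a Riesz potential of \<open>\<omega>\<close> plus a bounded term (Biot-Savart), Young's
  convolution inequality returns \<open>u \<in> L\<^bsup>\<lambda> q\<^esup>\<close> with a fixed \<open>\<lambda> > 1\<close>, and the new norm is at most a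
  power \<open>\<theta> < 1\<close> of the old one times a constant that is polynomial in \<open>q\<close>. Iterating along
  \<open>q\<^sub>n = (2 + \<epsilon>) \<lambda>\<^sup>n\<close>, the norms grow at most geometrically in \<open>n\<close>, hence polynomially in the
  exponent, at a rate depending on \<open>\<epsilon>\<close> only, and this is integrability of \<open>exp (|u|\<^bsup>1/\<gamma>\<^esup>)\<close> as soon
  as \<open>\<gamma>\<close> is at least a constant depending on \<open>\<epsilon>\<close>. The bracket in the definition of \<open>\<gamma>\<close> is at
  least \<open>1\<close>.
\<close>

subsection \<open>Smooth functions and cut-offs\<close>

text \<open>Two obstacles shape the proof. The first is null sets: the divergence and vorticity
  identities hold for almost every time, with an exceptional set depending on the test function,
  whereas Biot-Savart tests with kernels centred at uncountably many points \<open>y\<close>. The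
  kernel is therefore regularised to \<open>z / (|z|^2 + \<delta>^2)\<close>, a smooth gradient
  whose divergence is an approximate identity up to a constant. For fixed \<open>y\<close> and
  countably many \<delta> one gets bounds at almost every time, Fubini exchanges \<open>y\<close>
  and \<open>t\<close>, and only then does \<delta> tend to 0. Borel versions of the solution, zero
  outside a compact cylinder, make the sets in this exchange measurable. The second is time. The
  right side of (VE) integrates up to \<open>T\<close>, so localising at \<open>t0 < T\<close> needs
  a cut-off after \<open>t0\<close> as well, and the cylinders of the iteration grow forward. There
  the supremum over the given cylinder says nothing, and the local \<open>L^2\<close> bound on
  slices takes over. That bound stops short of \<open>T\<close>, but for \<open>t0 = T\<close>
  nothing lies beyond \<open>t0\<close>, as cut-offs may be nonzero at time
  \<open>T\<close>.\<close>

lemma Ck_on_SucI: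
  assumes "\<And>x. (f has_derivative f' x) (at x)" "\<And>v. Ck_on k (\<lambda>x. f' x v) UNIV"
  shows "Ck_on (Suc k) f UNIV"
proof -
  have "frechet_derivative f (at x) = f' x" for x
    using frechet_derivative_at[OF assms(1)] by simp
  then show ?thesis using assms by (auto simp: differentiable_def)
qed

lemma Ck_on_Suc_has_derivative:
  assumes "Ck_on (Suc k) f UNIV"
  shows "(f has_derivative frechet_derivative f (at x)) (at x)"
    and "Ck_on k (\<lambda>x. frechet_derivative f (at x) v) UNIV"
  using assms frechet_derivative_works by auto

lemma Ck_on_Suc_imp: "Ck_on (Suc k) f UNIV \<Longrightarrow> Ck_on k f UNIV"
proof (induction k arbitrary: f)
  case 0
  then show ?case by (auto intro!: continuous_at_imp_continuous_on differentiable_imp_continuous_within)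
next
  case (Suc k)
  then show ?case by (meson Ck_on.simps(2))
qed

lemma Ck_on_const: "Ck_on k (\<lambda>x. c) UNIV"
  by (induction k arbitrary: c) (auto intro!: Ck_on_SucI[where f' = "\<lambda>_ _. 0"] simp del: Ck_on.simps(2))

lemma Ck_on_bounded_linear:
  assumes "bounded_linear L"
  shows "Ck_on k L UNIV"
proof (cases k)
  case 0
  then show ?thesis using assms by (simp add: linear_continuous_on)
next
  case (Suc j)
  then show ?thesis
    using assms by (auto intro!: Ck_on_SucI[where f' = "\<lambda>_. L"] Ck_on_const simp del: Ck_on.simps(2)
        simp: bounded_linear_imp_has_derivative)
qed

lemma Ck_on_add:
  "Ck_on k f UNIV \<Longrightarrow> Ck_on k g UNIV \<Longrightarrow> Ck_on k (\<lambda>x. f x + g x) UNIV"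
proof (induction k arbitrary: f g)
  case (Suc k)
  note f = Ck_on_Suc_has_derivative[OF Suc.prems(1)] and g = Ck_on_Suc_has_derivative[OF Suc.prems(2)]
  show ?case
    by (rule Ck_on_SucI[OF has_derivative_add[OF f(1) g(1)] Suc.IH[OF f(2) g(2)]])
qed (auto intro: continuous_on_add)

lemma Ck_on_mult:
  fixes f g :: "'a::real_normed_vector \<Rightarrow> real"
  shows "Ck_on k f UNIV \<Longrightarrow> Ck_on k g UNIV \<Longrightarrow> Ck_on k (\<lambda>x. f x * g x) UNIV"
proof (induction k arbitrary: f g)
  case (Suc k)
  note f = Ck_on_Suc_has_derivative[OF Suc.prems(1)] and g = Ck_on_Suc_has_derivative[OF Suc.prems(2)]
  show ?case
    by (rule Ck_on_SucI[OF has_derivative_mult[OF f(1) g(1)]])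
      (intro Ck_on_add Suc.IH f(2) g(2) Ck_on_Suc_imp[OF Suc.prems(1)] Ck_on_Suc_imp[OF Suc.prems(2)])
qed (auto intro: continuous_on_mult)

lemma Ck_on_inverse:
  fixes f :: "'a::real_normed_vector \<Rightarrow> real"
  assumes "\<And>x. f x \<noteq> 0"
  shows "Ck_on k f UNIV \<Longrightarrow> Ck_on k (\<lambda>x. inverse (f x)) UNIV"
proof (induction k)
  case 0
  then show ?case using assms by (auto intro: continuous_on_inverse)
next
  case (Suc k)
  note f = Ck_on_Suc_has_derivative[OF Suc.prems]
  have i: "Ck_on k (\<lambda>x. inverse (f x)) UNIV"
    by (rule Suc.IH[OF Ck_on_Suc_imp[OF Suc.prems]])
  \<comment> \<open>Written as a product of \<open>inverse f\<close>, the derivative of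
    \<open>f\<close> and a constant, this falls under the product rule and the induction hypothesis
    at order \<open>k\<close>.\<close>
  have "((\<lambda>x. inverse (f x)) has_derivative
      (\<lambda>v. (- 1) * ((inverse (f x) * frechet_derivative f (at x) v) * inverse (f x)))) (at x)" for x
    using Deriv.has_derivative_inverse[OF assms f(1)] by simp
  then show ?case
    by (rule Ck_on_SucI) (intro Ck_on_mult i f(2) Ck_on_const)
qed

lemma Ck_on_compose_real:
  fixes f :: "'a::real_normed_vector \<Rightarrow> real" and g :: "real \<Rightarrow> real"
  shows "Ck_on k g UNIV \<Longrightarrow> Ck_on k f UNIV \<Longrightarrow> Ck_on k (\<lambda>x. g (f x)) UNIV"
proof (induction k arbitrary: g f)
  case 0
  then show ?case by (auto intro: continuous_on_compose2)
next
  case (Suc k)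
  note g = Ck_on_Suc_has_derivative[OF Suc.prems(1)] and f = Ck_on_Suc_has_derivative[OF Suc.prems(2)]
  \<comment> \<open>Linearity on the line splits off the increment, so that the chain rule yields a
    product of two functions of order \<open>k\<close> instead of a composition of linear
    maps.\<close>
  have g1: "frechet_derivative g (at y) v = v * frechet_derivative g (at y) 1" for y v
    using linear_scale[OF has_derivative_linear[OF g(1)[of y]], of v 1] by simp
  have "((\<lambda>x. g (f x)) has_derivative
      (\<lambda>v. frechet_derivative f (at x) v * frechet_derivative g (at (f x)) 1)) (at x)" for x
  proof -
    have eq: "(\<lambda>v. frechet_derivative g (at (f x)) (frechet_derivative f (at x) v)) =
        (\<lambda>v. frechet_derivative f (at x) v * frechet_derivative g (at (f x)) 1)"
      by (rule ext) (rule g1)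
    show ?thesis
      using has_derivative_compose[OF f(1)[of x] g(1)[of "f x"]] unfolding eq .
  qed
  then show ?case
    by (rule Ck_on_SucI) (rule Ck_on_mult[OF f(2) Suc.IH[OF g(2) Ck_on_Suc_imp[OF Suc.prems(2)]]])
qed

lemma Ck_on_compose_affine:
  fixes L :: "'a::real_normed_vector \<Rightarrow> 'b::real_normed_vector"
  assumes L: "bounded_linear L"
  shows "Ck_on k f UNIV \<Longrightarrow> Ck_on k (\<lambda>x. f (L x + c)) UNIV"
proof (induction k arbitrary: f)
  case 0
  have "continuous_on UNIV (\<lambda>x. L x + c)"
    by (intro continuous_intros linear_continuous_on L)
  then show ?case using 0 by (auto intro: continuous_on_compose2)
next
  case (Suc k)
  note f = Ck_on_Suc_has_derivative[OF Suc.prems]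
  have 1: "((\<lambda>x. L x + c) has_derivative L) (at x)" for x
    using bounded_linear_imp_has_derivative[OF L] by (auto intro!: derivative_eq_intros)
  show ?case
    by (rule Ck_on_SucI[OF has_derivative_compose[OF 1 f(1)]]) (rule Suc.IH[OF f(2)])
qed

lemma smooth_onI: "(\<And>k. Ck_on k f S) \<Longrightarrow> smooth_on f S"
  and smooth_onD: "smooth_on f S \<Longrightarrow> Ck_on k f S"
  by (auto simp: smooth_on_def)

lemma smooth_on_const: "smooth_on (\<lambda>x. c) UNIV"
  and smooth_on_bounded_linear: "bounded_linear L \<Longrightarrow> smooth_on L UNIV"
  and smooth_on_add: "smooth_on f UNIV \<Longrightarrow> smooth_on f2 UNIV \<Longrightarrow> smooth_on (\<lambda>x. f x + f2 x) UNIV"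
  by (blast intro: smooth_onI smooth_onD Ck_on_const Ck_on_bounded_linear Ck_on_add)+

lemma smooth_on_mult:
  fixes f g :: "'a::real_normed_vector \<Rightarrow> real"
  shows "smooth_on f UNIV \<Longrightarrow> smooth_on g UNIV \<Longrightarrow> smooth_on (\<lambda>x. f x * g x) UNIV"
  by (blast intro: smooth_onI Ck_on_mult smooth_onD)

lemma smooth_on_inverse:
  fixes f :: "'a::real_normed_vector \<Rightarrow> real"
  shows "smooth_on f UNIV \<Longrightarrow> (\<And>x. f x \<noteq> 0) \<Longrightarrow> smooth_on (\<lambda>x. inverse (f x)) UNIV"
  by (blast intro: smooth_onI Ck_on_inverse smooth_onD)

lemma smooth_on_compose_real:
  fixes f :: "'a::real_normed_vector \<Rightarrow> real" and g :: "real \<Rightarrow> real"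
  shows "smooth_on g UNIV \<Longrightarrow> smooth_on f UNIV \<Longrightarrow> smooth_on (\<lambda>x. g (f x)) UNIV"
  by (blast intro: smooth_onI Ck_on_compose_real smooth_onD)

lemma smooth_on_compose_affine:
  "smooth_on f UNIV \<Longrightarrow> bounded_linear L \<Longrightarrow> smooth_on (\<lambda>x. f (L x + c)) UNIV"
  by (blast intro: smooth_onI Ck_on_compose_affine smooth_onD)

lemma smooth_on_has_derivative:
  assumes "smooth_on f UNIV"
  shows "(f has_derivative frechet_derivative f (at x)) (at x)"
    and "smooth_on (\<lambda>x. frechet_derivative f (at x) v) UNIV"
proof -
  have *: "Ck_on (Suc k) f UNIV" for k
    using assms by (simp add: smooth_on_def del: Ck_on.simps)
  show "(f has_derivative frechet_derivative f (at x)) (at x)"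
    by (rule Ck_on_Suc_has_derivative[OF *])
  show "smooth_on (\<lambda>x. frechet_derivative f (at x) v) UNIV"
    by (rule smooth_onI, rule Ck_on_Suc_has_derivative[OF *])
qed

lemma smooth_on_continuous: "smooth_on f UNIV \<Longrightarrow> continuous_on UNIV f"
  using Ck_on.simps(1) smooth_onD by blast

text \<open>\<open>exp (- 1 / x)\<close> times a polynomial in \<open>1 / x\<close>: a family closed under differentiation.\<close>

definition flat :: "real poly \<Rightarrow> real \<Rightarrow> real" where
  "flat p x = (if x > 0 then poly p (1 / x) * exp (- (1 / x)) else 0)"

text \<open>With \<open>y = 1 / x\<close> one has \<open>dy/dx = - y^2\<close>, so differentiating
  \<open>p(y) exp(-y)\<close> gives \<open>y^2 (p - p')(y) exp(-y)\<close>.\<close>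

definition flat_deriv :: "real poly \<Rightarrow> real poly" where
  "flat_deriv p = [:0, 0, 1:] * (p - pderiv p)"

lemma poly_times_exp_minus_tendsto_0: "((\<lambda>y. poly p y * exp (- y)) \<longlongrightarrow> (0::real)) at_top"
proof -
  have "((\<lambda>y. \<Sum>i\<le>degree p. coeff p i * (y ^ i / exp y)) \<longlongrightarrow> (\<Sum>i\<le>degree p. coeff p i * 0)) at_top"
    by (intro tendsto_intros tendsto_power_div_exp_0)
  moreover have "(\<lambda>y. \<Sum>i\<le>degree p. coeff p i * (y ^ i / exp y)) = (\<lambda>y. poly p y * exp (- y))"
    by (auto simp: poly_altdef exp_minus sum_distrib_right divide_simps)
  ultimately show ?thesis by simp
qed

lemma flat_has_derivative: "(flat p has_real_derivative flat (flat_deriv p) x) (at x)"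
proof (cases "x = 0")
  case False
  show ?thesis
  proof (cases "x > 0")
    case True
    have "((\<lambda>x. poly p (1 / x) * exp (- (1 / x))) has_real_derivative
        flat (flat_deriv p) x) (at x)"
      using True by (auto intro!: derivative_eq_intros poly_DERIV[THEN DERIV_chain2]
          simp: flat_def flat_deriv_def field_simps power2_eq_square)
    then show ?thesis
      by (rule DERIV_cong_ev[THEN iffD1, rotated -1])
        (use True in \<open>auto simp: flat_def eventually_nhds intro!: exI[of _ "{0<..}"]\<close>)
  next
    case neg: False
    have "((\<lambda>x. 0) has_real_derivative flat (flat_deriv p) x) (at x)"
      using neg by (simp add: flat_def)
    then show ?thesis
      by (rule DERIV_cong_ev[THEN iffD1, rotated -1])
        (use neg False in \<open>auto simp: flat_def eventually_nhds intro!: exI[of _ "{..<0}"]\<close>)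
  qed
next
  case True
  have "((\<lambda>h. flat p h / h) \<longlongrightarrow> 0) (at 0)"
  proof (rule filterlim_split_at)
    show "((\<lambda>h. flat p h / h) \<longlongrightarrow> 0) (at_left 0)"
      by (rule tendsto_eventually) (auto simp: eventually_at_left_field flat_def intro!: exI[of _ "-1"])
    \<comment> \<open>With \<open>y = 1 / h\<close>, division by \<open>h\<close> is multiplication
      by \<open>y\<close>, hence the shifted polynomial; the exponential wins as \<open>y\<close>
      grows.\<close>
    have "((\<lambda>h. poly (pCons 0 p) (inverse h) * exp (- inverse h)) \<longlongrightarrow> (0::real)) (at_right 0)"
      by (rule filterlim_compose[OF poly_times_exp_minus_tendsto_0 filterlim_inverse_at_top_right])
    then show "((\<lambda>h. flat p h / h) \<longlongrightarrow> 0) (at_right 0)"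
      by (rule Lim_transform_eventually)
        (auto simp: eventually_at_right_field flat_def field_simps intro!: exI[of _ 1])
  qed
  then show ?thesis
    using True by (simp add: DERIV_def flat_def)
qed

lemma smooth_on_flat: "smooth_on (flat p) UNIV"
proof -
  have "Ck_on k (flat p) UNIV" for k
  proof (induction k arbitrary: p)
    case 0
    show ?case
      using DERIV_continuous[OF flat_has_derivative] by (auto intro!: continuous_at_imp_continuous_on)
  next
    case (Suc k)
    show ?case
      by (rule Ck_on_SucI[OF flat_has_derivative[unfolded has_field_derivative_def]])
        (intro Ck_on_mult Suc Ck_on_const)
  qed
  then show ?thesis by (rule smooth_onI)
qed

text \<open>The usual quotient of flat functions, with its transition between 1/2 and 1. Starting at
  1/2 instead of 0 keeps the supports of rescaled copies compactly inside open intervals and makes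
  the derivative vanish already at 0.\<close>

definition smooth_step :: "real \<Rightarrow> real" where
  "smooth_step x = flat 1 (2 * x - 1) * inverse (flat 1 (2 * x - 1) + flat 1 (2 - 2 * x))"

lemma flat_nonneg: "0 \<le> flat 1 x" and flat_pos: "x > 0 \<Longrightarrow> 0 < flat 1 x"
  and flat_nonpos: "x \<le> 0 \<Longrightarrow> flat p x = 0"
  by (simp_all add: flat_def)

text \<open>The two arguments add up to 1, so they cannot both be nonpositive.\<close>

lemma smooth_step_denominator_pos: "flat 1 (2 * x - 1) + flat 1 (2 - 2 * x) > 0"
proof (cases "2 * x - 1 > 0")
  case True
  then show ?thesis using flat_pos[of "2 * x - 1"] flat_nonneg[of "2 - 2 * x"] by linarith
next
  case False
  then show ?thesis using flat_pos[of "2 - 2 * x"] flat_nonneg[of "2 * x - 1"] by linarith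
qed

lemma smooth_step_nonneg: "0 \<le> smooth_step x"
  using smooth_step_denominator_pos[of x] by (simp add: smooth_step_def flat_nonneg)

lemma smooth_step_le_1: "smooth_step x \<le> 1"
  using smooth_step_denominator_pos[of x] flat_nonneg[of "2 - 2 * x"]
  by (simp add: smooth_step_def divide_inverse[symmetric])

lemma smooth_step_eq_0: "x \<le> 1/2 \<Longrightarrow> smooth_step x = 0"
  by (simp add: smooth_step_def flat_nonpos)

lemma smooth_step_eq_1: "x \<ge> 1 \<Longrightarrow> smooth_step x = 1"
  using flat_pos[of "2 * x - 1"] by (simp add: smooth_step_def flat_nonpos)

lemma smooth_on_smooth_step: "smooth_on smooth_step UNIV"
proof -
  have "smooth_on (\<lambda>x. flat 1 (2 * x + (-1))) UNIV" "smooth_on (\<lambda>x. flat 1 (-2 * x + 2)) UNIV"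
    by (rule smooth_on_compose_affine[OF smooth_on_flat bounded_linear_mult_right])+
  then have *: "smooth_on (\<lambda>x. flat 1 (2 * x - 1)) UNIV" "smooth_on (\<lambda>x. flat 1 (2 - 2 * x)) UNIV"
    by (simp_all add: algebra_simps)
  show ?thesis
    unfolding smooth_step_def
    by (intro smooth_on_mult smooth_on_inverse smooth_on_add * less_imp_neq[THEN not_sym] smooth_step_denominator_pos)
qed

text \<open>All cut-offs below are rescaled copies of \<open>smooth_step\<close>. This one bound,
  from continuity on \<open>{0..1}\<close> and constancy outside, therefore makes their derivatives
  inversely proportional to the width of the transition.\<close>

lemma smooth_step_derivative_bounded:
  obtains M where "M > 0" "\<And>x. (smooth_step has_real_derivative deriv smooth_step x) (at x)"
    "\<And>x. \<bar>deriv smooth_step x\<bar> \<le> M" "\<And>x. x < 1/2 \<Longrightarrow> deriv smooth_step x = 0" "\<And>x. x > 1 \<Longrightarrow> deriv smooth_step x = 0"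
    "smooth_on (deriv smooth_step) UNIV"
proof -
  note sm = smooth_on_has_derivative[OF smooth_on_smooth_step]
  have lin: "frechet_derivative smooth_step (at x) v = frechet_derivative smooth_step (at x) 1 * v" for x v
    using linear_scale[OF has_derivative_linear[OF sm(1)[of x]], of v 1] by simp
  have D: "(smooth_step has_real_derivative frechet_derivative smooth_step (at x) 1) (at x)" for x
  proof -
    have "frechet_derivative smooth_step (at x) = (*) (frechet_derivative smooth_step (at x) 1)"
      by (rule ext) (rule lin)
    then show ?thesis
      unfolding has_field_derivative_def using sm(1)[of x] by metis
  qed
  then have d: "deriv smooth_step = (\<lambda>x. frechet_derivative smooth_step (at x) 1)"
    by (intro ext DERIV_imp_deriv)
  have 0: "deriv smooth_step x = 0" if "x < 1/2" for x
  proof -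
    have "(smooth_step has_real_derivative 0) (at x)"
      by (rule DERIV_cong_ev[THEN iffD1, OF refl _ refl DERIV_const[of 0]])
        (use that in \<open>auto simp: eventually_nhds smooth_step_eq_0 intro!: exI[of _ "{..<1/2}"]\<close>)
    then show ?thesis by (rule DERIV_imp_deriv)
  qed
  have 1: "deriv smooth_step x = 0" if "x > 1" for x
  proof -
    have "(smooth_step has_real_derivative 0) (at x)"
      by (rule DERIV_cong_ev[THEN iffD1, OF refl _ refl DERIV_const[of 1]])
        (use that in \<open>auto simp: eventually_nhds smooth_step_eq_1 intro!: exI[of _ "{1<..}"]\<close>)
    then show ?thesis by (rule DERIV_imp_deriv)
  qed
  have s: "smooth_on (deriv smooth_step) UNIV" unfolding d by (rule sm)
  have "compact (deriv smooth_step ` {0..1})"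
    by (rule compact_continuous_image[OF continuous_on_subset[OF smooth_on_continuous[OF s] subset_UNIV]]) simp
  then obtain M where M: "M > 0" "\<And>y. y \<in> deriv smooth_step ` {0..1} \<Longrightarrow> norm y \<le> M"
    by (meson compact_imp_bounded bounded_pos)
  have M': "\<bar>deriv smooth_step x\<bar> \<le> M" for x
  proof (cases "x \<in> {0..1}")
    case False
    then have "deriv smooth_step x = 0" using 0[of x] 1[of x] by auto
    then show ?thesis using M(1) by simp
  qed (use M(2) in simp)
  have D': "(smooth_step has_real_derivative deriv smooth_step x) (at x)" for x
    using D unfolding d .
  show thesis by (rule that[OF M(1) D' M' 0 1 s])
qed

section \<open>Gradients and radial cut-offs\<close>

lemma grad_eqI: "(f has_derivative f') (at x) \<Longrightarrow> grad f x = (\<chi> i. f' (axis i 1))"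
  using frechet_derivative_at unfolding grad_def by metis

lemma grad_nth: "(f has_derivative f') (at x) \<Longrightarrow> grad f x $ i = f' (axis i 1)"
  by (simp add: grad_eqI)

lemma smooth_on_grad_nth: "smooth_on f UNIV \<Longrightarrow> smooth_on (\<lambda>x. grad f x $ i) UNIV"
  unfolding grad_def by (simp add: smooth_on_has_derivative(2))

lemma continuous_on_grad: "smooth_on f UNIV \<Longrightarrow> continuous_on UNIV (grad f)"
  using continuous_on_vec_lambda[of UNIV "\<lambda>i x. grad f x $ i"] smooth_on_continuous[OF smooth_on_grad_nth]
  by (simp add: vec_nth_inverse)

lemma grad_mult:
  assumes "smooth_on f UNIV" "smooth_on g UNIV"
  shows "grad (\<lambda>x. f x * g x) x = f x *\<^sub>R grad g x + g x *\<^sub>R grad f x"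
  using grad_eqI[OF has_derivative_mult[OF smooth_on_has_derivative(1)[OF assms(1)]
      smooth_on_has_derivative(1)[OF assms(2)]], of x]
  by (simp add: vec_eq_iff grad_def)

lemma grad_eq_0_outside_support:
  assumes "x \<notin> closure {z. f z \<noteq> 0}"
  shows "grad f x = 0"
proof -
  define S where "S = - closure {z. f z \<noteq> 0}"
  have S: "open S" "x \<in> S" "\<And>z. z \<in> S \<Longrightarrow> 0 = f z"
    using assms closure_subset[of "{z. f z \<noteq> 0}"] by (auto simp: S_def)
  have "(f has_derivative (\<lambda>_. 0)) (at x)"
    by (rule has_derivative_transform_within_open[OF has_derivative_const S])
  then show ?thesis by (simp add: grad_eqI vec_eq_iff)
qed

lemma norm_sq_vec2: "(norm (x::real^2))\<^sup>2 = (x $ 1)\<^sup>2 + (x $ 2)\<^sup>2"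
  unfolding norm_vec_def by (simp add: L2_set_def sum_2)

lemma smooth_on_affine_nth: "smooth_on (\<lambda>x::real^2. x $ i - c) UNIV"
  using smooth_on_add[OF smooth_on_bounded_linear[OF bounded_linear_vec_nth] smooth_on_const[of "-c"]] by simp

lemma smooth_on_norm_sq: "smooth_on (\<lambda>x::real^2. (norm (x - c))\<^sup>2) UNIV"
proof -
  have "smooth_on (\<lambda>x::real^2. (x $ 1 - c $ 1) * (x $ 1 - c $ 1) + (x $ 2 - c $ 2) * (x $ 2 - c $ 2)) UNIV"
    by (intro smooth_on_add smooth_on_mult smooth_on_affine_nth)
  then show ?thesis
    by (simp only: norm_sq_vec2 power2_eq_square[symmetric] vector_minus_component)
qed

lemma smooth_on_fst: "smooth_on f UNIV \<Longrightarrow> smooth_on (\<lambda>z. f (fst z)) UNIV"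
  and smooth_on_snd: "smooth_on g UNIV \<Longrightarrow> smooth_on (\<lambda>z. g (snd z)) UNIV"
  using smooth_on_compose_affine[OF _ bounded_linear_fst, of f 0]
    smooth_on_compose_affine[OF _ bounded_linear_snd, of g 0] by auto

text \<open>The radius enters squared, which keeps the function smooth at the centre.\<close>

definition bump :: "real^2 \<Rightarrow> real \<Rightarrow> real \<Rightarrow> real^2 \<Rightarrow> real" where
  "bump c a b x = smooth_step ((b\<^sup>2 - (norm (x - c))\<^sup>2) / (b\<^sup>2 - a\<^sup>2))"

lemma smooth_on_bump: "smooth_on (bump c a b) UNIV"
proof -
  have "smooth_on (\<lambda>x. smooth_step ((b\<^sup>2 + (-1) * (norm (x - c))\<^sup>2) * (1 / (b\<^sup>2 - a\<^sup>2)))) UNIV"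
    by (intro smooth_on_compose_real[OF smooth_on_smooth_step] smooth_on_mult smooth_on_add smooth_on_const smooth_on_norm_sq)
  then show ?thesis unfolding bump_def by simp
qed

lemma bump_nonneg: "0 \<le> bump c a b x" and bump_le_1: "bump c a b x \<le> 1"
  by (simp_all add: bump_def smooth_step_nonneg smooth_step_le_1)

lemma bump_eq_1: "0 < a \<Longrightarrow> a < b \<Longrightarrow> norm (x - c) \<le> a \<Longrightarrow> bump c a b x = 1"
  unfolding bump_def by (intro smooth_step_eq_1) (simp add: power_strict_mono power_mono)

lemma bump_eq_0:
  assumes "0 < a" "a < b" "b \<le> norm (x - c)"
  shows "bump c a b x = 0"
proof -
  have "b\<^sup>2 \<le> (norm (x - c))\<^sup>2" "a\<^sup>2 < b\<^sup>2"
    using assms by (auto intro: power_mono power_strict_mono)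
  then have "(b\<^sup>2 - (norm (x - c))\<^sup>2) / (b\<^sup>2 - a\<^sup>2) \<le> 0"
    by (simp add: divide_nonpos_pos)
  then show ?thesis unfolding bump_def by (intro smooth_step_eq_0) linarith
qed

text \<open>Differentiating the square produces a factor \<open>norm (x - c)\<close>, at most
  \<open>b + a\<close> where the gradient is nonzero; it cancels against
  \<open>b^2 - a^2 = (b - a) (b + a)\<close>. Hence a constant independent of centre and
  radii.\<close>

lemma bump_grad:
  obtains M where "M > 0"
    "\<And>c a b x. 0 < a \<Longrightarrow> a < b \<Longrightarrow> norm (grad (bump c a b) x) \<le> M / (b - a)"
    "\<And>c a b x. 0 < a \<Longrightarrow> a < b \<Longrightarrow> norm (x - c) < a \<or> b \<le> norm (x - c) \<Longrightarrow> grad (bump c a b) x = 0"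
proof -
  obtain M where M: "M > 0" "\<And>x. (smooth_step has_real_derivative deriv smooth_step x) (at x)"
    "\<And>x. \<bar>deriv smooth_step x\<bar> \<le> M" "\<And>x. x < 1/2 \<Longrightarrow> deriv smooth_step x = 0" "\<And>x. x > 1 \<Longrightarrow> deriv smooth_step x = 0"
    using smooth_step_derivative_bounded by metis
  define \<rho> where "\<rho> c a b x = (b\<^sup>2 - (norm (x - c))\<^sup>2) / (b\<^sup>2 - a\<^sup>2)" for c x :: "real^2" and a b :: real
  have g: "grad (bump c a b) x = - (deriv smooth_step (\<rho> c a b x) * 2 / (b\<^sup>2 - a\<^sup>2)) *\<^sub>R (x - c)" for c a b x
  proof -
    have "(\<rho> c a b has_derivative (\<lambda>v. - (2 * ((x - c) \<bullet> v)) / (b\<^sup>2 - a\<^sup>2))) (at x)"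
      unfolding \<rho>_def power2_norm_eq_inner divide_inverse
      by (auto intro!: derivative_eq_intros simp: inner_commute algebra_simps)
    from DERIV_compose_FDERIV[OF M(2) this]
    have "(bump c a b has_derivative (\<lambda>v. - (2 * ((x - c) \<bullet> v)) / (b\<^sup>2 - a\<^sup>2) * deriv smooth_step (\<rho> c a b x))) (at x)"
      unfolding bump_def[abs_def] \<rho>_def .
    then show ?thesis
      by (auto simp: grad_eqI vec_eq_iff inner_axis)
  qed
  have 0: "grad (bump c a b) x = 0" if "0 < a" "a < b" "norm (x - c) < a \<or> b \<le> norm (x - c)" for c a b x
  proof -
    have p: "b\<^sup>2 - a\<^sup>2 > 0" using that by (simp add: power_strict_mono)
    have "\<rho> c a b x > 1 \<or> \<rho> c a b x \<le> 0"
      using that(3) p that(1,2)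
      by (auto simp: \<rho>_def divide_le_0_iff power_strict_mono power_mono)
    then have "deriv smooth_step (\<rho> c a b x) = 0"
      using M(4)[of "\<rho> c a b x"] M(5)[of "\<rho> c a b x"] by linarith
    then show ?thesis by (simp add: g)
  qed
  have "norm (grad (bump c a b) x) \<le> (2 * M) / (b - a)" if "0 < a" "a < b" for c a b x
  proof (cases "b \<le> norm (x - c)")
    case True
    then show ?thesis using 0[OF that] that M(1) by simp
  next
    case False
    have p: "b\<^sup>2 - a\<^sup>2 = (b - a) * (b + a)" by (simp add: power2_eq_square algebra_simps)
    have "norm (grad (bump c a b) x) = \<bar>deriv smooth_step (\<rho> c a b x)\<bar> * 2 / (b\<^sup>2 - a\<^sup>2) * norm (x - c)"
      using that by (simp add: g p abs_mult)
    also have "\<dots> \<le> M * 2 / ((b - a) * (b + a)) * (b + a)"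
      unfolding p using that False M(1,3) by (intro mult_mono divide_right_mono) auto
    also have "\<dots> = (2 * M) / (b - a)" using that by simp
    finally show ?thesis .
  qed
  then show thesis using that[of "2 * M"] 0 M(1) by simp
qed

lemma grad_x_product:
  assumes "smooth_on f UNIV"
  shows "grad_x (\<lambda>z. f (fst z) * g (snd z)) z = g (snd z) *\<^sub>R grad f (fst z)"
  unfolding grad_x_def
  using has_derivative_mult_left[OF smooth_on_has_derivative(1)[OF assms], of "g (snd z)" "fst z"]
  by (auto simp: grad_eqI vec_eq_iff grad_nth[OF smooth_on_has_derivative(1)[OF assms]])

lemma d_t_product:
  fixes g :: "real \<Rightarrow> real"
  assumes "(g has_real_derivative g') (at (snd z))"
  shows "d_t (\<lambda>z. f (fst z) * g (snd z)) z = f (fst z) * g'"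
proof -
  have "((\<lambda>s. f (fst z) * g s) has_vector_derivative f (fst z) * g') (at (snd z))"
    using DERIV_cmult[OF assms, of "f (fst z)"] by (simp add: has_real_derivative_iff_has_vector_derivative)
  then show ?thesis unfolding d_t_def by (simp add: vector_derivative_at)
qed

subsection \<open>Convolution inequalities\<close>

text \<open>Two applications of the two-term inequality: first with weights \<open>u\<close> and
  \<open>v + w\<close>, then with \<open>v / (v + w)\<close> and \<open>w / (v + w)\<close>. Zero
  arguments are split off because that inequality is applied to positive numbers.\<close>

lemma weighted_AM_GM3:
  fixes a b c :: real
  assumes "0 \<le> a" "0 \<le> b" "0 \<le> c" and w: "0 < u" "0 < v" "0 < w" "u + v + w = 1"
  shows "a powr u * b powr v * c powr w \<le> u * a + v * b + w * c"
proof (cases "a = 0 \<or> b = 0 \<or> c = 0")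
  case True
  then show ?thesis using assms by auto
next
  case False
  then have pos: "0 < a" "0 < b" "0 < c" using assms by auto
  have "a powr u * (b powr (v/(v+w)) * c powr (w/(v+w))) powr (v+w) \<le>
      u * a + (v+w) * (b powr (v/(v+w)) * c powr (w/(v+w)))"
    using w pos by (intro Youngs_inequality_0) auto
  also have "(v+w) * (b powr (v/(v+w)) * c powr (w/(v+w))) \<le> (v+w) * (v/(v+w) * b + w/(v+w) * c)"
    using w pos by (intro mult_left_mono Youngs_inequality_0) (auto simp: add_divide_distrib[symmetric])
  also have "s * (v/s * b + w/s * c) = v * b + w * c" if "s \<noteq> 0" for s
    using that by (simp add: distrib_left)
  then have "(v+w) * (v/(v+w) * b + w/(v+w) * c) = v * b + w * c" using w by simp
  finally show ?thesis
    using w pos by (simp add: powr_mult powr_powr mult.assoc add.assoc)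
qed

text \<open>After division by \<open>F\<close>, \<open>G\<close>, \<open>H\<close> the
  arithmetic-geometric inequality holds pointwise and integrates to \<open>u + v + w = 1\<close>. If
  one bound is zero, one factor vanishes almost everywhere, and so does the product. Working with
  upper bounds instead of the integrals themselves avoids infinite values.\<close>

lemma Hoelder3:
  fixes f g h :: "'a \<Rightarrow> real"
  assumes [measurable]: "f \<in> borel_measurable M" "g \<in> borel_measurable M" "h \<in> borel_measurable M"
    and nonneg: "\<And>x. 0 \<le> f x" "\<And>x. 0 \<le> g x" "\<And>x. 0 \<le> h x"
    and w: "0 < u" "0 < v" "0 < w" "u + v + w = 1"
    and f: "(\<integral>\<^sup>+x. ennreal (f x) \<partial>M) \<le> ennreal F" and g: "(\<integral>\<^sup>+x. ennreal (g x) \<partial>M) \<le> ennreal G"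
    and h: "(\<integral>\<^sup>+x. ennreal (h x) \<partial>M) \<le> ennreal H"
    and FGH: "0 \<le> F" "0 \<le> G" "0 \<le> H"
  shows "(\<integral>\<^sup>+x. ennreal (f x powr u * g x powr v * h x powr w) \<partial>M) \<le> ennreal (F powr u * G powr v * H powr w)"
proof (cases "F = 0 \<or> G = 0 \<or> H = 0")
  case True
  have *: "AE x in M. k x = 0" if "(\<integral>\<^sup>+x. ennreal (k x) \<partial>M) \<le> 0" "k \<in> borel_measurable M" "\<And>x. 0 \<le> k x"
    for k :: "'a \<Rightarrow> real"
    using that by (subst (asm) le_zero_eq, subst (asm) nn_integral_0_iff_AE) (auto simp: ennreal_eq_0_iff antisym)
  have "AE x in M. f x = 0 \<or> g x = 0 \<or> h x = 0"
    using True *[of f] *[of g] *[of h] f g h nonneg by (elim disjE) auto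
  then have "(\<integral>\<^sup>+x. ennreal (f x powr u * g x powr v * h x powr w) \<partial>M) = (\<integral>\<^sup>+x. 0 \<partial>M)"
    by (intro nn_integral_cong_AE) auto
  then show ?thesis by simp
next
  case False
  then have pos: "0 < F" "0 < G" "0 < H" using FGH by auto
  define X where "X = F powr u * G powr v * H powr w"
  have X: "X > 0" using pos by (simp add: X_def)
  have "(\<integral>\<^sup>+x. ennreal (f x powr u * g x powr v * h x powr w) \<partial>M)
      \<le> (\<integral>\<^sup>+x. ennreal (X * u / F) * ennreal (f x) + ennreal (X * v / G) * ennreal (g x)
             + ennreal (X * w / H) * ennreal (h x) \<partial>M)"
  proof (rule nn_integral_mono)
    fix x
    have "f x powr u * g x powr v * h x powr w = X * ((f x / F) powr u * (g x / G) powr v * (h x / H) powr w)"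
      using pos nonneg by (simp add: X_def powr_divide)
    also have "\<dots> \<le> X * (u * (f x / F) + v * (g x / G) + w * (h x / H))"
      using pos nonneg w X by (intro mult_left_mono weighted_AM_GM3) auto
    also have "\<dots> = X * u / F * f x + X * v / G * g x + X * w / H * h x"
      by (simp add: algebra_simps)
    finally have "ennreal (f x powr u * g x powr v * h x powr w)
        \<le> ennreal (X * u / F * f x + X * v / G * g x + X * w / H * h x)"
      by (rule ennreal_leI)
    also have "\<dots> = ennreal (X * u / F) * ennreal (f x) + ennreal (X * v / G) * ennreal (g x)
             + ennreal (X * w / H) * ennreal (h x)"
      using pos nonneg w X by (simp add: ennreal_mult del: times_divide_eq_left)
    finally show "ennreal (f x powr u * g x powr v * h x powr w) \<le> \<dots>" .
  qed
  also have "\<dots> = ennreal (X * u / F) * (\<integral>\<^sup>+x. ennreal (f x) \<partial>M) + ennreal (X * v / G) * (\<integral>\<^sup>+x. ennreal (g x) \<partial>M)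
      + ennreal (X * w / H) * (\<integral>\<^sup>+x. ennreal (h x) \<partial>M)"
    by (simp add: nn_integral_add nn_integral_cmult)
  also have "\<dots> \<le> ennreal (X * u / F) * ennreal F + ennreal (X * v / G) * ennreal G + ennreal (X * w / H) * ennreal H"
    by (intro add_mono mult_left_mono f g h) auto
  also have "\<dots> = ennreal (X * u + X * v + X * w)"
    using pos w X by (simp add: ennreal_mult[symmetric])
  also have "X * u + X * v + X * w = X"
    using w(4) by (metis distrib_left mult.right_neutral)
  finally show ?thesis by (simp add: X_def)
qed

lemma nn_integral_lborel_reflect_translate:
  fixes y :: "'a::euclidean_space"
  assumes [measurable]: "g \<in> borel_measurable borel"
  shows "(\<integral>\<^sup>+x. g (x - y) \<partial>lborel) = (\<integral>\<^sup>+x. g x \<partial>lborel)"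
    and "(\<integral>\<^sup>+x. g (y - x) \<partial>lborel) = (\<integral>\<^sup>+x. g x \<partial>lborel)"
proof -
  have "(\<integral>\<^sup>+x. g x \<partial>lborel) = (\<integral>\<^sup>+x. g x \<partial>distr lborel borel ((+) (- y)))"
    by (simp add: lborel_distr_plus)
  also have "\<dots> = (\<integral>\<^sup>+x. g (x - y) \<partial>lborel)"
    by (subst nn_integral_distr) auto
  finally show "(\<integral>\<^sup>+x. g (x - y) \<partial>lborel) = (\<integral>\<^sup>+x. g x \<partial>lborel)" by simp
  have "(\<integral>\<^sup>+x. g x \<partial>lborel) = (\<integral>\<^sup>+x. g x \<partial>density (distr lborel borel (\<lambda>x. y + (-1) *\<^sub>R x)) (\<lambda>_. \<bar>-1::real\<bar> ^ DIM('a)))"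
    using lborel_affine[of "-1" y] by simp
  also have "\<dots> = (\<integral>\<^sup>+x. g (y - x) \<partial>lborel)"
    by (subst nn_integral_density) (auto simp: nn_integral_distr)
  finally show "(\<integral>\<^sup>+x. g (y - x) \<partial>lborel) = (\<integral>\<^sup>+x. g x \<partial>lborel)" by simp
qed

text \<open>Young's inequality with the kernel split as \<open>k^\<tau> k^(1 - \<tau>)\<close>. The
  two parts enter with the separate exponents \<open>\<tau> Q\<close> and
  \<open>(1 - \<tau>) p / (p - 1)\<close>, so \<tau> can be tuned until both are admissible for the
  kernel; for the Riesz kernel in the plane this means both below 2.\<close>

lemma convolution_bound:
  fixes f k :: "'a::euclidean_space \<Rightarrow> real" and v :: "'a \<Rightarrow> real"
  assumes [measurable]: "f \<in> borel_measurable borel" "k \<in> borel_measurable borel" "v \<in> borel_measurable borel"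
      "S \<in> sets borel"
    and nonneg: "\<And>x. 0 \<le> f x" "\<And>x. 0 \<le> k x" "\<And>x. 0 \<le> v x"
    and p: "1 < p" "p < Q" "0 < \<tau>" "\<tau> < 1"
    and F: "(\<integral>\<^sup>+x. ennreal (f x powr p) \<partial>lborel) \<le> ennreal F" "0 \<le> F"
    and L1: "(\<integral>\<^sup>+x. ennreal (k x powr (\<tau> * Q)) \<partial>lborel) \<le> ennreal L1" "0 \<le> L1"
    and L2: "(\<integral>\<^sup>+x. ennreal (k x powr ((1 - \<tau>) * (p / (p - 1)))) \<partial>lborel) \<le> ennreal L2" "0 \<le> L2"
    and v: "AE y in lborel. y \<in> S \<longrightarrow> ennreal (v y) \<le> ennreal a + ennreal c * (\<integral>\<^sup>+x. ennreal (f x * k (x - y)) \<partial>lborel)"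
    and ac: "0 \<le> a" "0 \<le> c" and m: "emeasure lborel S \<le> ennreal m" "0 \<le> m"
  shows "(\<integral>\<^sup>+y\<in>S. ennreal (v y powr Q) \<partial>lborel)
    \<le> ennreal (2 powr Q * (a powr Q * m + c powr Q * (F powr (1/p) * L2 powr (1 - 1/p)) powr Q * L1))"
proof -
  \<comment> \<open>The only factor that still depends on \<open>y\<close> after Hoelder's
    inequality in \<open>x\<close>; Fubini bounds its integral by \<open>F * L1\<close>.\<close>
  define G where "G y = (\<integral>\<^sup>+x. ennreal (f x powr p * k (x - y) powr (\<tau> * Q)) \<partial>lborel)" for y
  have [measurable]: "G \<in> borel_measurable borel" unfolding G_def by measurable
  have "(\<integral>\<^sup>+y. G y \<partial>lborel) = (\<integral>\<^sup>+x. (\<integral>\<^sup>+y. ennreal (f x powr p * k (x - y) powr (\<tau> * Q)) \<partial>lborel) \<partial>lborel)"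
    unfolding G_def by (rule lborel_pair.Fubini') simp
  also have "\<dots> = (\<integral>\<^sup>+x. ennreal (f x powr p) * (\<integral>\<^sup>+y. ennreal (k (x - y) powr (\<tau> * Q)) \<partial>lborel) \<partial>lborel)"
    by (simp add: ennreal_mult nn_integral_cmult)
  also have "\<dots> = (\<integral>\<^sup>+x. ennreal (f x powr p) * (\<integral>\<^sup>+y. ennreal (k y powr (\<tau> * Q)) \<partial>lborel) \<partial>lborel)"
    using nn_integral_lborel_reflect_translate(2)[of "\<lambda>y. ennreal (k y powr (\<tau> * Q))"] by simp
  also have "\<dots> \<le> ennreal F * ennreal L1"
    by (subst nn_integral_multc) (auto intro!: mult_mono F L1)
  finally have G_int: "(\<integral>\<^sup>+y. G y \<partial>lborel) \<le> ennreal (F * L1)"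
    using F L1 by (simp add: ennreal_mult)
  then have G_fin: "AE y in lborel. G y \<noteq> \<infinity>"
    by (intro nn_integral_noteq_infinite) (auto simp: top_unique)
  define X where "X = c powr Q * F powr (Q/p - 1) * L2 powr (Q * (1 - 1/p))"
  have Q: "Q > 0" using p by simp
  have pw: "v y powr Q \<le> 2 powr Q * (a powr Q + X * enn2real (G y))"
    if vy: "ennreal (v y) \<le> ennreal a + ennreal c * (\<integral>\<^sup>+x. ennreal (f x * k (x - y)) \<partial>lborel)"
      and fin: "G y \<noteq> \<infinity>" for y
  proof -
    define g where "g = enn2real (G y)"
    have g: "G y = ennreal g" "0 \<le> g" using fin by (auto simp: g_def less_top)
    \<comment> \<open>The weights \<open>1/Q\<close>, \<open>1/p - 1/Q\<close> and
      \<open>1 - 1/p\<close> add up to 1. The second factor integrates to a power of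
      \<open>F\<close> and, by translation invariance, the third to a power of
      \<open>L2\<close>.\<close>
    have e: "f x * k (x - y) = (f x powr p * k (x - y) powr (\<tau> * Q)) powr (1/Q) * (f x powr p) powr (1/p - 1/Q)
         * (k (x - y) powr ((1 - \<tau>) * (p / (p - 1)))) powr (1 - 1/p)" for x
    proof -
      have "(1 - \<tau>) * (p / (p - 1)) * (1 - 1/p) = 1 - \<tau>"
        using p by (simp add: field_simps)
      then have "(f x powr p * k (x - y) powr (\<tau> * Q)) powr (1/Q) * (f x powr p) powr (1/p - 1/Q)
         * (k (x - y) powr ((1 - \<tau>) * (p / (p - 1)))) powr (1 - 1/p)
         = (f x powr (p/Q) * f x powr (p * (1/p - 1/Q))) * (k (x - y) powr \<tau> * k (x - y) powr (1 - \<tau>))"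
        using Q nonneg by (simp add: powr_mult powr_powr)
      also have "\<dots> = f x * k (x - y)"
        unfolding powr_add[symmetric] using p nonneg by (simp add: field_simps)
      finally show ?thesis by simp
    qed
    have "(\<integral>\<^sup>+x. ennreal (f x * k (x - y)) \<partial>lborel) \<le> ennreal (g powr (1/Q) * F powr (1/p - 1/Q) * L2 powr (1 - 1/p))"
      unfolding e
    proof (rule Hoelder3)
      show "(\<integral>\<^sup>+x. ennreal (f x powr p * k (x - y) powr (\<tau> * Q)) \<partial>lborel) \<le> ennreal g"
        using g by (simp add: G_def)
      show "(\<integral>\<^sup>+x. ennreal (k (x - y) powr ((1 - \<tau>) * (p / (p - 1)))) \<partial>lborel) \<le> ennreal L2"
        using L2 nn_integral_lborel_reflect_translate(1)[of "\<lambda>y. ennreal (k y powr ((1 - \<tau>) * (p / (p - 1))))" y] by simp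
    qed (use p F L2 nonneg g in \<open>auto simp: field_simps\<close>)
    then have "ennreal (v y) \<le> ennreal a + ennreal c * ennreal (g powr (1/Q) * F powr (1/p - 1/Q) * L2 powr (1 - 1/p))"
      using vy by (meson add_left_mono mult_left_mono order_trans zero_le)
    then have "ennreal (v y) \<le> ennreal (a + c * (g powr (1/Q) * F powr (1/p - 1/Q) * L2 powr (1 - 1/p)))"
      using ac by (simp add: ennreal_mult)
    then have "v y \<le> a + c * (g powr (1/Q) * F powr (1/p - 1/Q) * L2 powr (1 - 1/p))" (is "_ \<le> a + ?b")
      using ac by (subst (asm) ennreal_le_iff) auto
    \<comment> \<open>The resulting factor \<open>2 powr Q\<close> becomes a mere 2 after taking the
      root of order \<open>Q\<close>, so it is harmless uniformly in \<open>Q\<close>.\<close>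
    also have "\<dots> \<le> 2 * max a ?b" by simp
    finally have "v y powr Q \<le> (2 * max a ?b) powr Q"
      using nonneg Q by (intro powr_mono2) auto
    also have "\<dots> = 2 powr Q * max a ?b powr Q" using ac by (simp add: powr_mult)
    also have "\<dots> \<le> 2 powr Q * (a powr Q + ?b powr Q)"
      by (intro mult_left_mono) (auto simp: max_def)
    also have "?b powr Q = X * g"
    proof -
      have "(1/p - 1/Q) * Q = Q/p - 1" "1/Q * Q = 1"
        using Q by (simp_all add: left_diff_distrib)
      then show ?thesis
        using ac g F L2 by (simp add: powr_mult powr_powr X_def mult_ac)
    qed
    finally show ?thesis unfolding g_def .
  qed
  have X: "0 \<le> X" by (simp add: X_def)
  have "(\<integral>\<^sup>+y\<in>S. ennreal (v y powr Q) \<partial>lborel)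
      \<le> (\<integral>\<^sup>+y. ennreal (2 powr Q * a powr Q) * indicator S y + ennreal (2 powr Q * X) * G y \<partial>lborel)"
  proof (rule nn_integral_mono_AE)
    show "AE y in lborel. ennreal (v y powr Q) * indicator S y
      \<le> ennreal (2 powr Q * a powr Q) * indicator S y + ennreal (2 powr Q * X) * G y"
      using v G_fin
    proof eventually_elim
      case (elim y)
      show ?case
      proof (cases "y \<in> S")
        case True
        have "ennreal (v y powr Q) \<le> ennreal (2 powr Q * a powr Q + 2 powr Q * X * enn2real (G y))"
          using pw[of y] elim True by (intro ennreal_leI) (simp add: algebra_simps)
        also have "\<dots> = ennreal (2 powr Q * a powr Q) + ennreal (2 powr Q * X) * G y"
          using X elim(2) by (simp add: ennreal_mult less_top)
        finally show ?thesis using True by simp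
      qed simp
    qed
  qed
  also have "\<dots> = ennreal (2 powr Q * a powr Q) * emeasure lborel S + ennreal (2 powr Q * X) * (\<integral>\<^sup>+y. G y \<partial>lborel)"
    by (simp add: nn_integral_add nn_integral_cmult)
  also have "\<dots> \<le> ennreal (2 powr Q * a powr Q) * ennreal m + ennreal (2 powr Q * X) * ennreal (F * L1)"
    by (intro add_mono mult_left_mono m G_int) auto
  also have "\<dots> = ennreal (2 powr Q * (a powr Q * m + X * F * L1))"
    using m X F L1 by (simp add: ennreal_plus[symmetric] ennreal_mult[symmetric] algebra_simps del: ennreal_plus)
  also have "X * F = c powr Q * (F powr (1/p) * L2 powr (1 - 1/p)) powr Q"
  proof -
    have "F powr (Q/p - 1) * F = F powr (Q/p)"
      using F p by (cases "F = 0") (auto simp: powr_diff)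
    then show ?thesis
      using F L2 by (simp add: X_def powr_mult powr_powr mult_ac)
  qed
  finally show ?thesis .
qed

section \<open>Powers of the truncated Riesz kernel\<close>

lemma ball_borel [measurable]: "ball c r \<in> sets (borel :: 'a::metric_space measure)"
  by simp

text \<open>Truncation makes all powers of order below 2 integrable. At the origin division by zero
  gives the value 0, which affects a single point.\<close>

definition riesz_kernel :: "real \<Rightarrow> real^2 \<Rightarrow> real" where
  "riesz_kernel R z = indicator (ball 0 R) z / norm z"

lemma riesz_kernel_measurable [measurable]: "riesz_kernel R \<in> borel_measurable borel"
  unfolding riesz_kernel_def
  by (intro borel_measurable_divide borel_measurable_indicator borel_measurable_continuous_onI continuous_on_norm_id) auto

lemma riesz_kernel_nonneg: "0 \<le> riesz_kernel R z"
  by (simp add: riesz_kernel_def)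

lemma ennreal_le_suminf: "f n \<le> (\<Sum>n. f n :: ennreal)"
  using sum_le_suminf[OF summableI, of "{n}" f] by simp

lemma power_powr_swap: "0 < x \<Longrightarrow> (x ^ k) powr b = (x powr b :: real) ^ k"
  by (induction k) (auto simp: powr_mult)

text \<open>Bounds the sum of a geometric series of ratio \<open>2 powr (- x)\<close> by
  \<open>4 / x\<close>, uniformly as \<open>x\<close> tends to 0. The estimate combines
  \<open>exp y \<ge> 1 + y\<close> with \<open>ln 2 \<ge> 1/2\<close>.\<close>

lemma one_minus_two_powr_minus:
  fixes x :: real
  assumes "0 < x" "x \<le> 2"
  shows "x / 4 \<le> 1 - 2 powr (- x)"
proof -
  define y where "y = x * ln 2"
  have y: "x / 2 \<le> y"
    using ln_2_less_1 ln2_ge_two_thirds assms by (simp add: y_def)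
  have "2 powr (- x) = inverse (exp y)"
    by (simp add: powr_def y_def exp_minus)
  also have "\<dots> \<le> inverse (1 + y)"
    using y assms by (intro le_imp_inverse_le) auto
  also have "\<dots> \<le> inverse (1 + x / 2)"
    using y assms by (intro le_imp_inverse_le) auto
  also have "\<dots> \<le> 1 - x / 4"
  proof -
    have "1 \<le> (1 - x/4) * (1 + x/2)"
      using assms mult_left_mono[of x 2 x] by (simp add: algebra_simps)
    then show ?thesis using assms by (simp add: inverse_eq_divide divide_le_eq)
  qed
  finally show ?thesis by simp
qed

text \<open>Dyadic annuli; the constant degenerates like \<open>1 / (2 - \<sigma>)\<close>, which is what makes the
  growth of the exponents in the iteration polynomial.\<close>

lemma riesz_kernel_powr_integral:
  assumes "R > 0"
  obtains K where "K > 0"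
    "\<And>\<sigma>. 0 < \<sigma> \<Longrightarrow> \<sigma> < 2 \<Longrightarrow> (\<integral>\<^sup>+z. ennreal (riesz_kernel R z powr \<sigma>) \<partial>lborel) \<le> ennreal (K / (2 - \<sigma>))"
proof
  define K where "K = unit_ball_vol 2 * R\<^sup>2 * (4 * (1 + 1 / R) powr 2) * 4"
  show "K > 0"
  proof -
    have "1 + 1 / R > 0" using assms by (simp add: add_pos_pos)
    then show ?thesis
      unfolding K_def using assms by (intro mult_pos_pos unit_ball_vol_pos) (auto simp del: powr_numeral)
  qed
  fix \<sigma> :: real assume \<sigma>: "0 < \<sigma>" "\<sigma> < 2"
  define a where "a k = (2 ^ Suc k / R) powr \<sigma>" for k :: nat
  \<comment> \<open>Balls replace annuli in the majorant: a single term of the series already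
    dominates at each point, and overlaps only enlarge the sum.\<close>
  have pw: "ennreal (riesz_kernel R z powr \<sigma>) \<le> (\<Sum>k. ennreal (a k) * indicator (ball 0 (R / 2 ^ k)) z)" for z :: "real^2"
  proof (cases "z \<noteq> 0 \<and> norm z < R")
    case True
    have "\<exists>n. R / norm z < 2 ^ n" by (rule real_arch_pow) simp
    define n where "n = (LEAST n. R / norm z < 2 ^ n)"
    have n: "R / norm z < 2 ^ n" unfolding n_def by (rule LeastI_ex) fact
    have "n \<noteq> 0"
      using n True by (intro notI) (simp add: divide_less_eq)
    then obtain k where k: "n = Suc k" using not0_implies_Suc by blast
    have "\<not> R / norm z < 2 ^ k"
      using not_less_Least[of k "\<lambda>n. R / norm z < 2 ^ n"] unfolding n_def[symmetric] k by simp
    moreover have "norm z \<noteq> R / 2 ^ k \<or> norm z = R / 2 ^ k" by simp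
    ultimately have le: "norm z \<le> R / 2 ^ k" using True by (simp add: field_simps)
    show ?thesis
    proof (cases "norm z < R / 2 ^ k")
      case lt: True
      have "riesz_kernel R z powr \<sigma> \<le> a k"
        unfolding a_def using True n k \<sigma> assms
        by (intro powr_mono2) (auto simp: riesz_kernel_def field_simps)
      then have "ennreal (riesz_kernel R z powr \<sigma>) \<le> ennreal (a k) * indicator (ball 0 (R / 2 ^ k)) z"
        using lt by (simp add: ennreal_leI)
      also have "\<dots> \<le> (\<Sum>k. ennreal (a k) * indicator (ball 0 (R / 2 ^ k)) z)"
        by (rule ennreal_le_suminf)
      finally show ?thesis .
    next
      \<comment> \<open>On the sphere itself the open ball is missed. The next larger ball contains
        the point, and its coefficient is exactly the value of the kernel there.\<close>
      case False
      then have e: "norm z = R / 2 ^ k" using le by simp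
      have "k \<noteq> 0" using e True by (intro notI) simp
      then obtain j where j: "k = Suc j" using not0_implies_Suc by blast
      have "riesz_kernel R z powr \<sigma> \<le> a j"
        unfolding a_def using True e j \<sigma> assms
        by (intro powr_mono2) (auto simp: riesz_kernel_def field_simps)
      moreover have "norm z < R / 2 ^ j" using e j assms by (simp add: field_simps)
      ultimately have "ennreal (riesz_kernel R z powr \<sigma>) \<le> ennreal (a j) * indicator (ball 0 (R / 2 ^ j)) z"
        by (simp add: ennreal_leI)
      also have "\<dots> \<le> (\<Sum>k. ennreal (a k) * indicator (ball 0 (R / 2 ^ k)) z)"
        by (rule ennreal_le_suminf)
      finally show ?thesis .
    qed
  next
    case False
    then show ?thesis by (auto simp: riesz_kernel_def)
  qed
  \<comment> \<open>Per dyadic step the kernel gains \<open>2 powr \<sigma>\<close> and the area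
    loses a factor 4.\<close>
  define \<rho> where "\<rho> = 2 powr (- (2 - \<sigma>))"
  have \<rho>: "0 < \<rho>" "\<rho> < 1" "(2 - \<sigma>) / 4 \<le> 1 - \<rho>"
    using \<sigma> one_minus_two_powr_minus[of "2 - \<sigma>"] powr_less_mono[of "-(2-\<sigma>)" 0 2] by (auto simp: \<rho>_def)
  define c where "c = unit_ball_vol 2 * R\<^sup>2 * (2 / R) powr \<sigma>"
  have c: "0 \<le> c" by (simp add: c_def)
  have ak: "a k * (unit_ball_vol 2 * (R / 2 ^ k)\<^sup>2) = c * \<rho> ^ k" for k
  proof -
    have 1: "(2 powr \<sigma>) ^ k / (2 ^ k)\<^sup>2 = \<rho> ^ k"
    proof -
      have "\<rho> = 2 powr \<sigma> / 4" by (simp add: \<rho>_def powr_diff)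
      then have "\<rho> ^ k = (2 powr \<sigma>) ^ k / 4 ^ k" by (simp only: power_divide)
      then show ?thesis by (simp add: power2_eq_square power_mult_distrib[symmetric])
    qed
    have "a k = (2 / R) powr \<sigma> * (2 powr \<sigma>) ^ k"
      unfolding a_def using assms by (simp add: powr_mult powr_divide power_powr_swap)
    then have "a k * (unit_ball_vol 2 * (R / 2 ^ k)\<^sup>2) = c * ((2 powr \<sigma>) ^ k / (2 ^ k)\<^sup>2)"
      by (simp add: c_def power_divide)
    then show ?thesis by (simp add: 1)
  qed
  have "(\<integral>\<^sup>+z. ennreal (riesz_kernel R z powr \<sigma>) \<partial>lborel)
      \<le> (\<integral>\<^sup>+z. (\<Sum>k. ennreal (a k) * indicator (ball 0 (R / 2 ^ k)) (z::real^2)) \<partial>lborel)"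
    by (intro nn_integral_mono pw)
  also have "\<dots> = (\<Sum>k. ennreal (a k) * emeasure lborel (ball (0::real^2) (R / 2 ^ k)))"
    by (subst nn_integral_suminf) (simp_all add: nn_integral_cmult_indicator)
  also have "\<dots> = (\<Sum>k. ennreal (c * \<rho> ^ k))"
  proof (rule suminf_cong)
    fix k
    have "emeasure lborel (ball (0::real^2) (R / 2 ^ k)) = ennreal (unit_ball_vol 2 * (R / 2 ^ k)\<^sup>2)"
      using assms by (subst emeasure_ball) auto
    then show "ennreal (a k) * emeasure lborel (ball (0::real^2) (R / 2 ^ k)) = ennreal (c * \<rho> ^ k)"
      unfolding ak[symmetric] by (simp add: ennreal_mult a_def)
  qed
  also have "\<dots> = ennreal (c * (1 / (1 - \<rho>)))"
    using \<rho> c by (subst suminf_ennreal2) (auto simp: suminf_mult suminf_geometric summable_geometric intro!: summable_mult)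
  also have "\<dots> \<le> ennreal (K / (2 - \<sigma>))"
  proof (rule ennreal_leI)
    \<comment> \<open>The base is first raised above 1, so that the exponent can then be raised from
      \<sigma> to 2; this frees the constant from \<sigma>.\<close>
    have "(2 / R) powr \<sigma> \<le> (2 * (1 + 1 / R)) powr \<sigma>"
      using assms \<sigma> by (intro powr_mono2) (auto simp: field_simps)
    also have "\<dots> \<le> (2 * (1 + 1 / R)) powr 2"
      using assms \<sigma> by (intro powr_mono) (auto simp: field_simps)
    also have "\<dots> = 4 * (1 + 1 / R) powr 2"
      using assms by (subst powr_mult) auto
    finally have "c \<le> unit_ball_vol 2 * R\<^sup>2 * (4 * (1 + 1 / R) powr 2)"
      unfolding c_def by (intro mult_left_mono) auto
    moreover have "1 / (1 - \<rho>) \<le> 4 / (2 - \<sigma>)"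
      using \<rho> \<sigma> by (simp add: field_simps)
    ultimately have "c * (1 / (1 - \<rho>)) \<le> unit_ball_vol 2 * R\<^sup>2 * (4 * (1 + 1 / R) powr 2) * (4 / (2 - \<sigma>))"
      using c \<rho> by (intro mult_mono) auto
    then show "c * (1 / (1 - \<rho>)) \<le> K / (2 - \<sigma>)" by (simp add: K_def)
  qed
  finally show "(\<integral>\<^sup>+z. ennreal (riesz_kernel R z powr \<sigma>) \<partial>lborel) \<le> ennreal (K / (2 - \<sigma>))" .
qed

text \<open>Chebyshev at geometric levels: with \<open>q n = q0 * lam ^ Suc n\<close> and
  \<open>V n = e A C1^(n+1)\<close>, the moment bound gives the set where \<open>v\<close> exceeds
  \<open>V n\<close> measure at most \<open>exp (- q n)\<close>. On it, below
  \<open>V (n+1)\<close>, the integrand is at most \<open>exp (V (n+1) powr \<beta>)\<close>, whose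
  exponent grows like \<open>sqrt lam ^ n\<close> by the choice of \<beta>, while \<open>q n\<close>
  grows like \<open>lam ^ n\<close>. \<open>M\<close> is fixed before \<open>v\<close> and
  \<open>S\<close>, so the bound is uniform over time slices.\<close>

lemma exp_powr_integral_bound:
  fixes A C1 lam q0 \<beta> m :: real
  assumes A: "A > 0" "C1 > 1" "lam > 1" "q0 \<ge> 1" "\<beta> > 0" "m \<ge> 0" and \<beta>: "C1 powr \<beta> \<le> sqrt lam"
  obtains M where "\<And>v (S :: 'a::euclidean_space set). v \<in> borel_measurable borel \<Longrightarrow> S \<in> sets borel \<Longrightarrow>
    emeasure lborel S \<le> ennreal m \<Longrightarrow> (\<And>x. 0 \<le> v x) \<Longrightarrow>
    (\<And>n. (\<integral>\<^sup>+x\<in>S. ennreal (v x powr (q0 * lam ^ Suc n)) \<partial>lborel) \<le> ennreal ((A * C1 ^ Suc n) powr (q0 * lam ^ Suc n))) \<Longrightarrow>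
    (\<integral>\<^sup>+x\<in>S. ennreal (exp (v x powr \<beta>)) \<partial>lborel) \<le> ennreal M"
proof -
  \<comment> \<open>The factor \<open>exp 1\<close> turns the quotient of the moment bound by the
    level, raised to the power \<open>q n\<close>, into \<open>exp (- q n)\<close>.\<close>
  define V where "V n = exp 1 * A * C1 ^ Suc n" for n
  define q where "q n = q0 * lam ^ Suc n" for n
  define \<mu> where "\<mu> = sqrt lam"
  have \<mu>: "\<mu> > 1" "lam = \<mu>\<^sup>2" using A by (auto simp: \<mu>_def)
  define b where "b = (exp 1 * A) powr \<beta> * \<mu>"
  have V: "V n > 0" for n using A by (simp add: V_def)
  have qpos: "q n > 0" for n using A by (simp add: q_def)
  have Vb: "V (Suc n) powr \<beta> \<le> b * \<mu> ^ Suc n" for n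
  proof -
    have "V (Suc n) powr \<beta> = (exp 1 * A) powr \<beta> * (C1 powr \<beta>) ^ Suc (Suc n)"
      using A power_powr_swap[of C1 "Suc (Suc n)" \<beta>] unfolding V_def by (subst powr_mult) auto
    also have "\<dots> \<le> (exp 1 * A) powr \<beta> * \<mu> ^ Suc (Suc n)"
      using \<beta> by (intro mult_left_mono power_mono) (auto simp: \<mu>_def)
    finally show ?thesis by (simp add: b_def)
  qed
  define e where "e n = exp (V (Suc n) powr \<beta> - q n)" for n
  have e_le: "e n \<le> exp ((b + 1)\<^sup>2) * (1 / \<mu>) ^ Suc n" for n
  proof -
    define x where "x = \<mu> ^ Suc n"
    have x: "x > 0" using \<mu> by (simp add: x_def)
    have "q n \<ge> x\<^sup>2"
    proof -
      have "x\<^sup>2 = lam ^ Suc n"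
        by (simp add: x_def \<mu>(2) power_mult_distrib power2_eq_square)
      then show ?thesis
        using A mult_right_mono[of 1 q0 "lam ^ Suc n"] by (simp add: q_def)
    qed
    then have "V (Suc n) powr \<beta> - q n \<le> b * x - x\<^sup>2"
      using Vb[of n] by (simp add: x_def)
    \<comment> \<open>Part of the quadratic gain is kept as a linear decay in
      \<open>x = \<mu>^(n+1)\<close>, which suffices for summability.\<close>
    also have "\<dots> \<le> (b + 1)\<^sup>2 - x"
    proof -
      have "0 \<le> ((b + 1) - x)\<^sup>2 + (b + 1) * x"
        using x A \<mu> by (simp add: b_def)
      then show ?thesis by (simp add: power2_eq_square algebra_simps)
    qed
    finally have "e n \<le> exp ((b + 1)\<^sup>2) * exp (- x)"
      by (simp add: e_def flip: exp_add)
    also have "exp (- x) \<le> 1 / x"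
    proof -
      have "x \<le> exp x" using exp_ge_add_one_self[of x] by linarith
      then show ?thesis using x by (simp add: exp_minus inverse_eq_divide frac_le)
    qed
    finally show ?thesis by (simp add: x_def power_divide)
  qed
  have sum_e: "summable e"
  proof (rule summable_comparison_test')
    show "summable (\<lambda>n. exp ((b + 1)\<^sup>2) * (1 / \<mu>) ^ Suc n)"
      using \<mu> by (intro summable_mult) (simp add: summable_Suc_iff summable_geometric)
    show "norm (e n) \<le> exp ((b + 1)\<^sup>2) * (1 / \<mu>) ^ Suc n" for n
      using e_le[of n] by (simp add: e_def)
  qed
  define M where "M = exp (V 0 powr \<beta>) * m + suminf e"
  show thesis
  proof (rule that[of M])
    fix v :: "'a \<Rightarrow> real" and S :: "'a set"
    assume [measurable]: "v \<in> borel_measurable borel" "S \<in> sets borel"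
      and S: "emeasure lborel S \<le> ennreal m" and v: "\<And>x. 0 \<le> v x"
      and vq: "\<And>n. (\<integral>\<^sup>+x\<in>S. ennreal (v x powr (q0 * lam ^ Suc n)) \<partial>lborel) \<le> ennreal ((A * C1 ^ Suc n) powr (q0 * lam ^ Suc n))"
    define d where "d n = exp (V (Suc n) powr \<beta>) / V n powr q n" for n
    have d: "0 \<le> d n" for n by (simp add: d_def)
    \<comment> \<open>Chebyshev in pointwise form: for the level interval containing
      \<open>y\<close>, the ratio \<open>y / V n\<close> exceeds 1, so its power \<open>q n\<close>
      may be inserted as a factor. The other terms of the series are nonnegative.\<close>
    have pw: "ennreal (exp (y powr \<beta>)) \<le> ennreal (exp (V 0 powr \<beta>)) + (\<Sum>n. ennreal (d n) * ennreal (y powr q n))"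
      if y: "0 \<le> y" for y
    proof (cases "y \<le> V 0")
      case True
      then have "ennreal (exp (y powr \<beta>)) \<le> ennreal (exp (V 0 powr \<beta>))"
        using A y by (intro ennreal_leI) (simp add: powr_mono2)
      then show ?thesis by (rule order_trans) simp
    next
      case False
      have "\<exists>n. y / (exp 1 * A) < C1 ^ n" using A by (intro real_arch_pow)
      then obtain n0 where n0: "y / (exp 1 * A) < C1 ^ n0" ..
      have "C1 ^ n0 \<le> C1 ^ Suc n0" using A by (intro power_increasing) auto
      then have "y / (exp 1 * A) < C1 ^ Suc n0" using n0 by linarith
      then have "y < C1 ^ Suc n0 * (exp 1 * A)" using A by (subst (asm) pos_divide_less_eq) auto
      then have "y < exp 1 * A * C1 ^ Suc n0" by (simp only: mult_ac)
      then have ex: "\<exists>n. y \<le> V n" unfolding V_def by (intro exI[of _ n0]) simp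
      define k where "k = (LEAST n. y \<le> V n)"
      have k: "y \<le> V k" unfolding k_def by (rule LeastI_ex[OF ex])
      then have "k \<noteq> 0" using False by (intro notI) simp
      then obtain n where n: "k = Suc n" using not0_implies_Suc by blast
      have n': "V n < y"
        using not_less_Least[of n "\<lambda>n. y \<le> V n"] unfolding k_def[symmetric] n by simp
      have "exp (y powr \<beta>) * 1 \<le> exp (V (Suc n) powr \<beta>) * (y / V n) powr q n"
        using k n n' y A V[of n] qpos[of n] by (intro mult_mono) (auto simp: powr_mono2 ge_one_powr_ge_zero)
      also have "\<dots> = d n * y powr q n"
        using y V[of n] by (simp add: d_def powr_divide)
      finally have "ennreal (exp (y powr \<beta>)) \<le> ennreal (d n) * ennreal (y powr q n)"
        using d by (simp add: ennreal_leI flip: ennreal_mult)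
      also have "\<dots> \<le> (\<Sum>n. ennreal (d n) * ennreal (y powr q n))"
        by (rule ennreal_le_suminf)
      finally show ?thesis by (rule order_trans) simp
    qed
    have "(\<integral>\<^sup>+x\<in>S. ennreal (exp (v x powr \<beta>)) \<partial>lborel)
       \<le> (\<integral>\<^sup>+x. ennreal (exp (V 0 powr \<beta>)) * indicator S x + (\<Sum>n. ennreal (d n) * (ennreal (v x powr q n) * indicator S x)) \<partial>lborel)"
    proof (rule nn_integral_mono)
      fix x
      show "ennreal (exp (v x powr \<beta>)) * indicator S x
        \<le> ennreal (exp (V 0 powr \<beta>)) * indicator S x + (\<Sum>n. ennreal (d n) * (ennreal (v x powr q n) * indicator S x))"
        using pw[OF v[of x]] by (cases "x \<in> S") auto
    qed
    also have "\<dots> = ennreal (exp (V 0 powr \<beta>)) * emeasure lborel S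
        + (\<Sum>n. ennreal (d n) * (\<integral>\<^sup>+x\<in>S. ennreal (v x powr q n) \<partial>lborel))"
      by (subst nn_integral_add) (auto simp: nn_integral_cmult nn_integral_suminf)
    also have "\<dots> \<le> ennreal (exp (V 0 powr \<beta>)) * ennreal m + (\<Sum>n. ennreal (e n))"
    proof (intro add_mono mult_left_mono S suminf_le summableI)
      fix n
      have "ennreal (d n) * (\<integral>\<^sup>+x\<in>S. ennreal (v x powr q n) \<partial>lborel)
          \<le> ennreal (d n) * ennreal ((A * C1 ^ Suc n) powr q n)"
        unfolding q_def by (intro mult_left_mono vq) auto
      also have "\<dots> = ennreal (d n * (A * C1 ^ Suc n) powr q n)"
        using d by (simp add: ennreal_mult)
      also have "d n * (A * C1 ^ Suc n) powr q n = e n"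
      proof -
        have "V n powr q n = exp (q n) * (A * C1 ^ Suc n) powr q n"
          using A by (simp add: V_def powr_mult mult.assoc) (simp add: powr_def)
        then show ?thesis
          using A by (simp add: d_def e_def exp_diff)
      qed
      finally show "ennreal (d n) * (\<integral>\<^sup>+x\<in>S. ennreal (v x powr q n) \<partial>lborel) \<le> ennreal (e n)" .
    qed auto
    also have "\<dots> = ennreal M"
      using sum_e A by (subst suminf_ennreal2)
        (auto simp: M_def e_def ennreal_mult suminf_nonneg)
    finally show "(\<integral>\<^sup>+x\<in>S. ennreal (exp (v x powr \<beta>)) \<partial>lborel) \<le> ennreal M" .
  qed
qed

subsection \<open>The iteration\<close>

lemma borel_measurable_slice:
  fixes g :: "'a::{second_countable_topology, t2_space} \<times> 'b::{second_countable_topology, t2_space} \<Rightarrow> 'c::topological_space"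
  assumes "g \<in> borel_measurable borel"
  shows "(\<lambda>x. g (x, t)) \<in> borel_measurable borel" "(\<lambda>t. g (x, t)) \<in> borel_measurable borel"
  by (rule measurable_compose[OF borel_measurable_continuous_onI assms]; intro continuous_intros)+

text \<open>After normalising \<open>x + y = 1\<close> this is \<open>z powr Q \<le> z\<close> on
  the unit interval. It merges two terms into one power of order \<open>Q\<close> at no
  cost.\<close>

lemma powr_add_superadditive:
  fixes x y :: real
  assumes "0 \<le> x" "0 \<le> y" "1 \<le> Q"
  shows "x powr Q + y powr Q \<le> (x + y) powr Q"
proof (cases "x + y = 0")
  case True
  then have "x = 0" "y = 0" using assms by auto
  then show ?thesis by simp
next
  case False
  then have s: "x + y > 0" using assms by auto
  have *: "z powr Q \<le> z" if "0 \<le> z" "z \<le> 1" for z :: real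
  proof (cases "z = 0")
    case z: False
    then have "z powr Q \<le> z powr 1" using that assms by (intro powr_mono') auto
    then show ?thesis using z that by simp
  qed simp
  have "(x / (x + y)) powr Q + (y / (x + y)) powr Q \<le> x / (x + y) + y / (x + y)"
    using s assms by (intro add_mono *) auto
  also have "\<dots> = 1" using s by (simp flip: add_divide_distrib)
  finally show ?thesis
    using s assms by (simp add: powr_divide field_simps)
qed

text \<open>Integrability of order \<open>q\<close> improves to order \<open>\<lambda> q\<close>; this needs
  \<open>q > 2\<close> strictly, because \<open>\<mu> < 2\<close> exactly when \<open>q0 > 2\<close>.\<close>

definition mu_of :: "real \<Rightarrow> real" where "mu_of q = q / (q - 1)"
text \<open>\<kappa> is the midpoint of \<mu> and 2, and \<lambda> that of 1 and
  \<open>2 / \<kappa>\<close>. Then \<lambda> > 1 improves integrability, while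
  \<open>\<kappa> \<lambda> < 2\<close> and \<open>\<kappa> > \<mu>\<close> keep the two exponents
  on the Riesz kernel below 2.\<close>

definition kappa_of :: "real \<Rightarrow> real" where "kappa_of q = 1 + mu_of q / 2"
definition lam_of :: "real \<Rightarrow> real" where "lam_of q = (1 + 2 / kappa_of q) / 2"
text \<open>The value of \<open>1 / p\<close> for \<open>p = 2 - 2 / q\<close>, hence its largest
  value along the increasing exponents of the iteration.\<close>

definition theta_of :: "real \<Rightarrow> real" where "theta_of q = mu_of q / 2"

lemma parameters_of:
  assumes "q > 2"
  shows "1 < mu_of q" "mu_of q < 2" "mu_of q < kappa_of q" "kappa_of q < 2" "1 < lam_of q" "lam_of q < 2"
    "kappa_of q * lam_of q < 2" "0 < theta_of q" "theta_of q < 1"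
proof -
  show 1: "1 < mu_of q" "mu_of q < 2" using assms by (auto simp: mu_of_def field_simps)
  then show 2: "mu_of q < kappa_of q" "kappa_of q < 2" by (auto simp: kappa_of_def)
  then show "1 < lam_of q" "lam_of q < 2" "kappa_of q * lam_of q < 2" using 1 by (auto simp: lam_of_def field_simps)
  show "0 < theta_of q" "theta_of q < 1" using 1 by (auto simp: theta_of_def)
qed

text \<open>The iteration has the form \<open>X' = K 8^n X^\<theta>\<close>. A geometric ansatz
  \<open>X = A R^n\<close> absorbs \<open>8^n\<close> precisely when
  \<open>R^(1 - \<theta>) = 8\<close>.\<close>

definition rate_of :: "real \<Rightarrow> real" where "rate_of q = 8 powr (1 / (1 - theta_of q))"

lemma rate_of_gt_1: "q > 2 \<Longrightarrow> 1 < rate_of q"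
  using parameters_of(9)[of q] powr_less_mono[of 0 "1 / (1 - theta_of q)" 8] by (simp add: rate_of_def)

text \<open>The solution \<gamma> of \<open>rate_of q powr (1 / \<gamma>) = sqrt (lam_of q)\<close>,
  which is the threshold case of the condition on \<beta> in
  \<open>exp_powr_integral_bound\<close>.\<close>

definition exp_constant :: "real \<Rightarrow> real" where "exp_constant q = 2 * ln (rate_of q) / ln (lam_of q)"

lemma exp_constant_pos: "q > 2 \<Longrightarrow> 0 < exp_constant q"
  using rate_of_gt_1[of q] parameters_of(5)[of q] by (simp add: exp_constant_def)

lemma rate_of_powr_le:
  assumes q: "q > 2" and "\<gamma> \<ge> exp_constant q"
  shows "rate_of q powr (1 / \<gamma>) \<le> sqrt (lam_of q)"
proof -
  have g: "\<gamma> > 0" using assms exp_constant_pos by (meson less_le_trans)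
  have l: "ln (lam_of q) > 0" using parameters_of(5)[OF q] by simp
  have "2 * ln (rate_of q) \<le> \<gamma> * ln (lam_of q)"
    using assms(2) l by (simp add: exp_constant_def pos_divide_le_eq)
  then have "1 / \<gamma> * ln (rate_of q) \<le> ln (lam_of q) / 2"
    using g by (simp add: field_simps)
  also have "\<dots> = ln (sqrt (lam_of q))" using parameters_of(5)[OF q] by (simp add: ln_sqrt)
  finally have "ln (rate_of q powr (1 / \<gamma>)) \<le> ln (sqrt (lam_of q))"
    using rate_of_gt_1[OF q] by simp
  then show ?thesis
    using rate_of_gt_1[OF q] parameters_of(5)[OF q] by (subst (asm) ln_le_cancel_iff) auto
qed

text \<open>One parameter indexes all cylinders: \<open>s = 0\<close> is the target, the iteration
  runs through \<open>s = 1 / 2^n\<close> from \<open>s = 1\<close>, the Riesz potential integrates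
  over \<open>B 2\<close>, and \<open>D 3\<close> carries the initial norms. \<open>J s\<close>
  grows at both ends and is capped at \<open>b\<close>. Spatial and temporal derivatives of the
  cut-off both cost a multiple of \<open>1 / (s - s')\<close>, whence the weight
  \<open>norm (U z) + 1\<close> in \<open>VE\<close>.\<close>

locale vorticity_iteration =
  fixes U :: "(real^2) \<times> real \<Rightarrow> real^2" and W :: "(real^2) \<times> real \<Rightarrow> real"
    and x0 :: "real^2" and t0 r h b q0 V A c :: real
  fixes B :: "real \<Rightarrow> (real^2) set" and J :: "real \<Rightarrow> real set" and D :: "real \<Rightarrow> ((real^2) \<times> real) set"
  defines "B s \<equiv> ball x0 (r + h * s)"
    and "J s \<equiv> {t0 - r - h * s<..<t0 + h * s} \<inter> {..b}"
    and "D s \<equiv> B s \<times> J s"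
  assumes U [measurable]: "U \<in> borel_measurable borel"
    and W [measurable]: "W \<in> borel_measurable borel"
    and pos: "r > 0" "h > 0" "q0 > 2" "V \<ge> 1" "A \<ge> 0" "c \<ge> 0"
    and VE: "\<And>\<alpha> s s'. 0 \<le> \<alpha> \<Longrightarrow> \<alpha> < 1 \<Longrightarrow> 0 \<le> s' \<Longrightarrow> s' < s \<Longrightarrow> s \<le> 3 \<Longrightarrow>
      AE t in lborel. t \<in> J s' \<longrightarrow> (\<integral>\<^sup>+x\<in>B s'. ennreal (\<bar>W (x, t)\<bar> powr (1 + \<alpha>)) \<partial>lborel)
        \<le> ennreal (V / (s - s')) * (\<integral>\<^sup>+z\<in>D s. ennreal (\<bar>W z\<bar> powr (1 + \<alpha>) * (norm (U z) + 1)) \<partial>lborel)"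
    and W2: "(\<integral>\<^sup>+z\<in>D 3. ennreal (\<bar>W z\<bar> powr 2) \<partial>lborel) < \<infinity>"
    and Uq: "(\<integral>\<^sup>+z\<in>D 3. ennreal (norm (U z) powr q0) \<partial>lborel) < \<infinity>"
    and Biot_Savart: "AE t in lborel. t \<in> J 1 \<longrightarrow> (AE y in lborel. y \<in> B 1 \<longrightarrow>
      ennreal (norm (U (y, t))) \<le> ennreal A + ennreal c * (\<integral>\<^sup>+x\<in>B 2. ennreal (\<bar>W (x, t)\<bar> / norm (x - y)) \<partial>lborel))"
begin

section \<open>Concentric cylinders and their integrals\<close>

lemma B_borel [measurable]: "B s \<in> sets borel" and J_borel [measurable]: "J s \<in> sets borel"
  by (auto simp: B_def J_def)

lemma D_borel [measurable]: "D s \<in> sets borel"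
  unfolding D_def borel_prod[symmetric] by (intro pair_measureI) auto

lemma B_mono: "s \<le> s' \<Longrightarrow> B s \<subseteq> B s'" and J_mono: "s \<le> s' \<Longrightarrow> J s \<subseteq> J s'"
proof -
  assume "s \<le> s'"
  then have "h * s \<le> h * s'" using pos by simp
  then show "B s \<subseteq> B s'" "J s \<subseteq> J s'"
    by (auto simp: B_def J_def)
qed

lemma D_mono: "s \<le> s' \<Longrightarrow> D s \<subseteq> D s'"
  unfolding D_def using B_mono J_mono by blast

lemma W_slice [measurable]: "(\<lambda>x. W (x, t)) \<in> borel_measurable borel"
  and U_slice [measurable]: "(\<lambda>x. U (x, t)) \<in> borel_measurable borel"
  by (rule borel_measurable_slice[OF W] borel_measurable_slice[OF U])+

lemma finite_measure_bounds:
  "\<exists>m\<ge>1. \<forall>s\<le>3. emeasure lborel (D s) \<le> ennreal m \<and> emeasure lborel (B s) \<le> ennreal m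
    \<and> emeasure lborel (J s) \<le> ennreal m"
proof -
  have bdd: "bounded (B 3)" "bounded (J 3)"
    by (auto simp: B_def J_def intro: bounded_subset[OF bounded_cball[of t0 "r + h * 3"]] bounded_subset[OF bounded_Ioo])
  then have "bounded (D 3)" unfolding D_def by (rule bounded_Times)
  have fin: "emeasure lborel (D 3) < \<infinity>" "emeasure lborel (B 3) < \<infinity>" "emeasure lborel (J 3) < \<infinity>"
    by (rule emeasure_bounded_finite, fact)+
  define m where "m = 1 + measure lborel (D 3) + measure lborel (B 3) + measure lborel (J 3)"
  have le: "emeasure lborel (D 3) \<le> ennreal m" "emeasure lborel (B 3) \<le> ennreal m" "emeasure lborel (J 3) \<le> ennreal m"
    using fin by (simp_all add: emeasure_eq_ennreal_measure less_top m_def ennreal_leI)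
  show ?thesis
  proof (intro exI[of _ m] conjI allI impI)
    show "m \<ge> 1" by (simp add: m_def)
    fix s :: real assume s: "s \<le> 3"
    show "emeasure lborel (D s) \<le> ennreal m"
      by (rule order_trans[OF emeasure_mono[OF D_mono[OF s]] le(1)]) simp
    show "emeasure lborel (B s) \<le> ennreal m"
      by (rule order_trans[OF emeasure_mono[OF B_mono[OF s]] le(2)]) simp
    show "emeasure lborel (J s) \<le> ennreal m"
      by (rule order_trans[OF emeasure_mono[OF J_mono[OF s]] le(3)]) simp
  qed
qed

lemma nn_integral_D:
  assumes [measurable]: "g \<in> borel_measurable borel"
  shows "(\<integral>\<^sup>+z\<in>D s. g z \<partial>lborel) = (\<integral>\<^sup>+t\<in>J s. (\<integral>\<^sup>+x\<in>B s. g (x, t) \<partial>lborel) \<partial>lborel)"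
proof -
  have "(\<integral>\<^sup>+z\<in>D s. g z \<partial>lborel) = (\<integral>\<^sup>+z. g z * indicator (D s) z \<partial>(lborel \<Otimes>\<^sub>M lborel))"
    by (simp add: lborel_prod)
  also have "\<dots> = (\<integral>\<^sup>+t. (\<integral>\<^sup>+x. g (x, t) * indicator (D s) (x, t) \<partial>lborel) \<partial>lborel)"
    by (rule lborel_pair.nn_integral_snd[symmetric]) (simp add: lborel_prod)
  also have "\<dots> = (\<integral>\<^sup>+t. (\<integral>\<^sup>+x. (g (x, t) * indicator (B s) x) * indicator (J s) t \<partial>lborel) \<partial>lborel)"
    by (simp add: D_def indicator_times mult.assoc)
  also have "\<dots> = (\<integral>\<^sup>+t\<in>J s. (\<integral>\<^sup>+x\<in>B s. g (x, t) \<partial>lborel) \<partial>lborel)"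
  proof (rule nn_integral_cong)
    fix t
    have "(\<lambda>x. g (x, t)) \<in> borel_measurable borel"
      by (rule borel_measurable_slice) simp
    then show "(\<integral>\<^sup>+x. (g (x, t) * indicator (B s) x) * indicator (J s) t \<partial>lborel)
       = (\<integral>\<^sup>+x\<in>B s. g (x, t) \<partial>lborel) * indicator (J s) t"
      by (subst nn_integral_multc) auto
  qed
  finally show ?thesis .
qed

text \<open>The case \<alpha> = 0 of the vorticity estimate, whose right side is finite because
  \<open>W\<close> is square integrable and \<open>q0 > 2\<close>. It controls the part of the Riesz
  potential that comes from vorticity far away.\<close>

lemma vorticity_L1:
  obtains E where "E \<ge> 0" "AE t in lborel. t \<in> J 1 \<longrightarrow> (\<integral>\<^sup>+x\<in>B 2. ennreal \<bar>W (x, t)\<bar> \<partial>lborel) \<le> ennreal E"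
proof -
  obtain m where m: "m \<ge> 1" "\<forall>s\<le>3. emeasure lborel (D s) \<le> ennreal m \<and> emeasure lborel (B s) \<le> ennreal m
    \<and> emeasure lborel (J s) \<le> ennreal m"
    using finite_measure_bounds by (elim exE conjE)
  let ?R = "\<integral>\<^sup>+z\<in>D 3. ennreal (\<bar>W z\<bar> powr (1 + 0) * (norm (U z) + 1)) \<partial>lborel"
  have "?R \<le> (\<integral>\<^sup>+z. ennreal (\<bar>W z\<bar> powr 2) * indicator (D 3) z
      + (2 * (ennreal (norm (U z) powr q0) * indicator (D 3) z) + 4 * indicator (D 3) z) \<partial>lborel)"
  proof (rule nn_integral_mono)
    fix z
    let ?w = "\<bar>W z\<bar>" and ?u = "norm (U z)"
    have u2: "?u\<^sup>2 \<le> ?u powr q0 + 1"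
    proof (cases "?u \<le> 1")
      case True
      then have "?u\<^sup>2 \<le> 1" by (simp add: power_le_one)
      then show ?thesis using powr_ge_zero[of ?u q0] by linarith
    next
      case False
      then have "?u powr 2 \<le> ?u powr q0" using pos by (intro powr_mono) auto
      then show ?thesis using False by simp
    qed
    have "?w * (?u + 1) \<le> ?w\<^sup>2 + (?u + 1)\<^sup>2"
    proof -
      have "0 \<le> ?w * (?u + 1)" by simp
      then show ?thesis using sum_squares_bound[of ?w "?u + 1"] by (simp only: mult.assoc)
    qed
    also have "(?u + 1)\<^sup>2 \<le> 2 * ?u\<^sup>2 + 2"
      using sum_squares_bound[of ?u 1] by (simp add: power2_sum)
    finally have "?w * (?u + 1) \<le> ?w powr 2 + (2 * ?u powr q0 + 4)"
      using u2 by simp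
    then have "ennreal (?w powr (1 + 0) * (?u + 1)) \<le> ennreal (?w powr 2 + (2 * ?u powr q0 + 4))"
      by (intro ennreal_leI) simp
    also have "\<dots> = ennreal (?w powr 2) + (2 * ennreal (?u powr q0) + 4)"
      by (simp add: ennreal_mult del: powr_numeral)
    finally show "ennreal (?w powr (1 + 0) * (?u + 1)) * indicator (D 3) z \<le>
      ennreal (?w powr 2) * indicator (D 3) z + (2 * (ennreal (?u powr q0) * indicator (D 3) z) + 4 * indicator (D 3) z)"
      by (auto split: split_indicator)
  qed
  also have "\<dots> = (\<integral>\<^sup>+z\<in>D 3. ennreal (\<bar>W z\<bar> powr 2) \<partial>lborel)
      + (2 * (\<integral>\<^sup>+z\<in>D 3. ennreal (norm (U z) powr q0) \<partial>lborel) + 4 * emeasure lborel (D 3))"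
    by (simp add: nn_integral_add nn_integral_cmult del: powr_numeral)
  also have "\<dots> < \<infinity>"
    using W2 Uq m(2)[rule_format, of 3] by (auto simp: ennreal_mult_less_top less_top[symmetric] top_unique ennreal_mult_eq_top_iff simp del: powr_numeral)
  finally have fin: "?R < \<infinity>" .
  define E where "E = enn2real (ennreal (V / (3 - 2)) * ?R)"
  have "ennreal (V / (3 - 2)) * ?R = ennreal E"
    using fin by (simp add: E_def ennreal_mult_less_top)
  moreover have "J 1 \<subseteq> J 2" by (rule J_mono) simp
  ultimately have "AE t in lborel. t \<in> J 1 \<longrightarrow> (\<integral>\<^sup>+x\<in>B 2. ennreal \<bar>W (x, t)\<bar> \<partial>lborel) \<le> ennreal E"
    using VE[of 0 2 3] by (auto elim!: eventually_mono)
  then show thesis by (intro that[of E]) (simp_all add: E_def)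
qed

section \<open>One improvement step\<close>

abbreviation "\<mu> \<equiv> mu_of q0"
abbreviation "\<kappa> \<equiv> kappa_of q0"
abbreviation "lam \<equiv> lam_of q0"
abbreviation "\<theta> \<equiv> theta_of q0"

lemmas parameters = parameters_of[OF pos(3)]

text \<open>Here \<open>p / (p - 1) = 2 (q - 1) / (q - 2)\<close>, so the second kernel exponent
  tends to 2 as \<open>q\<close> grows. The gap to 2 equals
  \<open>2 (\<kappa> (q - 1) / q - 1) / (q - 2)\<close>, and \<open>\<kappa> > \<mu>\<close> keeps
  it above a positive multiple of \<open>1 / q\<close>. Its reciprocal therefore grows only linearly
  in \<open>q\<close>.\<close>

lemma exponents:
  assumes q: "q0 \<le> q"
  defines "p \<equiv> 2 - 2 / q"
  shows "1 < p" "p < 2" "p < q * lam" "0 < \<kappa> / q" "\<kappa> / q < 1" "1 / p \<le> \<theta>"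
    "0 < (1 - \<kappa> / q) * (p / (p - 1))" "(1 - \<kappa> / q) * (p / (p - 1)) < 2"
    "1 / (2 - (1 - \<kappa> / q) * (p / (p - 1))) \<le> q / (2 * (\<kappa> / \<mu> - 1))"
proof -
  have q2: "q > 2" using q pos by simp
  show p: "1 < p" "p < 2" using q2 by (auto simp: p_def field_simps)
  have "q * 1 < q * lam" using q2 parameters by (intro mult_strict_left_mono) auto
  then show "p < q * lam" using p q2 by linarith
  show kq: "0 < \<kappa> / q" "\<kappa> / q < 1" using q2 parameters by auto
  have "1 / p = q / (q - 1) / 2" using q2 by (simp add: p_def field_simps)
  also have "q / (q - 1) \<le> \<mu>" using q pos by (simp add: mu_of_def field_simps)
  finally show "1 / p \<le> \<theta>" by (simp add: theta_of_def)
  show "0 < (1 - \<kappa> / q) * (p / (p - 1))" using kq p by simp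
  define d where "d = 2 - (1 - \<kappa> / q) * (p / (p - 1))"
  have pp: "p / (p - 1) = 2 * (q - 1) / (q - 2)" using q2 by (simp add: p_def field_simps)
  have "(1 - \<kappa> / q) * (2 * (q - 1)) = 2 * (q - 1) - 2 * (\<kappa> * (q - 1) / q)"
    using q2 by (simp add: field_simps)
  then have "d = 2 * (\<kappa> * (q - 1) / q - 1) / (q - 2)"
    unfolding d_def pp using q2 by (simp add: field_simps)
  moreover have "\<kappa> / \<mu> \<le> \<kappa> * (q - 1) / q"
  proof -
    have "1 / \<mu> \<le> (q - 1) / q" using q pos by (simp add: mu_of_def field_simps)
    then have "\<kappa> * (1 / \<mu>) \<le> \<kappa> * ((q - 1) / q)" using parameters by (intro mult_left_mono) auto
    then show ?thesis by simp
  qed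
  moreover have k1: "\<kappa> / \<mu> - 1 > 0" using parameters by simp
  ultimately have d: "2 * (\<kappa> / \<mu> - 1) / (q - 2) \<le> d" using q2 by (simp add: divide_right_mono)
  moreover have "2 * (\<kappa> / \<mu> - 1) / q \<le> 2 * (\<kappa> / \<mu> - 1) / (q - 2)"
    using q2 k1 by (intro divide_left_mono) auto
  moreover have l: "2 * (\<kappa> / \<mu> - 1) / q > 0" using q2 k1 by simp
  ultimately have d': "2 * (\<kappa> / \<mu> - 1) / q \<le> d" "d > 0" by linarith+
  then show "(1 - \<kappa> / q) * (p / (p - 1)) < 2" by (simp add: d_def)
  have "1 / d \<le> 1 / (2 * (\<kappa> / \<mu> - 1) / q)"
    using d' l by (intro divide_left_mono mult_pos_pos) auto
  then show "1 / (2 - (1 - \<kappa> / q) * (p / (p - 1))) \<le> q / (2 * (\<kappa> / \<mu> - 1))"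
    by (simp add: d_def)
qed

text \<open>\<open>|W|^(2 - 2/q)\<close> is the power \<open>1 - 1/q\<close> of
  \<open>|W|^2\<close>, and \<open>|U|\<close> the power \<open>1/q\<close> of \<open>|U|^q\<close>.
  What matters is the form of the bound: linear in \<open>X\<close> with \<open>K\<close>
  independent of \<open>q\<close> and \<open>s\<close>, so that the later root of order
  \<open>p > 1\<close> leaves a power of \<open>X\<close> below 1.\<close>

lemma vorticity_power_bound:
  "\<exists>K\<ge>1. \<forall>q s X. q0 \<le> q \<and> s \<le> 3 \<and> 1 \<le> X \<and>
     (\<integral>\<^sup>+z\<in>D s. ennreal (norm (U z) powr q) \<partial>lborel) \<le> ennreal (X powr q) \<longrightarrow>
     (\<integral>\<^sup>+z\<in>D s. ennreal (\<bar>W z\<bar> powr (2 - 2 / q) * (norm (U z) + 1)) \<partial>lborel) \<le> ennreal (K * X)"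
proof -
  obtain m where m: "m \<ge> 1" "\<forall>s\<le>3. emeasure lborel (D s) \<le> ennreal m \<and> emeasure lborel (B s) \<le> ennreal m
    \<and> emeasure lborel (J s) \<le> ennreal m"
    using finite_measure_bounds by (elim exE conjE)
  define E where "E = enn2real (\<integral>\<^sup>+z\<in>D 3. ennreal (\<bar>W z\<bar> powr 2) \<partial>lborel)"
  have E: "(\<integral>\<^sup>+z\<in>D 3. ennreal (\<bar>W z\<bar> powr 2) \<partial>lborel) = ennreal E" "E \<ge> 0"
    using W2 by (auto simp: E_def)
  have main: "(\<integral>\<^sup>+z\<in>D s. ennreal (\<bar>W z\<bar> powr (2 - 2 / q) * (norm (U z) + 1)) \<partial>lborel) \<le> ennreal ((2 * E + 1 + m) * X)"
    if q: "q0 \<le> q" and s: "s \<le> 3" and X: "1 \<le> X"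
      and Us: "(\<integral>\<^sup>+z\<in>D s. ennreal (norm (U z) powr q) \<partial>lborel) \<le> ennreal (X powr q)" for q s X
  proof -
    have q2: "q > 2" using q pos by simp
    let ?w = "\<lambda>z. \<bar>W z\<bar>" and ?u = "\<lambda>z. norm (U z)"
    have Es: "(\<integral>\<^sup>+z\<in>D s. ennreal (?w z powr 2) \<partial>lborel) \<le> ennreal E"
      unfolding E(1)[symmetric] using D_mono[OF s] by (intro nn_integral_mono) (auto split: split_indicator)
    have wu: "(\<integral>\<^sup>+z\<in>D s. ennreal (?w z powr (2 - 2 / q) * ?u z) \<partial>lborel) \<le> ennreal ((E + 1) * X)"
    proof -
      \<comment> \<open>The three-factor inequality serves for two factors: the weight
        \<open>1/q\<close> of \<open>|U|^q\<close> is split into equal halves.\<close>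
      have e: "ennreal (?w z powr (2 - 2 / q) * ?u z) * indicator (D s) z =
        ennreal ((?w z powr 2 * indicator (D s) z) powr (1 - 1/q) * (?u z powr q * indicator (D s) z) powr (1/(2*q))
          * (?u z powr q * indicator (D s) z) powr (1/(2*q)))" for z
      proof (cases "z \<in> D s")
        case True
        have "(?u z powr q) powr (1/(2*q)) * (?u z powr q) powr (1/(2*q)) = ?u z"
          using q2 by (simp add: powr_powr powr_add[symmetric])
        then show ?thesis
          using True q2 by (simp add: powr_powr right_diff_distrib mult.assoc del: powr_numeral)
      qed simp
      have "(\<integral>\<^sup>+z\<in>D s. ennreal (?w z powr (2 - 2 / q) * ?u z) \<partial>lborel)
        \<le> ennreal (E powr (1 - 1/q) * (X powr q) powr (1/(2*q)) * (X powr q) powr (1/(2*q)))"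
        unfolding e
      proof (rule Hoelder3)
        show "(\<integral>\<^sup>+z. ennreal (?w z powr 2 * indicator (D s) z) \<partial>lborel) \<le> ennreal E"
          using Es by (simp add: ennreal_mult ennreal_indicator del: powr_numeral)
        show "(\<integral>\<^sup>+z. ennreal (?u z powr q * indicator (D s) z) \<partial>lborel) \<le> ennreal (X powr q)"
          "(\<integral>\<^sup>+z. ennreal (?u z powr q * indicator (D s) z) \<partial>lborel) \<le> ennreal (X powr q)"
          using Us by (simp_all add: ennreal_mult ennreal_indicator)
      qed (use q2 E in \<open>auto simp: field_simps\<close>)
      also have "(X powr q) powr (1/(2*q)) * (X powr q) powr (1/(2*q)) = X"
        using q2 X by (simp add: powr_powr powr_add[symmetric])
      then have "E powr (1 - 1/q) * (X powr q) powr (1/(2*q)) * (X powr q) powr (1/(2*q)) = E powr (1 - 1/q) * X"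
        by (simp add: mult.assoc)
      also have "ennreal (E powr (1 - 1/q) * X) \<le> ennreal ((E + 1) * X)"
      proof (intro ennreal_leI mult_right_mono)
        have "E powr (1 - 1/q) \<le> (E + 1) powr (1 - 1/q)" using E q2 by (intro powr_mono2) auto
        also have "\<dots> \<le> (E + 1) powr 1" using E q2 by (intro powr_mono) auto
        finally show "E powr (1 - 1/q) \<le> E + 1" using E by simp
      qed (use X in simp)
      finally show ?thesis .
    qed
    have w: "(\<integral>\<^sup>+z\<in>D s. ennreal (?w z powr (2 - 2 / q)) \<partial>lborel) \<le> ennreal (E + m)"
    proof -
      have "(\<integral>\<^sup>+z\<in>D s. ennreal (?w z powr (2 - 2 / q)) \<partial>lborel)
        \<le> (\<integral>\<^sup>+z. ennreal (?w z powr 2) * indicator (D s) z + indicator (D s) z \<partial>lborel)"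
      proof (rule nn_integral_mono)
        fix z
        have "?w z powr (2 - 2 / q) \<le> ?w z powr 2 + 1"
        proof (cases "?w z \<le> 1")
          case True
          then have "?w z powr (2 - 2/q) \<le> 1" using q2 by (intro powr_le1) (auto simp: field_simps)
          then show ?thesis using powr_ge_zero[of "?w z" 2] by linarith
        next
          case False
          then have "?w z powr (2 - 2/q) \<le> ?w z powr 2" using q2 by (intro powr_mono) auto
          then show ?thesis by linarith
        qed
        then have "ennreal (?w z powr (2 - 2/q)) \<le> ennreal (?w z powr 2) + 1"
          by (metis ennreal_1 ennreal_leI ennreal_plus powr_ge_zero zero_le_one)
        then show "ennreal (?w z powr (2 - 2 / q)) * indicator (D s) z
            \<le> ennreal (?w z powr 2) * indicator (D s) z + indicator (D s) z"
          by (auto split: split_indicator)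
      qed
      also have "\<dots> = (\<integral>\<^sup>+z\<in>D s. ennreal (?w z powr 2) \<partial>lborel) + emeasure lborel (D s)"
        by (subst nn_integral_add) auto
      also have "\<dots> \<le> ennreal E + ennreal m"
        using Es m s by (intro add_mono) auto
      finally show ?thesis using E m by simp
    qed
    have "(\<integral>\<^sup>+z\<in>D s. ennreal (?w z powr (2 - 2 / q) * (?u z + 1)) \<partial>lborel)
      = (\<integral>\<^sup>+z. ennreal (?w z powr (2 - 2 / q) * ?u z) * indicator (D s) z
           + ennreal (?w z powr (2 - 2 / q)) * indicator (D s) z \<partial>lborel)"
      by (intro nn_integral_cong) (auto simp: distrib_left split: split_indicator)
    also have "\<dots> \<le> ennreal ((E + 1) * X) + ennreal (E + m)"
      by (subst nn_integral_add) (auto intro!: add_mono wu w)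
    also have "\<dots> = ennreal ((E + 1) * X + (E + m))"
      using E m X by (subst ennreal_plus) auto
    also have "\<dots> \<le> ennreal ((2 * E + 1 + m) * X)"
    proof (rule ennreal_leI)
      have "(E + m) * 1 \<le> (E + m) * X" using E m X by (intro mult_left_mono) auto
      then show "(E + 1) * X + (E + m) \<le> (2 * E + 1 + m) * X" by (simp add: algebra_simps)
    qed
    finally show ?thesis .
  qed
  show ?thesis
    by (rule exI[of _ "2 * E + 1 + m"]) (use main E m in auto)
qed

text \<open>Vorticity in the middle ball is convolved with the truncated kernel. The rest lies at
  distance at least \<open>(s - s') h / 2\<close> from \<open>B s'\<close>, and its
  \<open>L^1\<close> norm produces the term \<open>1 / (s - s')\<close>. The factor \<open>q\<close>
  stems from the kernel exponent approaching 2, the power \<theta> from the root of order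
  \<open>p\<close>. \<open>K\<close> is chosen before \<open>q\<close>, \<open>s\<close>,
  \<open>s'\<close> and \<open>X\<close>.\<close>

lemma step_bound:
  "\<exists>K\<ge>1. \<forall>q s s' X. q0 \<le> q \<and> 0 \<le> s' \<and> s' < s \<and> s \<le> 1 \<and> 1 \<le> X \<and>
     (\<integral>\<^sup>+z\<in>D s. ennreal (norm (U z) powr q) \<partial>lborel) \<le> ennreal (X powr q) \<longrightarrow>
     (AE t in lborel. t \<in> J s' \<longrightarrow> (\<integral>\<^sup>+x\<in>B s'. ennreal (norm (U (x, t)) powr (q * lam)) \<partial>lborel)
        \<le> ennreal ((K * (1 / (s - s') + q * (X / (s - s')) powr \<theta>)) powr (q * lam)))"
proof -
  obtain m where m: "m \<ge> 1" "\<forall>s\<le>3. emeasure lborel (D s) \<le> ennreal m \<and> emeasure lborel (B s) \<le> ennreal m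
    \<and> emeasure lborel (J s) \<le> ennreal m"
    using finite_measure_bounds by (elim exE conjE)
  obtain K0 where K0: "K0 \<ge> 1" "\<forall>q s X. q0 \<le> q \<and> s \<le> 3 \<and> 1 \<le> X \<and>
     (\<integral>\<^sup>+z\<in>D s. ennreal (norm (U z) powr q) \<partial>lborel) \<le> ennreal (X powr q) \<longrightarrow>
     (\<integral>\<^sup>+z\<in>D s. ennreal (\<bar>W z\<bar> powr (2 - 2 / q) * (norm (U z) + 1)) \<partial>lborel) \<le> ennreal (K0 * X)"
    using vorticity_power_bound by (elim exE conjE)
  obtain E where E: "E \<ge> 0" "AE t in lborel. t \<in> J 1 \<longrightarrow> (\<integral>\<^sup>+x\<in>B 2. ennreal \<bar>W (x, t)\<bar> \<partial>lborel) \<le> ennreal E"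
    by (rule vorticity_L1)
  \<comment> \<open>The diameter of \<open>B 3\<close>: for two points of the balls in play the
    truncation is invisible.\<close>
  define R where "R = 2 * (r + h * 3)"
  have R: "R > 0" using pos by (simp add: R_def)
  obtain Kk where Kk: "Kk > 0" "\<And>\<sigma>. 0 < \<sigma> \<Longrightarrow> \<sigma> < 2 \<Longrightarrow>
      (\<integral>\<^sup>+z. ennreal (riesz_kernel R z powr \<sigma>) \<partial>lborel) \<le> ennreal (Kk / (2 - \<sigma>))"
    using riesz_kernel_powr_integral[OF R] by metis
  \<comment> \<open>\<open>L1\<close> does not involve \<open>q\<close>, since the first kernel
    exponent will be \<open>\<kappa> * lam\<close> at every step. The second kernel integral is at
    most \<open>l2 * q\<close>.\<close>
  define L1 where "L1 = Kk / (2 - \<kappa> * lam)"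
  define l2 where "l2 = max 1 (Kk / (2 * (\<kappa> / \<mu> - 1)))"
  have L1: "L1 > 0" using Kk parameters by (simp add: L1_def)
  \<comment> \<open>The affine term at distance \<open>d = s - s' \<le> 1\<close> is at most
    \<open>a0 / d\<close>.\<close>
  define a0 where "a0 = A + 2 * c * E / h"
  have a0: "a0 \<ge> 0" using pos E by (simp add: a0_def)
  define K where "K = max 1 (max (2 * (m + 1) * a0) (2 * (L1 + 1) * c * (2 * V * K0) * l2))"
  have K: "K \<ge> 1" "2 * (m + 1) * a0 \<le> K" "2 * (L1 + 1) * c * (2 * V * K0) * l2 \<le> K"
    by (auto simp: K_def)
  have "AE t in lborel. t \<in> J s' \<longrightarrow> (\<integral>\<^sup>+x\<in>B s'. ennreal (norm (U (x, t)) powr (q * lam)) \<partial>lborel)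
        \<le> ennreal ((K * (1 / (s - s') + q * (X / (s - s')) powr \<theta>)) powr (q * lam))"
    if q: "q0 \<le> q" and s: "0 \<le> s'" "s' < s" "s \<le> 1" and X: "1 \<le> X"
      and Us: "(\<integral>\<^sup>+z\<in>D s. ennreal (norm (U z) powr q) \<partial>lborel) \<le> ennreal (X powr q)" for q s s' X
  proof -
    define d where "d = s - s'"
    \<comment> \<open>Half of the gap is spent on the vorticity estimate, the other half separates
      near from far vorticity.\<close>
    define sm where "sm = (s + s') / 2"
    have d: "0 < d" "d \<le> 1" "s - sm = d / 2" "sm - s' = d / 2" "s' < sm" "sm < s" "sm \<le> 2"
      using s by (auto simp: d_def sm_def field_simps)
    define p where "p = 2 - 2 / q"
    have q2: "q > 2" using q pos by simp
    note ex = exponents[OF q, folded p_def]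
    define Q where "Q = q * lam"
    \<comment> \<open>Chosen so that \<open>\<tau> * Q = \<kappa> * lam\<close> stays fixed while
      \<open>q\<close> grows.\<close>
    define \<tau> where "\<tau> = \<kappa> / q"
    have \<tau>Q: "\<tau> * Q = \<kappa> * lam" using q2 by (simp add: \<tau>_def Q_def)
    define F where "F = 2 * V * K0 * (X / d)"
    have X1: "1 \<le> X / d" using X d by (simp add: field_simps)
    have "1 * 1 \<le> V * K0" using pos K0 by (intro mult_mono) auto
    then have VK: "1 \<le> 2 * V * K0" by simp
    have "1 * 1 \<le> F" unfolding F_def using VK X1 by (intro mult_mono) linarith+
    then have F: "1 \<le> F" by simp
    define L2 where "L2 = l2 * q"
    have "1 * 1 \<le> L2" unfolding L2_def using q2 by (intro mult_mono) (auto simp: l2_def)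
    then have L2: "1 \<le> L2" by simp
    have Wp: "AE t in lborel. t \<in> J sm \<longrightarrow> (\<integral>\<^sup>+x\<in>B sm. ennreal (\<bar>W (x, t)\<bar> powr p) \<partial>lborel) \<le> ennreal F"
    proof -
      have al: "1 + (1 - 2 / q) = p" by (simp add: p_def)
      have "ennreal (V / (s - sm)) * (\<integral>\<^sup>+z\<in>D s. ennreal (\<bar>W z\<bar> powr p * (norm (U z) + 1)) \<partial>lborel)
          \<le> ennreal (V / (s - sm)) * ennreal (K0 * X)"
        using K0(2) q s X Us unfolding p_def by (intro mult_left_mono) auto
      also have "\<dots> = ennreal F"
        using pos d K0 X by (simp add: ennreal_mult[symmetric] F_def field_simps)
      finally have le: "ennreal (V / (s - sm)) * (\<integral>\<^sup>+z\<in>D s. ennreal (\<bar>W z\<bar> powr p * (norm (U z) + 1)) \<partial>lborel) \<le> ennreal F" .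
      have "0 \<le> 1 - 2 / q" "1 - 2 / q < 1" "0 \<le> sm" "s \<le> 3" using q2 s d by auto
      from VE[OF this(1,2,3) d(6) this(4), unfolded al] show ?thesis
        by (rule eventually_mono) (intro impI, drule (1) mp, erule order_trans, rule le)
    qed
    have J1: "J s' \<subseteq> J 1" "J s' \<subseteq> J sm" using s d by (auto intro!: J_mono)
    show ?thesis
      using Wp E(2) Biot_Savart
    proof eventually_elim
      case (elim t)
      show ?case
      proof
        assume t: "t \<in> J s'"
        define f where "f x = \<bar>W (x, t)\<bar> * indicator (B sm) x" for x
        have [measurable]: "f \<in> borel_measurable borel" unfolding f_def by measurable
        define a where "a = A + c * (2 / (d * h) * E)"
        have a: "0 \<le> a" using pos d E by (simp add: a_def)
        have conv: "AE y in lborel. y \<in> B s' \<longrightarrow> ennreal (norm (U (y, t))) \<le> ennreal a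
            + ennreal c * (\<integral>\<^sup>+x. ennreal (f x * riesz_kernel R (x - y)) \<partial>lborel)"
        proof -
          have "AE y in lborel. y \<in> B 1 \<longrightarrow> ennreal (norm (U (y, t))) \<le> ennreal A
              + ennreal c * (\<integral>\<^sup>+x\<in>B 2. ennreal (\<bar>W (x, t)\<bar> / norm (x - y)) \<partial>lborel)"
            using elim(3) t J1 by blast
          then show ?thesis
          proof eventually_elim
            case (elim y)
            show ?case
            proof
              assume y: "y \<in> B s'"
              have "(\<integral>\<^sup>+x\<in>B 2. ennreal (\<bar>W (x, t)\<bar> / norm (x - y)) \<partial>lborel)
                \<le> (\<integral>\<^sup>+x. ennreal (f x * riesz_kernel R (x - y))
                    + ennreal (2 / (d * h)) * (ennreal \<bar>W (x, t)\<bar> * indicator (B 2) x) \<partial>lborel)"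
              proof (rule nn_integral_mono)
                fix x
                show "ennreal (\<bar>W (x, t)\<bar> / norm (x - y)) * indicator (B 2) x \<le>
                  ennreal (f x * riesz_kernel R (x - y))
                    + ennreal (2 / (d * h)) * (ennreal \<bar>W (x, t)\<bar> * indicator (B 2) x)"
                proof (cases "x \<in> B 2")
                  case x: True
                  show ?thesis
                  proof (cases "x \<in> B sm")
                    case True
                    have "h * s' \<le> h * 3" "h * sm \<le> h * 3" using pos s d by auto
                    then have "dist x0 x < r + h * 3" "dist x0 y < r + h * 3"
                      using True y by (auto simp: B_def)
                    then have "norm (x - y) < R"
                      using dist_triangle2[of x y x0] by (simp add: R_def dist_norm norm_minus_commute)
                    then have "ennreal (\<bar>W (x, t)\<bar> / norm (x - y)) \<le> ennreal (f x * riesz_kernel R (x - y))"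
                      using True by (simp add: f_def riesz_kernel_def)
                    then show ?thesis using x by (auto intro: order_trans)
                  next
                    \<comment> \<open>Far vorticity: \<open>x\<close> lies outside the middle ball
                      and \<open>y\<close> in the inner one, so the kernel is bounded by
                      \<open>2 / (d * h)\<close>.\<close>
                    case False
                    have "dist x0 x \<ge> r + h * sm" "dist x0 y < r + h * s'"
                      using False y by (auto simp: B_def)
                    then have "h * (sm - s') \<le> norm (x - y)"
                      using dist_triangle[of x0 x y] by (simp add: dist_norm norm_minus_commute algebra_simps)
                    then have n: "d * h / 2 \<le> norm (x - y)" using d by (simp add: mult.commute)
                    have "\<bar>W (x, t)\<bar> / norm (x - y) \<le> \<bar>W (x, t)\<bar> / (d * h / 2)"
                    proof (rule divide_left_mono[OF n])
                      have dh: "0 < d * h / 2" using d(1) pos by simp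
                      then show "0 < norm (x - y) * (d * h / 2)"
                        using less_le_trans[OF dh n] by (intro mult_pos_pos)
                    qed simp
                    then have "ennreal (\<bar>W (x, t)\<bar> / norm (x - y)) \<le> ennreal (2 / (d * h) * \<bar>W (x, t)\<bar>)"
                      by (intro ennreal_leI) (simp add: mult.commute)
                    also have "\<dots> = ennreal (2 / (d * h)) * ennreal \<bar>W (x, t)\<bar>"
                      using d pos by (intro ennreal_mult) auto
                    finally show ?thesis using x by (auto intro: order_trans)
                  qed
                qed simp
              qed
              also have "\<dots> = (\<integral>\<^sup>+x. ennreal (f x * riesz_kernel R (x - y)) \<partial>lborel)
                  + ennreal (2 / (d * h)) * (\<integral>\<^sup>+x\<in>B 2. ennreal \<bar>W (x, t)\<bar> \<partial>lborel)"
                by (simp add: nn_integral_add nn_integral_cmult)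
              also have "\<dots> \<le> (\<integral>\<^sup>+x. ennreal (f x * riesz_kernel R (x - y)) \<partial>lborel)
                  + ennreal (2 / (d * h)) * ennreal E"
                using \<open>t \<in> J 1 \<longrightarrow> _ \<le> ennreal E\<close> t J1 by (intro add_left_mono mult_left_mono) auto
              finally have le: "ennreal A + ennreal c * (\<integral>\<^sup>+x\<in>B 2. ennreal (\<bar>W (x, t)\<bar> / norm (x - y)) \<partial>lborel)
                  \<le> ennreal A + ennreal c * ((\<integral>\<^sup>+x. ennreal (f x * riesz_kernel R (x - y)) \<partial>lborel)
                  + ennreal (2 / (d * h)) * ennreal E)"
                by (intro add_left_mono mult_left_mono) auto
              have eq: "ennreal A + ennreal c * ((\<integral>\<^sup>+x. ennreal (f x * riesz_kernel R (x - y)) \<partial>lborel)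
                  + ennreal (2 / (d * h)) * ennreal E) = ennreal a
                  + ennreal c * (\<integral>\<^sup>+x. ennreal (f x * riesz_kernel R (x - y)) \<partial>lborel)"
                using pos E d by (simp add: a_def ennreal_mult distrib_left add_ac del: times_divide_eq_left)
              have "y \<in> B 1" using y B_mono[of s' 1] s by auto
              then show "ennreal (norm (U (y, t))) \<le> ennreal a
                  + ennreal c * (\<integral>\<^sup>+x. ennreal (f x * riesz_kernel R (x - y)) \<partial>lborel)"
                using elim le unfolding eq by (auto intro: order_trans)
            qed
          qed
        qed
        have fp: "(\<integral>\<^sup>+x. ennreal (f x powr p) \<partial>lborel) \<le> ennreal F"
        proof -
          have "(\<integral>\<^sup>+x. ennreal (f x powr p) \<partial>lborel) = (\<integral>\<^sup>+x\<in>B sm. ennreal (\<bar>W (x, t)\<bar> powr p) \<partial>lborel)"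
            by (intro nn_integral_cong) (auto simp: f_def split: split_indicator)
          then show ?thesis using elim(1) t J1 by auto
        qed
        have k1: "(\<integral>\<^sup>+x. ennreal (riesz_kernel R x powr (\<tau> * Q)) \<partial>lborel) \<le> ennreal L1"
          unfolding \<tau>Q L1_def using parameters by (intro Kk) auto
        have k2: "(\<integral>\<^sup>+x. ennreal (riesz_kernel R x powr ((1 - \<tau>) * (p / (p - 1)))) \<partial>lborel) \<le> ennreal L2"
        proof -
          have "(\<integral>\<^sup>+x. ennreal (riesz_kernel R x powr ((1 - \<tau>) * (p / (p - 1)))) \<partial>lborel)
            \<le> ennreal (Kk / (2 - (1 - \<tau>) * (p / (p - 1))))"
            unfolding \<tau>_def by (intro Kk ex)
          also have "\<dots> \<le> ennreal L2"
          proof (rule ennreal_leI)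
            have "Kk * (1 / (2 - (1 - \<tau>) * (p / (p - 1)))) \<le> Kk * (q / (2 * (\<kappa> / \<mu> - 1)))"
              unfolding \<tau>_def using Kk by (intro mult_left_mono ex) auto
            also have "\<dots> = Kk / (2 * (\<kappa> / \<mu> - 1)) * q" by simp
            also have "\<dots> \<le> L2"
              unfolding L2_def l2_def using q2 by (intro mult_right_mono) auto
            finally show "Kk / (2 - (1 - \<tau>) * (p / (p - 1))) \<le> L2" by simp
          qed
          finally show ?thesis .
        qed
        have "(\<integral>\<^sup>+x\<in>B s'. ennreal (norm (U (x, t)) powr Q) \<partial>lborel)
          \<le> ennreal (2 powr Q * (a powr Q * m + c powr Q * (F powr (1/p) * L2 powr (1 - 1/p)) powr Q * L1))"
          by (rule convolution_bound[OF _ _ _ _ _ _ _ ex(1) _ _ _ fp _ k1 _ k2 _ conv])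
            (use ex a pos m s F L1 L2 in \<open>auto simp: Q_def \<tau>_def f_def riesz_kernel_nonneg\<close>)
        also have "\<dots> \<le> ennreal ((K * (1 / d + q * (X / d) powr \<theta>)) powr Q)"
        proof (rule ennreal_leI)
          have "1 * 1 \<le> Q" unfolding Q_def using q2 parameters by (intro mult_mono) auto
          then have Q1: "1 \<le> Q" by simp
          define G where "G = F powr (1/p) * L2 powr (1 - 1/p)"
          have G0: "0 \<le> G" by (simp add: G_def)
          \<comment> \<open>Measure and kernel constants are pulled under the power
            \<open>Q\<close>, where they become bounded factors uniformly in
            \<open>q\<close>.\<close>
          have "(m + 1) powr 1 \<le> (m + 1) powr Q" using m Q1 by (intro powr_mono) auto
          then have "a powr Q * m \<le> a powr Q * (m + 1) powr Q"
            using m(1) by (intro mult_left_mono) auto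
          then have "a powr Q * m \<le> ((m + 1) * a) powr Q"
            using a m(1) by (simp add: powr_mult mult.commute)
          moreover have "(L1 + 1) powr 1 \<le> (L1 + 1) powr Q" using L1 Q1 by (intro powr_mono) auto
          then have "(c powr Q * G powr Q) * L1 \<le> (c powr Q * G powr Q) * (L1 + 1) powr Q"
            using L1 by (intro mult_left_mono) auto
          then have "c powr Q * G powr Q * L1 \<le> ((L1 + 1) * c * G) powr Q"
            using L1 pos G0 by (simp add: powr_mult mult_ac)
          ultimately have "a powr Q * m + c powr Q * G powr Q * L1 \<le> ((m + 1) * a) powr Q + ((L1 + 1) * c * G) powr Q"
            by linarith
          also have "\<dots> \<le> ((m + 1) * a + (L1 + 1) * c * G) powr Q"
            using m a L1 pos G0 Q1 by (intro powr_add_superadditive) auto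
          finally have "2 powr Q * (a powr Q * m + c powr Q * G powr Q * L1)
              \<le> 2 powr Q * ((m + 1) * a + (L1 + 1) * c * G) powr Q"
            by (intro mult_left_mono) auto
          also have "\<dots> = (2 * ((m + 1) * a + (L1 + 1) * c * G)) powr Q"
            using m a L1 pos G0 by (subst powr_mult) auto
          also have "\<dots> \<le> (K * (1 / d + q * (X / d) powr \<theta>)) powr Q"
          proof (rule powr_mono2)
            have "A * 1 \<le> A * (1 / d)" using pos d by (intro mult_left_mono) (auto simp: field_simps)
            then have "a \<le> a0 * (1 / d)"
              by (simp add: a_def a0_def add_divide_distrib mult_ac)
            then have "2 * (m + 1) * a \<le> 2 * (m + 1) * (a0 * (1 / d))" using m by (intro mult_left_mono) auto
            also have "\<dots> = (2 * (m + 1) * a0) * (1 / d)" by simp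
            also have "\<dots> \<le> K * (1 / d)" using K d by (intro mult_right_mono) auto
            finally have 1: "2 * (m + 1) * a \<le> K * (1 / d)" .
            \<comment> \<open>The gain: \<open>F\<close> is linear in \<open>X\<close>, and
              \<open>1/p\<close> stays below the fixed \<theta> < 1.\<close>
            have "F powr (1/p) \<le> F powr \<theta>" using F ex by (intro powr_mono) auto
            also have "\<dots> = (2 * V * K0) powr \<theta> * (X / d) powr \<theta>"
              unfolding F_def using VK X1 by (subst powr_mult) auto
            also have "(2 * V * K0) powr \<theta> \<le> (2 * V * K0) powr 1" using VK parameters by (intro powr_mono) auto
            finally have F': "F powr (1/p) \<le> (2 * V * K0) * (X / d) powr \<theta>" using VK by (simp add: mult_right_mono)
            have "L2 powr (1 - 1/p) \<le> L2 powr 1" using L2 ex by (intro powr_mono) auto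
            then have "L2 powr (1 - 1/p) \<le> l2 * q" using L2 by (simp add: L2_def)
            then have "G \<le> (2 * V * K0) * (X / d) powr \<theta> * (l2 * q)"
              unfolding G_def using F' pos K0(1) by (intro mult_mono) auto
            then have "2 * (L1 + 1) * c * G \<le> 2 * (L1 + 1) * c * ((2 * V * K0) * (X / d) powr \<theta> * (l2 * q))"
              using L1 pos by (intro mult_left_mono) auto
            also have "\<dots> = (2 * (L1 + 1) * c * (2 * V * K0) * l2) * (q * (X / d) powr \<theta>)" by (simp add: mult_ac)
            also have "\<dots> \<le> K * (q * (X / d) powr \<theta>)" using K q2 by (intro mult_right_mono) auto
            finally have 2: "2 * (L1 + 1) * c * G \<le> K * (q * (X / d) powr \<theta>)" .
            show "2 * ((m + 1) * a + (L1 + 1) * c * G) \<le> K * (1 / d + q * (X / d) powr \<theta>)"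
              using 1 2 by (simp add: algebra_simps)
          qed (use m a L1 pos G0 Q1 in auto)
          finally show "2 powr Q * (a powr Q * m + c powr Q * (F powr (1/p) * L2 powr (1 - 1/p)) powr Q * L1)
              \<le> (K * (1 / d + q * (X / d) powr \<theta>)) powr Q" by (simp add: G_def)
        qed
        finally show "(\<integral>\<^sup>+x\<in>B s'. ennreal (norm (U (x, t)) powr (q * lam)) \<partial>lborel)
          \<le> ennreal ((K * (1 / (s - s') + q * (X / (s - s')) powr \<theta>)) powr (q * lam))"
          by (simp add: Q_def d_def)
      qed
    qed
  qed
  then show ?thesis using K(1) by blast
qed

text \<open>Radii \<open>2^-n\<close> give \<open>1 / (s - s') = 2^(n+1)\<close>, and
  \<open>lam < 2\<close> gives \<open>q \<le> q0 2^n\<close>; their product is of order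
  \<open>4^n\<close>, so \<open>8^n\<close> leaves room. The slice-wise bound is what the conclusion
  needs, and its integral over time feeds the next step.\<close>

lemma iteration_step:
  "\<exists>K\<ge>1. \<forall>n X. 1 \<le> X \<and>
     (\<integral>\<^sup>+z\<in>D ((1/2) ^ n). ennreal (norm (U z) powr (q0 * lam ^ n)) \<partial>lborel) \<le> ennreal (X powr (q0 * lam ^ n)) \<longrightarrow>
     (AE t in lborel. t \<in> J ((1/2) ^ Suc n) \<longrightarrow>
        (\<integral>\<^sup>+x\<in>B ((1/2) ^ Suc n). ennreal (norm (U (x, t)) powr (q0 * lam ^ Suc n)) \<partial>lborel)
          \<le> ennreal ((K * 8 ^ n * X powr \<theta>) powr (q0 * lam ^ Suc n))) \<and>
     (\<integral>\<^sup>+z\<in>D ((1/2) ^ Suc n). ennreal (norm (U z) powr (q0 * lam ^ Suc n)) \<partial>lborel)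
        \<le> ennreal ((K * 8 ^ n * X powr \<theta>) powr (q0 * lam ^ Suc n))"
proof -
  obtain m where m: "m \<ge> 1" "\<forall>s\<le>3. emeasure lborel (D s) \<le> ennreal m \<and> emeasure lborel (B s) \<le> ennreal m
    \<and> emeasure lborel (J s) \<le> ennreal m"
    using finite_measure_bounds by (elim exE conjE)
  obtain K where K: "K \<ge> 1" "\<forall>q s s' X. q0 \<le> q \<and> 0 \<le> s' \<and> s' < s \<and> s \<le> 1 \<and> 1 \<le> X \<and>
     (\<integral>\<^sup>+z\<in>D s. ennreal (norm (U z) powr q) \<partial>lborel) \<le> ennreal (X powr q) \<longrightarrow>
     (AE t in lborel. t \<in> J s' \<longrightarrow> (\<integral>\<^sup>+x\<in>B s'. ennreal (norm (U (x, t)) powr (q * lam)) \<partial>lborel)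
        \<le> ennreal ((K * (1 / (s - s') + q * (X / (s - s')) powr \<theta>)) powr (q * lam)))"
    using step_bound by (elim exE conjE)
  \<comment> \<open>\<open>m + 1\<close> pays for integrating over time, \<open>2 + 2 * q0\<close>
    for the two terms of the step bound.\<close>
  define K' where "K' = (m + 1) * (K * (2 + 2 * q0))"
  have "1 * 1 \<le> K * (2 + 2 * q0)" using K pos by (intro mult_mono) auto
  then have "1 * 1 \<le> K'" unfolding K'_def using m(1) by (intro mult_mono) auto
  then have K': "1 \<le> K'" by simp
  have main: "(AE t in lborel. t \<in> J ((1/2) ^ Suc n) \<longrightarrow>
        (\<integral>\<^sup>+x\<in>B ((1/2) ^ Suc n). ennreal (norm (U (x, t)) powr (q0 * lam ^ Suc n)) \<partial>lborel)
          \<le> ennreal ((K' * 8 ^ n * X powr \<theta>) powr (q0 * lam ^ Suc n))) \<and>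
     (\<integral>\<^sup>+z\<in>D ((1/2) ^ Suc n). ennreal (norm (U z) powr (q0 * lam ^ Suc n)) \<partial>lborel)
        \<le> ennreal ((K' * 8 ^ n * X powr \<theta>) powr (q0 * lam ^ Suc n))"
    if X: "1 \<le> X" and Us: "(\<integral>\<^sup>+z\<in>D ((1/2) ^ n). ennreal (norm (U z) powr (q0 * lam ^ n)) \<partial>lborel) \<le> ennreal (X powr (q0 * lam ^ n))"
    for n X
  proof -
    define s s' q Q where "s = (1/2 :: real) ^ n" and "s' = (1/2 :: real) ^ Suc n" and "q = q0 * lam ^ n" and "Q = q0 * lam ^ Suc n"
    have Qq: "q * lam = Q" by (simp add: q_def Q_def)
    have s: "0 \<le> s'" "s' < s" "s \<le> 1" "s - s' = 1 / 2 ^ Suc n"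
      by (auto simp: s_def s'_def power_le_one field_simps)
    then have s3: "s' \<le> 3" by linarith
    have q: "q0 \<le> q" "q \<le> q0 * 2 ^ n"
      using pos parameters by (auto simp: q_def intro!: power_mono)
    have "q0 * 1 \<le> q0 * lam ^ Suc n"
      using pos parameters by (intro mult_left_mono one_le_power) auto
    then have Q: "1 \<le> Q" using pos(3) unfolding Q_def by linarith
    define Y where "Y = K * (1 / (s - s') + q * (X / (s - s')) powr \<theta>)"
    have Y0: "0 \<le> Y" using K q pos s by (simp add: Y_def)
    have X1: "1 \<le> X powr \<theta>" using X parameters by (simp add: ge_one_powr_ge_zero)
    have Yle: "Y \<le> K * (2 + 2 * q0) * 8 ^ n * X powr \<theta>"
    proof -
      have p2: "(1::real) \<le> 2 ^ Suc n" by (rule one_le_power) simp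
      have "(X / (s - s')) powr \<theta> = X powr \<theta> * (2 ^ Suc n) powr \<theta>"
        using X by (simp add: s(4) powr_mult)
      also have "(2 ^ Suc n) powr \<theta> \<le> (2 ^ Suc n :: real) powr 1"
        using parameters(9) by (intro powr_mono p2) simp
      finally have "(X / (s - s')) powr \<theta> \<le> X powr \<theta> * 2 ^ Suc n" using X by (simp add: mult_left_mono)
      then have "q * (X / (s - s')) powr \<theta> \<le> (q0 * 2 ^ n) * (X powr \<theta> * 2 ^ Suc n)"
        using q pos X by (intro mult_mono) auto
      also have "\<dots> = 2 * q0 * 4 ^ n * X powr \<theta>"
        by (simp add: power_mult_distrib[symmetric] mult_ac)
      also have "\<dots> \<le> 2 * q0 * 8 ^ n * X powr \<theta>"
        using pos by (intro mult_right_mono mult_left_mono power_mono) auto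
      finally have 1: "q * (X / (s - s')) powr \<theta> \<le> 2 * q0 * 8 ^ n * X powr \<theta>" .
      have "1 / (s - s') = 2 * 2 ^ n * 1" by (simp add: s(4))
      also have "\<dots> \<le> 2 * 8 ^ n * X powr \<theta>"
        using X1 by (intro mult_mono power_mono) auto
      finally have "1 / (s - s') + q * (X / (s - s')) powr \<theta> \<le> (2 + 2 * q0) * 8 ^ n * X powr \<theta>"
        using 1 by (simp add: algebra_simps)
      then have "Y \<le> K * ((2 + 2 * q0) * 8 ^ n * X powr \<theta>)"
        unfolding Y_def using K by (intro mult_left_mono) auto
      then show ?thesis by (simp add: mult_ac)
    qed
    define Z where "Z = K' * 8 ^ n * X powr \<theta>"
    have mY: "(m + 1) * Y \<le> Z"
      unfolding Z_def K'_def using mult_left_mono[OF Yle, of "m + 1"] m(1) by (simp add: mult_ac)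
    have slice: "AE t in lborel. t \<in> J s' \<longrightarrow> (\<integral>\<^sup>+x\<in>B s'. ennreal (norm (U (x, t)) powr Q) \<partial>lborel) \<le> ennreal (Y powr Q)"
    proof -
      have "(\<integral>\<^sup>+z\<in>D s. ennreal (norm (U z) powr q) \<partial>lborel) \<le> ennreal (X powr q)"
        unfolding s_def q_def by (rule Us)
      then show ?thesis
        using K(2)[rule_format, of q s' s X] q(1) s(1-3) X unfolding Y_def Qq by blast
    qed
    have "1 * Y \<le> (m + 1) * Y" using m(1) Y0 by (intro mult_right_mono) auto
    then have "Y \<le> Z" using mY by simp
    then have YZ: "ennreal (Y powr Q) \<le> ennreal (Z powr Q)"
      using Y0 Q by (intro ennreal_leI powr_mono2) auto
    have "(\<integral>\<^sup>+z\<in>D s'. ennreal (norm (U z) powr Q) \<partial>lborel)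
        = (\<integral>\<^sup>+t\<in>J s'. (\<integral>\<^sup>+x\<in>B s'. ennreal (norm (U (x, t)) powr Q) \<partial>lborel) \<partial>lborel)"
      by (rule nn_integral_D) measurable
    also have "\<dots> \<le> (\<integral>\<^sup>+t. ennreal (Y powr Q) * indicator (J s') t \<partial>lborel)"
      using slice by (intro nn_integral_mono_AE) (auto elim!: eventually_mono split: split_indicator)
    also have "\<dots> = ennreal (Y powr Q) * emeasure lborel (J s')"
      by (simp add: nn_integral_cmult_indicator)
    also have "\<dots> \<le> ennreal (Y powr Q) * ennreal m" using m s3 by (intro mult_left_mono) auto
    also have "\<dots> = ennreal (Y powr Q * m)" using m by (simp add: ennreal_mult)
    also have "\<dots> \<le> ennreal (Z powr Q)"
    proof (rule ennreal_leI)
      have "(m + 1) powr 1 \<le> (m + 1) powr Q" using m Q by (intro powr_mono) auto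
      then have "Y powr Q * m \<le> Y powr Q * (m + 1) powr Q" using m(1) by (intro mult_left_mono) auto
      also have "\<dots> = ((m + 1) * Y) powr Q" using Y0 m(1) by (simp add: powr_mult mult.commute)
      also have "\<dots> \<le> Z powr Q" using mY Y0 m(1) Q by (intro powr_mono2) auto
      finally show "Y powr Q * m \<le> Z powr Q" .
    qed
    finally have "(\<integral>\<^sup>+z\<in>D s'. ennreal (norm (U z) powr Q) \<partial>lborel) \<le> ennreal (Z powr Q)" .
    moreover have "AE t in lborel. t \<in> J s' \<longrightarrow> (\<integral>\<^sup>+x\<in>B s'. ennreal (norm (U (x, t)) powr Q) \<partial>lborel) \<le> ennreal (Z powr Q)"
      using slice by (rule eventually_mono) (intro impI, drule (1) mp, erule order_trans, rule YZ)
    ultimately show ?thesis unfolding s'_def Q_def Z_def by blast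
  qed
  show ?thesis by (rule exI[of _ K']) (use main K' in blast)
qed

text \<open>Because \<theta> < 1, the recursion admits a geometric majorant \<open>A0 R^n\<close>:
  the share \<open>(A0 R^n)^(1 - \<theta>)\<close> absorbs \<open>K 8^n\<close>.\<close>

lemma iteration:
  "\<exists>A0>0. \<forall>n. AE t in lborel. t \<in> J ((1/2) ^ Suc n) \<longrightarrow>
     (\<integral>\<^sup>+x\<in>B ((1/2) ^ Suc n). ennreal (norm (U (x, t)) powr (q0 * lam ^ Suc n)) \<partial>lborel)
       \<le> ennreal ((A0 * rate_of q0 ^ Suc n) powr (q0 * lam ^ Suc n))"
proof -
  obtain K where K: "K \<ge> 1" "\<forall>n X. 1 \<le> X \<and>
     (\<integral>\<^sup>+z\<in>D ((1/2) ^ n). ennreal (norm (U z) powr (q0 * lam ^ n)) \<partial>lborel) \<le> ennreal (X powr (q0 * lam ^ n)) \<longrightarrow>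
     (AE t in lborel. t \<in> J ((1/2) ^ Suc n) \<longrightarrow>
        (\<integral>\<^sup>+x\<in>B ((1/2) ^ Suc n). ennreal (norm (U (x, t)) powr (q0 * lam ^ Suc n)) \<partial>lborel)
          \<le> ennreal ((K * 8 ^ n * X powr \<theta>) powr (q0 * lam ^ Suc n))) \<and>
     (\<integral>\<^sup>+z\<in>D ((1/2) ^ Suc n). ennreal (norm (U z) powr (q0 * lam ^ Suc n)) \<partial>lborel)
        \<le> ennreal ((K * 8 ^ n * X powr \<theta>) powr (q0 * lam ^ Suc n))"
    using iteration_step by (elim exE conjE)
  define e where "e = enn2real (\<integral>\<^sup>+z\<in>D 3. ennreal (norm (U z) powr q0) \<partial>lborel)"
  have e: "(\<integral>\<^sup>+z\<in>D 3. ennreal (norm (U z) powr q0) \<partial>lborel) = ennreal e" "e \<ge> 0"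
    using Uq by (auto simp: e_def)
  \<comment> \<open>The first entry starts the induction from the given \<open>L^q0\<close> norm,
    the second makes \<open>A0 powr (1 - \<theta>)\<close> dominate \<open>K\<close>.\<close>
  define A0 where "A0 = max ((e + 1) powr (1 / q0)) (K powr (1 / (1 - \<theta>)))"
  define R where "R = rate_of q0"
  have R: "R > 1" unfolding R_def using rate_of_gt_1 pos by simp
  have R8: "R powr (1 - \<theta>) = 8"
    unfolding R_def rate_of_def using parameters by (simp add: powr_powr)
  have A0: "1 \<le> A0"
    using K parameters by (auto simp: A0_def le_max_iff_disj ge_one_powr_ge_zero)
  have KA: "K \<le> A0 powr (1 - \<theta>)"
  proof -
    have "K = (K powr (1 / (1 - \<theta>))) powr (1 - \<theta>)" using K parameters by (simp add: powr_powr)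
    also have "\<dots> \<le> A0 powr (1 - \<theta>)" using parameters by (intro powr_mono2) (auto simp: A0_def)
    finally show ?thesis .
  qed
  have AR: "1 \<le> A0 * R ^ n" for n
    using A0 R mult_mono[of 1 A0 1 "R ^ n"] by simp
  have grow: "K * 8 ^ n * (A0 * R ^ n) powr \<theta> \<le> A0 * R ^ Suc n" for n
  proof -
    have "K * 8 ^ n * (A0 * R ^ n) powr \<theta> \<le> A0 powr (1 - \<theta>) * 8 ^ n * (A0 * R ^ n) powr \<theta>"
      using KA by (intro mult_right_mono) auto
    also have "\<dots> = (A0 * R ^ n) powr (1 - \<theta>) * (A0 * R ^ n) powr \<theta>"
      using A0 R power_powr_swap[of R n "1 - \<theta>"] by (simp add: R8 powr_mult)
    also have "\<dots> = A0 * R ^ n"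
      unfolding powr_add[symmetric] using A0 R by simp
    also have "\<dots> \<le> A0 * R ^ Suc n" using A0 R by simp
    finally show ?thesis .
  qed
  have mono: "ennreal ((K * 8 ^ n * (A0 * R ^ n) powr \<theta>) powr (q0 * lam ^ Suc n)) \<le> ennreal ((A0 * R ^ Suc n) powr (q0 * lam ^ Suc n))" for n
    using grow[of n] K pos parameters by (intro ennreal_leI powr_mono2) auto
  have P: "(\<integral>\<^sup>+z\<in>D ((1/2) ^ n). ennreal (norm (U z) powr (q0 * lam ^ n)) \<partial>lborel) \<le> ennreal ((A0 * R ^ n) powr (q0 * lam ^ n))" for n
  proof (induction n)
    case 0
    have "(\<integral>\<^sup>+z\<in>D 1. ennreal (norm (U z) powr q0) \<partial>lborel) \<le> (\<integral>\<^sup>+z\<in>D 3. ennreal (norm (U z) powr q0) \<partial>lborel)"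
      using D_mono[of 1 3] by (intro nn_integral_mono) (auto split: split_indicator)
    also have "\<dots> \<le> ennreal (A0 powr q0)"
      unfolding e
    proof (rule ennreal_leI)
      have "e \<le> ((e + 1) powr (1 / q0)) powr q0" using e pos by (simp add: powr_powr)
      also have "\<dots> \<le> A0 powr q0" using pos by (intro powr_mono2) (auto simp: A0_def)
      finally show "e \<le> A0 powr q0" .
    qed
    finally show ?case by simp
  next
    case (Suc n)
    then show ?case using K(2)[rule_format, of "A0 * R ^ n" n] AR[of n] mono[of n] by (meson order_trans)
  qed
  show ?thesis
  proof (intro exI[of _ A0] conjI allI)
    show "0 < A0" using A0 by simp
    fix n
    have "AE t in lborel. t \<in> J ((1/2) ^ Suc n) \<longrightarrow>
        (\<integral>\<^sup>+x\<in>B ((1/2) ^ Suc n). ennreal (norm (U (x, t)) powr (q0 * lam ^ Suc n)) \<partial>lborel)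
          \<le> ennreal ((K * 8 ^ n * (A0 * R ^ n) powr \<theta>) powr (q0 * lam ^ Suc n))"
      using K(2)[rule_format, of "A0 * R ^ n" n] AR[of n] P[of n] by blast
    then show "AE t in lborel. t \<in> J ((1/2) ^ Suc n) \<longrightarrow>
     (\<integral>\<^sup>+x\<in>B ((1/2) ^ Suc n). ennreal (norm (U (x, t)) powr (q0 * lam ^ Suc n)) \<partial>lborel)
       \<le> ennreal ((A0 * rate_of q0 ^ Suc n) powr (q0 * lam ^ Suc n))"
      unfolding R_def[symmetric]
      by (rule eventually_mono) (intro impI, drule (1) mp, erule order_trans, rule mono)
  qed
qed

lemma exponential_integrability:
  assumes \<gamma>: "\<gamma> \<ge> exp_constant q0"
  shows "\<exists>M. AE t in lborel. t \<in> J 0 \<longrightarrow> (\<integral>\<^sup>+x\<in>B 0. ennreal (exp (norm (U (x, t)) powr (1 / \<gamma>))) \<partial>lborel) \<le> ennreal M"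
proof -
  obtain m where m: "m \<ge> 1" "\<forall>s\<le>3. emeasure lborel (D s) \<le> ennreal m \<and> emeasure lborel (B s) \<le> ennreal m
    \<and> emeasure lborel (J s) \<le> ennreal m"
    using finite_measure_bounds by (elim exE conjE)
  obtain A0 where A0: "A0 > 0" "\<forall>n. AE t in lborel. t \<in> J ((1/2) ^ Suc n) \<longrightarrow>
     (\<integral>\<^sup>+x\<in>B ((1/2) ^ Suc n). ennreal (norm (U (x, t)) powr (q0 * lam ^ Suc n)) \<partial>lborel)
       \<le> ennreal ((A0 * rate_of q0 ^ Suc n) powr (q0 * lam ^ Suc n))"
    using iteration by (elim exE conjE)
  have "0 < \<gamma>" using \<gamma> exp_constant_pos[OF pos(3)] by linarith
  then have pos': "0 < 1 / \<gamma>" "0 \<le> m" "1 \<le> q0" using m(1) pos by auto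
  obtain M where M: "\<And>v (S :: (real^2) set). v \<in> borel_measurable borel \<Longrightarrow> S \<in> sets borel \<Longrightarrow>
    emeasure lborel S \<le> ennreal m \<Longrightarrow> (\<And>x. 0 \<le> v x) \<Longrightarrow>
    (\<And>n. (\<integral>\<^sup>+x\<in>S. ennreal (v x powr (q0 * lam ^ Suc n)) \<partial>lborel) \<le> ennreal ((A0 * rate_of q0 ^ Suc n) powr (q0 * lam ^ Suc n))) \<Longrightarrow>
    (\<integral>\<^sup>+x\<in>S. ennreal (exp (v x powr (1 / \<gamma>))) \<partial>lborel) \<le> ennreal M"
    by (rule exp_powr_integral_bound[OF A0(1) rate_of_gt_1[OF pos(3)] parameters(5) pos'(3,1,2)
          rate_of_powr_le[OF pos(3) \<gamma>], where 'a = "real^2"]) blast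
  \<comment> \<open>One null set serves all \<open>n\<close>. The shrinking cylinders all contain
    \<open>D 0\<close>, so every moment bound restricts to the same ball and the same times.\<close>
  have "AE t in lborel. \<forall>n. t \<in> J ((1/2) ^ Suc n) \<longrightarrow>
     (\<integral>\<^sup>+x\<in>B ((1/2) ^ Suc n). ennreal (norm (U (x, t)) powr (q0 * lam ^ Suc n)) \<partial>lborel)
       \<le> ennreal ((A0 * rate_of q0 ^ Suc n) powr (q0 * lam ^ Suc n))"
    using A0(2) by (simp add: AE_all_countable)
  then have "AE t in lborel. t \<in> J 0 \<longrightarrow> (\<integral>\<^sup>+x\<in>B 0. ennreal (exp (norm (U (x, t)) powr (1 / \<gamma>))) \<partial>lborel) \<le> ennreal M"
  proof eventually_elim
    case (elim t)
    show ?case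
    proof
      assume t: "t \<in> J 0"
      show "(\<integral>\<^sup>+x\<in>B 0. ennreal (exp (norm (U (x, t)) powr (1 / \<gamma>))) \<partial>lborel) \<le> ennreal M"
      proof (rule M)
        fix n
        have z: "0 \<le> (1/2 :: real) ^ Suc n" by simp
        have "(\<integral>\<^sup>+x\<in>B 0. ennreal (norm (U (x, t)) powr (q0 * lam ^ Suc n)) \<partial>lborel)
          \<le> (\<integral>\<^sup>+x\<in>B ((1/2) ^ Suc n). ennreal (norm (U (x, t)) powr (q0 * lam ^ Suc n)) \<partial>lborel)"
          using B_mono[OF z] by (intro nn_integral_mono) (auto split: split_indicator)
        also have "\<dots> \<le> ennreal ((A0 * rate_of q0 ^ Suc n) powr (q0 * lam ^ Suc n))"
          using elim[rule_format, of n] t J_mono[OF z] by blast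
        finally show "(\<integral>\<^sup>+x\<in>B 0. ennreal (norm (U (x, t)) powr (q0 * lam ^ Suc n)) \<partial>lborel)
          \<le> ennreal ((A0 * rate_of q0 ^ Suc n) powr (q0 * lam ^ Suc n))" .
      qed (use m(2) in auto)
    qed
  qed
  then show ?thesis ..
qed

end

subsection \<open>Almost everywhere identities from test functions\<close>

text \<open>The negative and positive parts of \<open>g\<close> on \<open>G\<close> are densities of
  finite measures. The hypothesis compares these measures on open sets, and outer regularity extends
  the comparison to \<open>N\<close>, the part of \<open>G\<close> where \<open>g < 0\<close>. There
  the positive part has no mass, so neither has the negative one.\<close>

lemma AE_nonneg_of_regular:
  fixes g :: "'a::{second_countable_topology, complete_space} \<Rightarrow> real"
  assumes [simp]: "sets M = sets borel" and g: "integrable M g" and [measurable]: "G \<in> sets borel"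
    and V: "\<And>V. open V \<Longrightarrow> 0 \<le> (\<integral>x. indicator (V \<inter> G) x * g x \<partial>M)"
  shows "AE x in M. x \<in> G \<longrightarrow> 0 \<le> g x"
proof -
  have [measurable]: "g \<in> borel_measurable M" using g by simp
  have [measurable_cong]: "sets M = sets borel" by simp
  define \<mu>p where "\<mu>p = density M (\<lambda>x. ennreal (indicator G x * max 0 (g x)))"
  define \<mu>m where "\<mu>m = density M (\<lambda>x. ennreal (indicator G x * max 0 (- g x)))"
  have int: "integrable M (\<lambda>x. indicator A x * (indicator G x * max 0 (g x)))"
    "integrable M (\<lambda>x. indicator A x * (indicator G x * max 0 (- g x)))" if "A \<in> sets borel" for A
    by (rule Bochner_Integration.integrable_bound[OF g], use that in \<open>auto split: split_indicator\<close>)+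
  have em: "emeasure \<mu>p A = ennreal (\<integral>x. indicator A x * (indicator G x * max 0 (g x)) \<partial>M)"
    "emeasure \<mu>m A = ennreal (\<integral>x. indicator A x * (indicator G x * max 0 (- g x)) \<partial>M)"
    if [measurable]: "A \<in> sets borel" for A
  proof -
    have "emeasure \<mu>p A = (\<integral>\<^sup>+x. ennreal (indicator A x * (indicator G x * max 0 (g x))) \<partial>M)"
      unfolding \<mu>p_def by (subst emeasure_density) (auto intro!: nn_integral_cong split: split_indicator)
    also have "\<dots> = ennreal (\<integral>x. indicator A x * (indicator G x * max 0 (g x)) \<partial>M)"
      by (rule nn_integral_eq_integral[OF int(1)]) auto
    finally show "emeasure \<mu>p A = \<dots>" .
    have "emeasure \<mu>m A = (\<integral>\<^sup>+x. ennreal (indicator A x * (indicator G x * max 0 (- g x))) \<partial>M)"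
      unfolding \<mu>m_def by (subst emeasure_density) (auto intro!: nn_integral_cong split: split_indicator)
    also have "\<dots> = ennreal (\<integral>x. indicator A x * (indicator G x * max 0 (- g x)) \<partial>M)"
      by (rule nn_integral_eq_integral[OF int(2)]) auto
    finally show "emeasure \<mu>m A = \<dots>" .
  qed
  have open_le: "emeasure \<mu>m V \<le> emeasure \<mu>p V" if "open V" for V
  proof -
    have [measurable]: "V \<in> sets borel" using that by simp
    have "0 \<le> (\<integral>x. indicator (V \<inter> G) x * g x \<partial>M)" by (rule V[OF that])
    also have "\<dots> = (\<integral>x. indicator V x * (indicator G x * max 0 (g x)) - indicator V x * (indicator G x * max 0 (- g x)) \<partial>M)"
      by (intro Bochner_Integration.integral_cong) (auto split: split_indicator)
    also have "\<dots> = (\<integral>x. indicator V x * (indicator G x * max 0 (g x)) \<partial>M) - (\<integral>x. indicator V x * (indicator G x * max 0 (- g x)) \<partial>M)"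
      using int by (intro Bochner_Integration.integral_diff) auto
    finally show ?thesis by (simp add: em ennreal_leI)
  qed
  define N where "N = {x \<in> space M. x \<in> G \<and> g x < 0}"
  have N[measurable]: "N \<in> sets borel" unfolding N_def by measurable
  have fin: "emeasure \<mu>p (space \<mu>p) \<noteq> \<infinity>"
    using em(1)[of UNIV] sets_eq_imp_space_eq[of M borel] by (simp add: \<mu>p_def)
  have "emeasure \<mu>m N \<le> emeasure \<mu>p N"
  proof -
    have "emeasure \<mu>p N = (INF U \<in> {U. N \<subseteq> U \<and> open U}. emeasure \<mu>p U)"
      by (rule outer_regular[OF _ fin N]) (simp add: \<mu>p_def)
    also have "emeasure \<mu>m N \<le> \<dots>"
    proof (rule INF_greatest)
      fix U assume "U \<in> {U. N \<subseteq> U \<and> open U}"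
      then have "emeasure \<mu>m N \<le> emeasure \<mu>m U" by (intro emeasure_mono) (auto simp: \<mu>m_def)
      also have "\<dots> \<le> emeasure \<mu>p U" using \<open>U \<in> _\<close> by (intro open_le) auto
      finally show "emeasure \<mu>m N \<le> emeasure \<mu>p U" .
    qed
    finally show ?thesis .
  qed
  also have "emeasure \<mu>p N = (\<integral>\<^sup>+x. 0 \<partial>M)"
    unfolding em(1)[OF N] by (auto simp: N_def intro!: integral_eq_zero_AE split: split_indicator)
  finally have "emeasure \<mu>m N = 0" by simp
  then have "(\<integral>\<^sup>+x. ennreal (indicator G x * max 0 (- g x)) * indicator N x \<partial>M) = 0"
    unfolding \<mu>m_def by (subst (asm) emeasure_density) auto
  then have "AE x in M. ennreal (indicator G x * max 0 (- g x)) * indicator N x = 0"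
    by (subst (asm) nn_integral_0_iff_AE) auto
  then show ?thesis
    by (rule AE_mp) (auto simp: N_def split: split_indicator_asm)
qed

text \<open>The indicator of an open set is the limit of the continuous functions
  \<open>min 1 (n * dist)\<close>, with the distance taken to the complement; dominated convergence
  transfers nonnegativity to open sets.\<close>

lemma AE_nonneg_of_continuous_tests:
  fixes g :: "'a::euclidean_space \<Rightarrow> real"
  assumes g: "integrable lborel g" and G: "open G"
    and tests: "\<And>h. continuous_on UNIV h \<Longrightarrow> (\<And>x. 0 \<le> h x) \<Longrightarrow> (\<And>x. h x \<le> 1) \<Longrightarrow> (\<And>x. x \<notin> G \<Longrightarrow> h x = 0)
      \<Longrightarrow> 0 \<le> (\<integral>x. h x * g x \<partial>lborel)"
  shows "AE x in lborel. x \<in> G \<longrightarrow> 0 \<le> g x"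
proof (rule AE_nonneg_of_regular[OF _ g])
  fix V :: "'a set" assume "open V"
  define S where "S = V \<inter> G"
  have S: "open S" using \<open>open V\<close> G by (simp add: S_def open_Int)
  have [measurable]: "S \<in> sets borel" using S by simp
  \<comment> \<open>The distance to the empty set is 0 by convention, hence the separate case of the
    whole space.\<close>
  define h where "h n x = (if S = UNIV then 1 else min 1 (real n * infdist x (- S)))" for n x
  have cont: "continuous_on UNIV (h n)" for n
    unfolding h_def by (cases "S = UNIV") (auto intro!: continuous_intros)
  have h: "0 \<le> h n x" "h n x \<le> 1" for n x by (auto simp: h_def infdist_nonneg)
  have h0: "h n x = 0" if "x \<notin> S" for n x
    using that by (auto simp: h_def)
  have nonneg: "0 \<le> (\<integral>x. h n x * g x \<partial>lborel)" for n
    by (rule tests[OF cont h]) (auto intro!: h0 simp: S_def)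
  have lim: "(\<lambda>n. h n x) \<longlonglongrightarrow> indicator S x" for x
  proof (cases "x \<in> S")
    case True
    show ?thesis
    proof (cases "S = UNIV")
      case False
      have "infdist x (- S) \<noteq> 0"
        using in_closed_iff_infdist_zero[of "- S" x] S False True by auto
      then have d: "infdist x (- S) > 0" using infdist_nonneg[of x "- S"] by linarith
      obtain n0 where n0: "real n0 * infdist x (- S) > 1"
        using reals_Archimedean3[OF d] by blast
      have "h n x = 1" if "n \<ge> n0" for n
      proof -
        have "real n0 * infdist x (- S) \<le> real n * infdist x (- S)" using that d by (intro mult_right_mono) auto
        then show ?thesis using n0 by (simp add: h_def)
      qed
      then show ?thesis
        using True by (intro tendsto_eventually) (auto simp: eventually_sequentially)
    qed (use True in \<open>simp add: h_def\<close>)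
  qed (simp add: h0)
  have [measurable]: "h n \<in> borel_measurable borel" for n
    using cont by (rule borel_measurable_continuous_onI)
  have [measurable]: "g \<in> borel_measurable borel" using g by auto
  have "(\<lambda>n. \<integral>x. h n x * g x \<partial>lborel) \<longlonglongrightarrow> (\<integral>x. indicator S x * g x \<partial>lborel)"
  proof (rule integral_dominated_convergence[where w = "\<lambda>x. \<bar>g x\<bar>"])
    show "AE x in lborel. (\<lambda>n. h n x * g x) \<longlonglongrightarrow> indicator S x * g x"
      by (intro AE_I2 tendsto_mult lim tendsto_const)
    show "AE x in lborel. norm (h n x * g x) \<le> \<bar>g x\<bar>" for n
      using h by (intro AE_I2) (auto simp: abs_mult intro: mult_left_le_one_le)
  qed (use g in auto)
  then show "0 \<le> (\<integral>x. indicator (V \<inter> G) x * g x \<partial>lborel)"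
    unfolding S_def[symmetric] by (rule LIMSEQ_le_const) (use nonneg in blast)
qed (use G in auto)

text \<open>Smooth tests exhaust open intervals, so the positive and negative parts of
  \<open>g\<close> have equal distribution functions and induce the same measure. Being concentrated
  on disjoint sets, both vanish. This is what turns an identity tested in space-time into one at
  almost every time.\<close>

lemma AE_zero_of_test_functions_real:
  fixes g :: "real \<Rightarrow> real"
  assumes g: "integrable lborel g"
    and tests: "\<And>\<eta>. \<eta> \<in> test_functions {a<..<b} \<Longrightarrow> (\<integral>t. g t * \<eta> t \<partial>lborel) = 0"
  shows "AE t in lborel. t \<in> {a<..<b} \<longrightarrow> g t = 0"
proof -
  have [measurable]: "g \<in> borel_measurable borel" using g by auto
  have Ioo: "(\<integral>t. indicator {a<..<c} t * g t \<partial>lborel) = 0" if c: "c \<le> b" for c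
  proof -
    \<comment> \<open>Two rescaled steps, one from each end. As \<open>smooth_step\<close> vanishes
      up to 1/2, the support keeps the distance \<open>1 / (2 (n + 1))\<close> from both
      endpoints.\<close>
    define \<eta> where "\<eta> n t = smooth_step (real (Suc n) * (t - a)) * smooth_step (real (Suc n) * (c - t))" for n t
    have sm: "smooth_on (\<eta> n) UNIV" for n
    proof -
      have "smooth_on (\<lambda>t. smooth_step (real (Suc n) * t + (- (real (Suc n) * a)))) UNIV"
        "smooth_on (\<lambda>t. smooth_step ((- real (Suc n)) * t + real (Suc n) * c)) UNIV"
        by (rule smooth_on_compose_affine[OF smooth_on_smooth_step bounded_linear_mult_right])+
      then show ?thesis unfolding \<eta>_def by (intro smooth_on_mult) (simp_all add: algebra_simps)
    qed
    have [measurable]: "\<eta> n \<in> borel_measurable borel" for n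
      using smooth_on_continuous[OF sm] by (rule borel_measurable_continuous_onI)
    have supp: "{t. \<eta> n t \<noteq> 0} \<subseteq> {a + 1 / (2 * real (Suc n)) .. c - 1 / (2 * real (Suc n))}" for n
    proof
      fix t assume "t \<in> {t. \<eta> n t \<noteq> 0}"
      then have "\<not> real (Suc n) * (t - a) \<le> 1/2" "\<not> real (Suc n) * (c - t) \<le> 1/2"
        using smooth_step_eq_0 by (auto simp: \<eta>_def)
      then show "t \<in> {a + 1 / (2 * real (Suc n)) .. c - 1 / (2 * real (Suc n))}"
        by (auto simp: field_simps)
    qed
    have cl: "closure {t. \<eta> n t \<noteq> 0} \<subseteq> {a + 1 / (2 * real (Suc n)) .. c - 1 / (2 * real (Suc n))}" for n
      by (rule closure_minimal[OF supp]) simp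
    have test: "\<eta> n \<in> test_functions {a<..<b}" for n
      unfolding test_functions_def
    proof (intro CollectI conjI sm)
      show "compact (closure {z. \<eta> n z \<noteq> 0})"
        using cl[of n] by (meson bounded_closed_interval bounded_subset closed_closure compact_eq_bounded_closed)
      have "{a + 1 / (2 * real (Suc n)) .. c - 1 / (2 * real (Suc n))} \<subseteq> {a<..<b}"
      proof -
        define \<delta> where "\<delta> = 1 / (2 * real (Suc n))"
        have "\<delta> > 0" by (simp add: \<delta>_def)
        then show ?thesis unfolding \<delta>_def[symmetric] using c by auto
      qed
      then show "closure {z. \<eta> n z \<noteq> 0} \<subseteq> {a<..<b}" using cl[of n] by blast
    qed
    have lim: "(\<lambda>n. \<eta> n t) \<longlonglongrightarrow> indicator {a<..<c} t" for t
    proof (cases "t \<in> {a<..<c}")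
      case True
      then have pos: "t - a > 0" "c - t > 0" by auto
      obtain n1 n2 where n: "real n1 * (t - a) > 1" "real n2 * (c - t) > 1"
        using reals_Archimedean3[OF pos(1)] reals_Archimedean3[OF pos(2)] by blast
      have "\<eta> n t = 1" if "n \<ge> max n1 n2" for n
      proof -
        have "real n1 * (t - a) \<le> real (Suc n) * (t - a)" "real n2 * (c - t) \<le> real (Suc n) * (c - t)"
          using that True by (auto intro!: mult_right_mono)
        then show ?thesis using n by (simp add: \<eta>_def smooth_step_eq_1)
      qed
      then show ?thesis
        using True by (intro tendsto_eventually) (auto simp: eventually_sequentially intro!: exI[of _ "max n1 n2"])
    next
      case False
      then have "\<eta> n t = 0" for n
        using mult_nonneg_nonpos[of "real (Suc n)" "t - a"] mult_nonneg_nonpos[of "real (Suc n)" "c - t"]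
        by (auto simp: \<eta>_def smooth_step_eq_0 not_less)
      then show ?thesis using False by simp
    qed
    have "(\<lambda>n. \<integral>t. g t * \<eta> n t \<partial>lborel) \<longlonglongrightarrow> (\<integral>t. indicator {a<..<c} t * g t \<partial>lborel)"
    proof (rule integral_dominated_convergence[where w = "\<lambda>t. \<bar>g t\<bar>"])
      show "AE t in lborel. (\<lambda>n. g t * \<eta> n t) \<longlonglongrightarrow> indicator {a<..<c} t * g t"
        by (intro AE_I2) (auto intro!: tendsto_eq_intros lim)
      show "AE t in lborel. norm (g t * \<eta> n t) \<le> \<bar>g t\<bar>" for n
      proof (intro AE_I2)
        fix t
        have "\<bar>\<eta> n t\<bar> \<le> 1"
          using smooth_step_nonneg smooth_step_le_1 by (auto simp: \<eta>_def abs_mult intro!: mult_le_one)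
        then show "norm (g t * \<eta> n t) \<le> \<bar>g t\<bar>"
          using mult_left_mono[of "\<bar>\<eta> n t\<bar>" 1 "\<bar>g t\<bar>"] by (simp add: abs_mult)
      qed
    qed (use g in auto)
    then show ?thesis using tests[OF test] by (simp add: LIMSEQ_const_iff)
  qed
  define \<mu> where "\<mu> s = density lborel (\<lambda>t. ennreal (indicator {a<..<b} t * max 0 (s * g t)))" for s :: real
  have int: "integrable lborel (\<lambda>t. indicator A t * (indicator {a<..<b} t * max 0 (s * g t)))" if "A \<in> sets borel" for A s
    by (rule Bochner_Integration.integrable_bound[OF integrable_mult_right[OF g, of s]], use that in \<open>auto split: split_indicator\<close>)
  have em: "emeasure (\<mu> s) A = ennreal (\<integral>t. indicator A t * (indicator {a<..<b} t * max 0 (s * g t)) \<partial>lborel)"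
    if [measurable]: "A \<in> sets borel" for A s
  proof -
    have "emeasure (\<mu> s) A = (\<integral>\<^sup>+t. ennreal (indicator A t * (indicator {a<..<b} t * max 0 (s * g t))) \<partial>lborel)"
      unfolding \<mu>_def by (subst emeasure_density) (auto intro!: nn_integral_cong split: split_indicator)
    also have "\<dots> = ennreal (\<integral>t. indicator A t * (indicator {a<..<b} t * max 0 (s * g t)) \<partial>lborel)"
      by (rule nn_integral_eq_integral[OF int]) auto
    finally show ?thesis .
  qed
  have fin: "finite_borel_measure (\<mu> s)" for s
    using em[of UNIV s] by (intro finite_borel_measure.intro finite_measureI finite_borel_measure_axioms.intro) (auto simp: \<mu>_def)
  have "\<mu> 1 = \<mu> (-1)"
  proof (rule cdf_unique'[OF fin fin], rule ext)
    fix x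
    have "(\<integral>t. indicator {..x} t * (indicator {a<..<b} t * max 0 (1 * g t)) \<partial>lborel)
        - (\<integral>t. indicator {..x} t * (indicator {a<..<b} t * max 0 (-1 * g t)) \<partial>lborel)
      = (\<integral>t. indicator {..x} t * (indicator {a<..<b} t * max 0 (1 * g t))
          - indicator {..x} t * (indicator {a<..<b} t * max 0 (-1 * g t)) \<partial>lborel)"
      by (intro Bochner_Integration.integral_diff[symmetric] int) auto
    \<comment> \<open>The half-line is closed and the interval open; they differ by the point
      \<open>x\<close> only.\<close>
    also have "\<dots> = (\<integral>t. indicator {a<..<min (b) x} t * g t \<partial>lborel)"
    proof (rule integral_cong_AE)
      show "AE t in lborel. indicator {..x} t * (indicator {a<..<b} t * max 0 (1 * g t))
          - indicator {..x} t * (indicator {a<..<b} t * max 0 (-1 * g t)) = indicator {a<..<min b x} t * g t"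
        using AE_lborel_singleton[of x] by eventually_elim (auto split: split_indicator simp: max_def)
    qed auto
    also have "\<dots> = 0" by (rule Ioo) simp
    finally show "cdf (\<mu> 1) x = cdf (\<mu> (-1)) x"
      by (simp add: cdf_def measure_def em)
  qed
  then have eq: "emeasure (\<mu> 1) A = emeasure (\<mu> (-1)) A" for A by simp
  have nul: "AE t in lborel. t \<in> {a<..<b} \<longrightarrow> s * g t \<le> 0" if s: "s = 1 \<or> s = -1" for s
  proof -
    define N where "N = {t \<in> space lborel. t \<in> {a<..<b} \<and> s * g t > 0}"
    have [measurable]: "N \<in> sets borel" unfolding N_def by measurable
    have "emeasure (\<mu> (- s)) N = 0"
      unfolding em[OF \<open>N \<in> sets borel\<close>] by (auto simp: N_def intro!: integral_eq_zero_AE split: split_indicator)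
    then have "emeasure (\<mu> s) N = 0" using s eq[of N] by auto
    then have "(\<integral>\<^sup>+t. ennreal (indicator {a<..<b} t * max 0 (s * g t)) * indicator N t \<partial>lborel) = 0"
      unfolding \<mu>_def by (subst (asm) emeasure_density) auto
    then have "AE t in lborel. ennreal (indicator {a<..<b} t * max 0 (s * g t)) * indicator N t = 0"
      by (subst (asm) nn_integral_0_iff_AE) auto
    then show ?thesis
      by (rule AE_mp) (auto simp: N_def not_less split: split_indicator_asm)
  qed
  show ?thesis
    using nul[OF disjI1[OF refl]] nul[OF disjI2[OF refl]] by eventually_elim auto
qed

section \<open>Test functions and integration by parts\<close>

lemma test_functionsD:
  assumes "\<phi> \<in> test_functions U"
  shows "smooth_on \<phi> UNIV" "compact (closure {z. \<phi> z \<noteq> 0})" "closure {z. \<phi> z \<noteq> 0} \<subseteq> U"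
    "x \<notin> closure {z. \<phi> z \<noteq> 0} \<Longrightarrow> \<phi> x = 0"
  using assms closure_subset[of "{z. \<phi> z \<noteq> 0}"] by (auto simp: test_functions_def)

lemma test_functionsI:
  assumes "smooth_on \<phi> UNIV" "compact K" "K \<subseteq> U" "\<And>x. x \<notin> K \<Longrightarrow> \<phi> x = 0"
  shows "\<phi> \<in> test_functions U"
proof -
  have "{z. \<phi> z \<noteq> 0} \<subseteq> K" using assms(4) by auto
  then have "closure {z. \<phi> z \<noteq> 0} \<subseteq> K" by (rule closure_minimal[OF _ compact_imp_closed[OF assms(2)]])
  moreover from this have "compact (closure {z. \<phi> z \<noteq> 0})"
    using assms(2) by (meson bounded_subset closed_closure compact_eq_bounded_closed)
  ultimately show ?thesis
    using assms(1,3) by (auto simp: test_functions_def)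
qed

lemma test_functions_grad_support:
  "\<phi> \<in> test_functions U \<Longrightarrow> x \<notin> closure {z. \<phi> z \<noteq> 0} \<Longrightarrow> grad \<phi> x = 0"
  by (rule grad_eq_0_outside_support)

lemma integrable_continuous_compact_support:
  fixes f :: "'a::euclidean_space \<Rightarrow> real"
  assumes f: "continuous_on UNIV f" and K: "compact K" "\<And>x. x \<notin> K \<Longrightarrow> f x = 0"
  shows "integrable lborel f"
proof -
  have "integrable lborel (\<lambda>x. indicator K x *\<^sub>R f x)"
    using K(1) by (rule borel_integrable_compact) (rule continuous_on_subset[OF f subset_UNIV])
  also have "(\<lambda>x. indicator K x *\<^sub>R f x) = f"
    using K(2) by (auto split: split_indicator)
  finally show ?thesis .
qed

lemma continuous_compact_support_bounded:
  fixes f :: "'a::euclidean_space \<Rightarrow> real"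
  assumes f: "continuous_on UNIV f" and K: "compact K" "\<And>x. x \<notin> K \<Longrightarrow> f x = 0"
  obtains M where "M > 0" "\<And>x. \<bar>f x\<bar> \<le> M"
proof -
  have "bounded (f ` K)"
    using compact_continuous_image[OF continuous_on_subset[OF f subset_UNIV] K(1)] by (rule compact_imp_bounded)
  then obtain M where M: "M > 0" "\<And>y. y \<in> f ` K \<Longrightarrow> norm y \<le> M" by (meson bounded_pos)
  have "\<bar>f x\<bar> \<le> M" for x
    using M K(2)[of x] by (cases "x \<in> K") auto
  then show thesis using that M(1) by blast
qed

lemma integral_lborel_translate:
  fixes f :: "'a::euclidean_space \<Rightarrow> real"
  assumes [measurable]: "f \<in> borel_measurable borel"
  shows "(\<integral>x. f (x + c) \<partial>lborel) = (\<integral>x. f x \<partial>lborel)"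
proof -
  have "(\<integral>x. f x \<partial>lborel) = (\<integral>x. f x \<partial>distr lborel borel ((+) c))" by (simp add: lborel_distr_plus)
  also have "\<dots> = (\<integral>x. f (x + c) \<partial>lborel)" by (subst integral_distr) (auto simp: add.commute)
  finally show ?thesis by simp
qed

text \<open>Difference quotients integrate to zero by translation invariance. They converge to the
  partial derivative, dominated through the mean value theorem.\<close>

lemma integral_grad_eq_0:
  assumes F: "F \<in> test_functions UNIV"
  shows "(\<integral>x. grad F x $ i \<partial>lborel) = 0"
proof -
  define K where "K = closure {z. F z \<noteq> 0}"
  note F' = test_functionsD[OF F, folded K_def]
  define e :: "real^2" where "e = axis i 1"
  have e: "norm e = 1" by (simp add: e_def)
  define g where "g x = grad F x $ i" for x
  have g0: "g x = 0" if "x \<notin> K" for x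
    using test_functions_grad_support[OF F, of x] that by (simp add: g_def K_def)
  have cg: "continuous_on UNIV g"
    unfolding g_def by (rule smooth_on_continuous[OF smooth_on_grad_nth[OF F'(1)]])
  obtain M where M: "M > 0" "\<And>x. \<bar>g x\<bar> \<le> M"
    by (rule continuous_compact_support_bounded[OF cg F'(2) g0]) auto
  have cF: "continuous_on UNIV F" by (rule smooth_on_continuous[OF F'(1)])
  have [measurable]: "F \<in> borel_measurable borel" "g \<in> borel_measurable borel"
    using cF cg by (auto intro: borel_measurable_continuous_onI)
  have line: "((\<lambda>s. F (x + s *\<^sub>R e)) has_real_derivative g (x + s *\<^sub>R e)) (at s)" for x s
  proof -
    have 1: "((\<lambda>s. x + s *\<^sub>R e) has_derivative (\<lambda>h. h *\<^sub>R e)) (at s)"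
      by (auto intro!: derivative_eq_intros)
    have D: "(F has_derivative frechet_derivative F (at (x + s *\<^sub>R e))) (at (x + s *\<^sub>R e))"
      by (rule smooth_on_has_derivative[OF F'(1)])
    have "frechet_derivative F (at (x + s *\<^sub>R e)) (h *\<^sub>R e) = h * g (x + s *\<^sub>R e)" for h
      using linear_scale[OF has_derivative_linear[OF D], of h e] by (simp add: g_def grad_def e_def)
    then have "(\<lambda>h. frechet_derivative F (at (x + s *\<^sub>R e)) (h *\<^sub>R e)) = (*) (g (x + s *\<^sub>R e))"
      by (auto simp: mult.commute)
    with has_derivative_compose[OF 1 D] show ?thesis
      by (simp add: has_field_derivative_def)
  qed
  define t where "t n = 1 / real (Suc n)" for n
  have t: "t n > 0" "t n \<le> 1" for n by (auto simp: t_def)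
  have t0: "t \<longlonglongrightarrow> 0" unfolding t_def by (rule LIMSEQ_Suc[OF lim_1_over_n])
  define Dn where "Dn n x = (F (x + t n *\<^sub>R e) - F x) / t n" for n x
  \<comment> \<open>The increments are at most 1, so all difference quotients vanish outside the
    unit neighbourhood of the support.\<close>
  define K' where "K' = (\<Union>x\<in>K. \<Union>y\<in>cball 0 1. {x + y})"
  have K': "compact K'" unfolding K'_def by (rule compact_sums'[OF F'(2) compact_cball])
  have KK': "K \<subseteq> K'" unfolding K'_def by force
  have "(\<lambda>n. \<integral>x. Dn n x \<partial>lborel) \<longlonglongrightarrow> (\<integral>x. g x \<partial>lborel)"
  proof (rule integral_dominated_convergence[where w = "\<lambda>x. M * indicator K' x"])
    show "integrable lborel (\<lambda>x. M * indicator K' x)"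
      using emeasure_compact_finite[OF K'] compact_imp_closed[OF K'] by (auto intro!: integrable_real_mult_indicator)
    show "AE x in lborel. (\<lambda>n. Dn n x) \<longlonglongrightarrow> g x"
    proof (intro AE_I2)
      fix x
      have "((\<lambda>h. (F (x + (0 + h) *\<^sub>R e) - F (x + 0 *\<^sub>R e)) / h) \<longlongrightarrow> g (x + 0 *\<^sub>R e)) (at 0)"
        using line[of x 0] unfolding DERIV_def .
      then have "((\<lambda>h. (F (x + h *\<^sub>R e) - F x) / h) \<longlongrightarrow> g x) (at 0)" by simp
      then show "(\<lambda>n. Dn n x) \<longlonglongrightarrow> g x"
        unfolding Dn_def
      proof (rule filterlim_compose)
        show "filterlim t (at 0) sequentially"
          using t0 by (rule filterlim_atI) (use t in \<open>auto simp: less_imp_neq[THEN not_sym]\<close>)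
      qed
    qed
    show "AE x in lborel. norm (Dn n x) \<le> M * indicator K' x" for n
    proof (intro AE_I2)
      fix x
      show "norm (Dn n x) \<le> M * indicator K' x"
      proof (cases "x \<in> K'")
        case True
        obtain z where "0 < z" "z < t n" "F (x + t n *\<^sub>R e) - F (x + 0 *\<^sub>R e) = (t n - 0) * g (x + z *\<^sub>R e)"
          using MVT2[OF t(1)[of n], of "\<lambda>s. F (x + s *\<^sub>R e)" "\<lambda>s. g (x + s *\<^sub>R e)"] line by blast
        then have "Dn n x = g (x + z *\<^sub>R e)" using t(1)[of n] by (simp add: Dn_def)
        then show ?thesis using M(2) True by simp
      next
        case False
        have "x + t n *\<^sub>R e \<notin> K"
        proof
          assume "x + t n *\<^sub>R e \<in> K"
          moreover have "- (t n *\<^sub>R e) \<in> cball 0 1" using t[of n] e by simp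
          ultimately have "(x + t n *\<^sub>R e) + - (t n *\<^sub>R e) \<in> K'" unfolding K'_def by blast
          then show False using False by simp
        qed
        then show ?thesis using False KK' F'(4) by (auto simp: Dn_def)
      qed
    qed
  qed (auto simp: Dn_def)
  moreover have "(\<integral>x. Dn n x \<partial>lborel) = 0" for n
  proof -
    have iF: "integrable lborel F" by (rule integrable_continuous_compact_support[OF cF F'(2,4)])
    have "integrable lborel (\<lambda>x. F (x + t n *\<^sub>R e))"
    proof (rule integrable_continuous_compact_support)
      show "continuous_on UNIV (\<lambda>x. F (x + t n *\<^sub>R e))"
        by (rule continuous_on_compose2[OF cF]) (auto intro!: continuous_intros)
      show "compact ((\<lambda>x. x - t n *\<^sub>R e) ` K)"
        by (intro compact_continuous_image F'(2)) (auto intro!: continuous_intros)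
      show "F (x + t n *\<^sub>R e) = 0" if "x \<notin> (\<lambda>x. x - t n *\<^sub>R e) ` K" for x
      proof (rule F'(4), rule notI)
        assume "x + t n *\<^sub>R e \<in> K"
        then have "(x + t n *\<^sub>R e) - t n *\<^sub>R e \<in> (\<lambda>x. x - t n *\<^sub>R e) ` K" by (rule imageI)
        with that show False by simp
      qed
    qed
    then show ?thesis
      unfolding Dn_def using iF by (simp add: integral_lborel_translate)
  qed
  ultimately have "(\<integral>x. g x \<partial>lborel) = 0" by (simp add: LIMSEQ_const_iff)
  then show ?thesis by (simp add: g_def)
qed

lemma set_lebesgue_integral_compact_support:
  fixes f :: "'a::euclidean_space \<Rightarrow> real"
  assumes "f \<in> borel_measurable borel" "\<And>x. x \<notin> \<Omega> \<Longrightarrow> f x = 0"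
  shows "(LINT x:\<Omega>|lebesgue. f x) = (\<integral>x. f x \<partial>lborel)"
proof -
  have "(LINT x:\<Omega>|lebesgue. f x) = (\<integral>x. f x \<partial>lebesgue)"
    unfolding set_lebesgue_integral_def using assms(2)
    by (intro Bochner_Integration.integral_cong) (auto split: split_indicator)
  also have "\<dots> = (\<integral>x. f x \<partial>lborel)"
    using assms(1) by (intro integral_completion) simp
  finally show ?thesis .
qed

lemma Lp_continuous:
  fixes f :: "'a::euclidean_space \<Rightarrow> 'b::euclidean_space"
  assumes f: "continuous_on UNIV f" and "open S \<or> compact S" and K: "compact K" "\<And>x. x \<in> S - K \<Longrightarrow> f x = 0" and "p > 0"
  shows "Lp p S f"
proof -
  have [measurable]: "S \<in> sets borel" using assms(2) by (auto simp: compact_imp_closed)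
  have [measurable]: "f \<in> borel_measurable borel" using f by (rule borel_measurable_continuous_onI)
  have m: "set_borel_measurable lebesgue S f"
    unfolding set_borel_measurable_def by (intro measurable_completion) simp
  have "integrable lborel (\<lambda>x. indicator K x *\<^sub>R (norm (f x) powr p))"
    using K(1) by (rule borel_integrable_compact)
      (intro continuous_on_powr' continuous_on_norm continuous_on_const continuous_on_subset[OF f],
        use \<open>p > 0\<close> in auto)
  then have "integrable lborel (\<lambda>x. indicator S x *\<^sub>R (norm (f x) powr p))"
  proof (rule Bochner_Integration.integrable_bound)
    show "AE x in lborel. norm (indicator S x *\<^sub>R (norm (f x) powr p)) \<le> norm (indicator K x *\<^sub>R (norm (f x) powr p))"
      using K(2) by (intro AE_I2) (auto split: split_indicator)
  qed simp
  then have "set_integrable lebesgue S (\<lambda>z. norm (f z) powr p)"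
    unfolding set_integrable_def by (subst integrable_completion) auto
  with m show ?thesis by (simp add: Lp_def)
qed

lemma Lp_loc_continuous:
  fixes f :: "'a::euclidean_space \<Rightarrow> 'b::euclidean_space"
  assumes "continuous_on UNIV f" "p > 0"
  shows "Lp_loc p S f"
  unfolding Lp_loc_def
proof (intro allI impI)
  fix K assume "compact K \<and> K \<subseteq> S"
  then show "Lp p K f" using assms by (intro Lp_continuous[of f K K]) auto
qed

text \<open>Integration by parts: the gradient of the product of \<psi> and \<eta> has integral
  zero.\<close>

lemma weak_gradient_test_function:
  assumes \<psi>: "\<psi> \<in> test_functions \<Omega>"
  shows "weak_gradient \<Omega> \<psi> (grad \<psi>)"
  unfolding weak_gradient_def
proof (intro conjI ballI allI)
  note \<psi>' = test_functionsD[OF \<psi>]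
  show "Lp_loc 1 \<Omega> \<psi>" "Lp_loc 1 \<Omega> (grad \<psi>)"
    using smooth_on_continuous[OF \<psi>'(1)] continuous_on_grad[OF \<psi>'(1)] by (auto intro!: Lp_loc_continuous)
  fix \<eta> :: "real^2 \<Rightarrow> real" and i assume \<eta>: "\<eta> \<in> test_functions \<Omega>"
  note \<eta>' = test_functionsD[OF \<eta>]
  have c: "continuous_on UNIV \<psi>" "continuous_on UNIV \<eta>" "continuous_on UNIV (\<lambda>x. grad \<psi> x $ i)" "continuous_on UNIV (\<lambda>x. grad \<eta> x $ i)"
    using smooth_on_continuous smooth_on_grad_nth \<psi>'(1) \<eta>'(1) by blast+
  have [measurable]: "\<psi> \<in> borel_measurable borel" "\<eta> \<in> borel_measurable borel"
    "(\<lambda>x. grad \<psi> x $ i) \<in> borel_measurable borel" "(\<lambda>x. grad \<eta> x $ i) \<in> borel_measurable borel"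
    using c by (auto intro: borel_measurable_continuous_onI)
  have g0: "grad \<eta> x = 0" if "x \<notin> closure {z. \<eta> z \<noteq> 0}" for x
    using that by (rule test_functions_grad_support[OF \<eta>])
  have i1: "integrable lborel (\<lambda>x. \<psi> x * grad \<eta> x $ i)"
    by (rule integrable_continuous_compact_support[OF _ \<eta>'(2)]) (use g0 in \<open>auto intro!: continuous_on_mult c\<close>)
  have i2: "integrable lborel (\<lambda>x. grad \<psi> x $ i * \<eta> x)"
    by (rule integrable_continuous_compact_support[OF continuous_on_mult[OF c(3,2)] \<eta>'(2)]) (drule \<eta>'(4), simp)
  have "(\<lambda>x. \<psi> x * \<eta> x) \<in> test_functions UNIV"
    by (rule test_functionsI[OF smooth_on_mult[OF \<psi>'(1) \<eta>'(1)] \<eta>'(2)]) (simp, drule \<eta>'(4), simp)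
  from integral_grad_eq_0[OF this, of i]
  have "(\<integral>x. \<psi> x * grad \<eta> x $ i + grad \<psi> x $ i * \<eta> x \<partial>lborel) = 0"
    unfolding grad_mult[OF \<psi>'(1) \<eta>'(1)] by (simp add: mult.commute[of "\<eta> _"])
  then have "(\<integral>x. \<psi> x * grad \<eta> x $ i \<partial>lborel) = - (\<integral>x. grad \<psi> x $ i * \<eta> x \<partial>lborel)"
    using i1 i2 by simp
  moreover have "(LINT x:\<Omega>|lebesgue. \<psi> x * grad \<eta> x $ i) = (\<integral>x. \<psi> x * grad \<eta> x $ i \<partial>lborel)"
  proof (rule set_lebesgue_integral_compact_support)
    fix x assume "x \<notin> \<Omega>"
    then have "grad \<eta> x = 0" using \<eta>'(3) by (intro g0) blast
    then show "\<psi> x * grad \<eta> x $ i = 0" by simp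
  qed simp
  moreover have "(LINT x:\<Omega>|lebesgue. grad \<psi> x $ i * \<eta> x) = (\<integral>x. grad \<psi> x $ i * \<eta> x \<partial>lborel)"
  proof (rule set_lebesgue_integral_compact_support)
    fix x assume "x \<notin> \<Omega>"
    then have "\<eta> x = 0" using \<eta>'(3) by (intro \<eta>'(4)) blast
    then show "grad \<psi> x $ i * \<eta> x = 0" by simp
  qed simp
  ultimately show "(LINT x:\<Omega>|lebesgue. \<psi> x * grad \<eta> x $ i) = - (LINT x:\<Omega>|lebesgue. grad \<psi> x $ i * \<eta> x)"
    by simp
qed

text \<open>The constant sequence approximates \<psi>. This opens the divergence condition to
  compactly supported smooth kernels.\<close>

lemma test_function_in_H10:
  assumes \<psi>: "\<psi> \<in> test_functions \<Omega>" and "open \<Omega>"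
  shows "\<psi> \<in> H10 \<Omega>"
proof -
  note \<psi>' = test_functionsD[OF \<psi>]
  have "Lp 2 \<Omega> \<psi>"
    by (rule Lp_continuous[OF smooth_on_continuous[OF \<psi>'(1)] disjI1[OF assms(2)] \<psi>'(2)]) (blast intro: \<psi>'(4), simp)
  moreover have "Lp 2 \<Omega> (grad \<psi>)"
    by (rule Lp_continuous[OF continuous_on_grad[OF \<psi>'(1)] disjI1[OF assms(2)] \<psi>'(2)])
      (blast intro: test_functions_grad_support[OF \<psi>], simp)
  moreover have "\<exists>\<phi>. (\<forall>n::nat. \<phi> n \<in> test_functions \<Omega>) \<and>
       (\<lambda>n. LINT x:\<Omega>|lebesgue. (\<phi> n x - \<psi> x)\<^sup>2 + (norm (grad (\<phi> n) x - grad \<psi> x))\<^sup>2) \<longlonglongrightarrow> 0"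
    using \<psi> by (intro exI[of _ "\<lambda>_. \<psi>"]) (simp add: set_lebesgue_integral_def)
  ultimately show ?thesis
    unfolding H10_def using weak_gradient_test_function[OF \<psi>] by blast
qed

subsection \<open>The regularised Biot-Savart kernel\<close>

text \<open>The components of the gradient of \<open>1/2 log (|z|^2 + \<delta>^2)\<close>, a smooth
  substitute for the singular field \<open>z / |z|^2\<close>.\<close>

definition smooth_kernel :: "real \<Rightarrow> 2 \<Rightarrow> real^2 \<Rightarrow> real" where
  "smooth_kernel \<delta> i z = z $ i / ((norm z)\<^sup>2 + \<delta>\<^sup>2)"

text \<open>The Laplacian of \<open>1/2 log (|z|^2 + \<delta>^2)\<close>, that is, the divergence of
  \<open>smooth_kernel\<close>. It is the rescaling of one integrable profile and concentrates at
  the origin as \<delta> tends to 0.\<close>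

definition poisson :: "real \<Rightarrow> real^2 \<Rightarrow> real" where
  "poisson \<delta> z = 2 * \<delta>\<^sup>2 / ((norm z)\<^sup>2 + \<delta>\<^sup>2)\<^sup>2"

lemma smooth_on_smooth_kernel:
  assumes "\<delta> > 0"
  shows "smooth_on (smooth_kernel \<delta> i) UNIV"
proof -
  have s: "smooth_on (\<lambda>z::real^2. (norm z)\<^sup>2) UNIV" using smooth_on_norm_sq[of 0] by simp
  have "(norm z)\<^sup>2 + \<delta>\<^sup>2 \<noteq> 0" for z :: "real^2"
    using assms by (metis add_nonneg_pos less_irrefl zero_le_power2 zero_less_power)
  then show ?thesis
    unfolding smooth_kernel_def[abs_def] divide_inverse
    by (intro smooth_on_mult smooth_on_inverse smooth_on_add s smooth_on_const
        smooth_on_bounded_linear bounded_linear_vec_nth)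
qed

lemma grad_smooth_kernel:
  assumes "\<delta> > 0"
  shows "grad (smooth_kernel \<delta> i) z $ j = (if i = j then 1 / ((norm z)\<^sup>2 + \<delta>\<^sup>2) else 0)
    - 2 * z $ i * z $ j / ((norm z)\<^sup>2 + \<delta>\<^sup>2)\<^sup>2"
proof -
  have pos: "z \<bullet> z + \<delta>\<^sup>2 > 0" using assms by (simp add: add_nonneg_pos)
  have dz: "((\<lambda>z. z $ i) has_derivative (\<lambda>v. v $ i)) (at z)"
    by (rule bounded_linear_imp_has_derivative[OF bounded_linear_vec_nth])
  have dN: "((\<lambda>z. z \<bullet> z + \<delta>\<^sup>2) has_derivative (\<lambda>v. z \<bullet> v + v \<bullet> z)) (at z)"
    by (auto intro!: derivative_eq_intros)
  have k: "smooth_kernel \<delta> i = (\<lambda>z. z $ i * inverse (z \<bullet> z + \<delta>\<^sup>2))"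
    by (simp add: smooth_kernel_def[abs_def] divide_inverse power2_norm_eq_inner)
  have nz: "z \<bullet> z + \<delta>\<^sup>2 \<noteq> 0" using pos by simp
  have "grad (smooth_kernel \<delta> i) z $ j = z $ i * - (inverse (z \<bullet> z + \<delta>\<^sup>2) * (z \<bullet> axis j 1 + axis j 1 \<bullet> z) * inverse (z \<bullet> z + \<delta>\<^sup>2))
      + axis j 1 $ i * inverse (z \<bullet> z + \<delta>\<^sup>2)"
    unfolding k by (rule grad_nth[OF has_derivative_mult[OF dz Deriv.has_derivative_inverse[OF nz dN]]])
  moreover have "z \<bullet> axis j 1 = z $ j" "axis j 1 \<bullet> z = z $ j"
    by (simp_all add: inner_axis inner_commute)
  moreover have "axis j 1 $ i = (if i = j then 1 else 0 :: real)" by (simp add: axis_def)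
  moreover have "z $ i * - (inverse N * (z $ j + z $ j) * inverse N) + d * inverse N
      = d / N - 2 * z $ i * z $ j / N\<^sup>2" for d N :: real
    by (simp add: divide_inverse power2_eq_square algebra_simps)
  ultimately show ?thesis
    by (simp only: power2_norm_eq_inner) simp
qed

lemma div_smooth_kernel:
  assumes "\<delta> > 0"
  shows "grad (smooth_kernel \<delta> 1) z $ 1 + grad (smooth_kernel \<delta> 2) z $ 2 = poisson \<delta> z"
    and "grad (smooth_kernel \<delta> 1) z $ 2 = grad (smooth_kernel \<delta> 2) z $ 1"
proof -
  define N where "N = (norm z)\<^sup>2 + \<delta>\<^sup>2"
  have N: "N > 0" unfolding N_def using assms by (simp add: add_nonneg_pos)
  have "grad (smooth_kernel \<delta> 1) z $ 1 + grad (smooth_kernel \<delta> 2) z $ 2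
      = 2 / N - 2 * ((z $ 1)\<^sup>2 + (z $ 2)\<^sup>2) / N\<^sup>2"
    unfolding grad_smooth_kernel[OF assms] N_def[symmetric]
    by (simp add: power2_eq_square add_divide_distrib distrib_left)
  also have "(z $ 1)\<^sup>2 + (z $ 2)\<^sup>2 = N - \<delta>\<^sup>2" by (simp add: N_def norm_sq_vec2)
  also have "2 / N - 2 * (N - \<delta>\<^sup>2) / N\<^sup>2 = 2 * \<delta>\<^sup>2 / N\<^sup>2"
    using N by (simp add: field_simps power2_eq_square)
  finally show "grad (smooth_kernel \<delta> 1) z $ 1 + grad (smooth_kernel \<delta> 2) z $ 2 = poisson \<delta> z"
    by (simp add: poisson_def N_def)
  show "grad (smooth_kernel \<delta> 1) z $ 2 = grad (smooth_kernel \<delta> 2) z $ 1"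
    by (simp add: grad_smooth_kernel[OF assms])
qed

text \<open>Uniformity in \<delta> keeps the Riesz potential as a fixed majorant in the limit. At
  the origin both sides are 0.\<close>

lemma smooth_kernel_bound: "\<bar>smooth_kernel \<delta> i z\<bar> \<le> 1 / norm z"
proof (cases "z = 0")
  case False
  then have n: "norm z > 0" by simp
  have "\<bar>z $ i\<bar> / ((norm z)\<^sup>2 + \<delta>\<^sup>2) \<le> norm z / (norm z)\<^sup>2"
    using n component_le_norm_cart[of z i] by (intro frac_le) auto
  also have "\<dots> = 1 / norm z" using n by (simp add: power2_eq_square)
  finally show ?thesis
    by (simp add: smooth_kernel_def abs_div_pos[symmetric] add_nonneg_nonneg abs_of_nonneg)
qed (simp add: smooth_kernel_def)

section \<open>Averages against the concentrating kernels\<close>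

lemma poisson_nonneg: "0 \<le> poisson \<delta> z"
  by (simp add: poisson_def)

lemma poisson_le:
  assumes "\<delta> > 0"
  shows "poisson \<delta> z \<le> 2 / \<delta>\<^sup>2"
proof -
  have "(\<delta>\<^sup>2)\<^sup>2 \<le> ((norm z)\<^sup>2 + \<delta>\<^sup>2)\<^sup>2" by (intro power_mono) auto
  then have "poisson \<delta> z \<le> 2 * \<delta>\<^sup>2 / (\<delta>\<^sup>2)\<^sup>2"
    unfolding poisson_def using assms by (intro divide_left_mono) (auto simp: add_nonneg_pos intro!: mult_pos_pos)
  also have "\<dots> = 2 / \<delta>\<^sup>2" using assms by (simp add: power2_eq_square)
  finally show ?thesis .
qed

lemma poisson_measurable [measurable]: "poisson \<delta> \<in> borel_measurable borel"
proof (cases "\<delta> = 0")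
  case True
  then show ?thesis by (simp add: poisson_def[abs_def])
next
  case False
  then have "continuous_on UNIV (poisson \<delta>)"
    unfolding poisson_def by (auto intro!: continuous_intros simp: add_nonneg_eq_0_iff)
  then show ?thesis by (rule borel_measurable_continuous_onI)
qed

lemma poisson_scale:
  assumes "\<delta> > 0"
  shows "poisson \<delta> (\<delta> *\<^sub>R z) = poisson 1 z / \<delta>\<^sup>2"
proof -
  have "(norm (\<delta> *\<^sub>R z))\<^sup>2 + \<delta>\<^sup>2 = \<delta>\<^sup>2 * ((norm z)\<^sup>2 + 1)"
    using assms by (simp add: power_mult_distrib algebra_simps)
  then have "poisson \<delta> (\<delta> *\<^sub>R z) = 2 * \<delta>\<^sup>2 / (\<delta>\<^sup>2 * ((norm z)\<^sup>2 + 1))\<^sup>2"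
    by (simp add: poisson_def)
  also have "\<dots> = poisson 1 z / \<delta>\<^sup>2"
    using assms by (simp add: poisson_def power_mult_distrib power2_eq_square)
  finally show ?thesis .
qed

text \<open>In dimension two \<open>(1 + |z|^2)^2\<close> dominates the product of
  \<open>1 + z_b^2\<close> over the two coordinates, so the profile lies below a product of
  integrable functions of one variable.\<close>

lemma integrable_poisson: "integrable lborel (poisson 1)"
proof (rule integrableI_bounded)
  have 1: "(\<integral>\<^sup>+x. ennreal (inverse (1 + x\<^sup>2)) \<partial>lborel) < \<infinity>"
    using integrable_inverse_1_plus_square
    by (simp add: set_integrable_def integrable_iff_bounded)
  have pw: "ennreal (poisson 1 z) \<le> 2 * (\<Prod>b\<in>Basis. ennreal (inverse (1 + (z \<bullet> b)\<^sup>2)))" for z :: "real^2"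
  proof -
    define N where "N = (norm z)\<^sup>2 + 1"
    have N: "N > 0" by (simp add: N_def add_nonneg_pos)
    have f: "inverse N \<le> inverse (1 + (z \<bullet> b)\<^sup>2)" if "b \<in> Basis" for b
    proof (rule le_imp_inverse_le)
      have "\<bar>z \<bullet> b\<bar> \<le> norm z" by (rule Basis_le_norm[OF that])
      then have "(z \<bullet> b)\<^sup>2 \<le> (norm z)\<^sup>2" using abs_le_square_iff[of "z \<bullet> b" "norm z"] by simp
      then show "1 + (z \<bullet> b)\<^sup>2 \<le> N" by (simp add: N_def)
    qed (simp add: add_pos_nonneg)
    have "(\<Prod>b\<in>(Basis :: (real^2) set). inverse N) \<le> (\<Prod>b\<in>Basis. inverse (1 + (z \<bullet> b)\<^sup>2))"
      using f N by (intro prod_mono) auto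
    then have "2 * (inverse N)\<^sup>2 \<le> 2 * (\<Prod>b\<in>Basis. inverse (1 + (z \<bullet> b)\<^sup>2))" by simp
    moreover have "poisson 1 z = 2 * (inverse N)\<^sup>2"
      by (simp add: poisson_def N_def power_inverse divide_inverse)
    ultimately have "ennreal (poisson 1 z) \<le> ennreal (2 * (\<Prod>b\<in>Basis. inverse (1 + (z \<bullet> b)\<^sup>2)))"
      by (intro ennreal_leI) simp
    also have "\<dots> = 2 * (\<Prod>b\<in>Basis. ennreal (inverse (1 + (z \<bullet> b)\<^sup>2)))"
      by (subst ennreal_mult) (auto simp: prod_ennreal prod_nonneg)
    finally show ?thesis .
  qed
  have "(\<integral>\<^sup>+z. ennreal (norm (poisson 1 z)) \<partial>lborel) \<le> (\<integral>\<^sup>+z. 2 * (\<Prod>b\<in>Basis. ennreal (inverse (1 + ((z::real^2) \<bullet> b)\<^sup>2))) \<partial>lborel)"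
    using pw by (intro nn_integral_mono) (simp add: poisson_nonneg)
  also have "\<dots> = 2 * (\<Prod>b\<in>(Basis :: (real^2) set). (\<integral>\<^sup>+x. ennreal (inverse (1 + x\<^sup>2)) \<partial>lborel))"
  proof -
    have "(\<integral>\<^sup>+z. (\<Prod>b\<in>Basis. ennreal (inverse (1 + ((z::real^2) \<bullet> b)\<^sup>2))) \<partial>lborel)
      = (\<Prod>b\<in>(Basis :: (real^2) set). (\<integral>\<^sup>+x. ennreal (inverse (1 + x\<^sup>2)) \<partial>lborel))"
      by (rule nn_integral_lborel_prod) simp_all
    then show ?thesis by (subst nn_integral_cmult) simp_all
  qed
  also have "\<dots> < \<infinity>"
    using 1 by (simp add: ennreal_mult_less_top power_less_top_ennreal)
  finally show "(\<integral>\<^sup>+z. ennreal (norm (poisson 1 z)) \<partial>lborel) < \<infinity>" .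
qed simp

text \<open>The number \<open>2 * pi\<close>; its exact value would only change constants.\<close>

definition poisson_mass :: real where "poisson_mass = (\<integral>z. poisson 1 z \<partial>lborel)"

lemma poisson_mass_pos: "0 < poisson_mass"
proof -
  have pos: "0 < poisson 1 z" for z
  proof -
    have "(norm z)\<^sup>2 + 1 > 0" by (simp add: add_nonneg_pos)
    then show ?thesis unfolding poisson_def by (intro divide_pos_pos zero_less_power) auto
  qed
  have "poisson_mass \<noteq> 0"
  proof
    assume "poisson_mass = 0"
    then have "AE z in lborel. poisson 1 z = 0"
      unfolding poisson_mass_def using integral_nonneg_eq_0_iff_AE[OF integrable_poisson] poisson_nonneg by simp
    moreover have "poisson 1 z \<noteq> 0" for z using pos[of z] by simp
    ultimately have "ae_filter (lborel :: (real^2) measure) = bot" by (simp add: eventually_False)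
    then show False by (simp add: ae_filter_eq_bot_iff)
  qed
  moreover have "0 \<le> poisson_mass" unfolding poisson_mass_def by (simp add: poisson_nonneg)
  ultimately show ?thesis by simp
qed

lemma integrable_bounded_mult:
  fixes f g :: "'a \<Rightarrow> real"
  assumes f: "integrable M f" and [measurable]: "g \<in> borel_measurable M" and g: "\<And>x. \<bar>g x\<bar> \<le> C"
  shows "integrable M (\<lambda>x. f x * g x)" "integrable M (\<lambda>x. g x * f x)"
proof -
  have [measurable]: "f \<in> borel_measurable M" using f by simp
  have "\<bar>f x\<bar> * \<bar>g x\<bar> \<le> \<bar>C * f x\<bar>" for x
  proof -
    have "\<bar>f x\<bar> * \<bar>g x\<bar> \<le> \<bar>f x\<bar> * \<bar>C\<bar>" using g[of x] by (intro mult_left_mono) auto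
    then show ?thesis by (simp add: abs_mult mult.commute)
  qed
  then show "integrable M (\<lambda>x. f x * g x)"
    by (intro Bochner_Integration.integrable_bound[OF integrable_mult_right[OF f, of C]]) (auto simp: abs_mult)
  then show "integrable M (\<lambda>x. g x * f x)" by (simp add: mult.commute)
qed

lemma poisson_average:
  assumes [measurable]: "h \<in> borel_measurable borel" and d: "\<delta> > 0"
  shows "(\<integral>y. h y * poisson \<delta> (x - y) \<partial>lborel) = (\<integral>z. h (x - \<delta> *\<^sub>R z) * poisson 1 z \<partial>lborel)"
proof -
  have "(\<integral>y. h y * poisson \<delta> (x - y) \<partial>lborel)
    = (\<integral>y. h y * poisson \<delta> (x - y) \<partial>density (distr lborel borel (\<lambda>z::real^2. x + (-\<delta>) *\<^sub>R z)) (\<lambda>_. ennreal (\<bar>-\<delta>\<bar> ^ DIM(real^2))))"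
    using lborel_affine[of "-\<delta>" x] d by simp
  also have "\<dots> = (\<integral>y. (\<delta>\<^sup>2) * (h y * poisson \<delta> (x - y)) \<partial>distr lborel borel (\<lambda>z::real^2. x + (-\<delta>) *\<^sub>R z))"
    using d by (subst integral_density) auto
  also have "\<dots> = (\<integral>z. (\<delta>\<^sup>2) * (h (x + (-\<delta>) *\<^sub>R z) * poisson \<delta> (x - (x + (-\<delta>) *\<^sub>R z))) \<partial>lborel)"
    by (subst integral_distr) auto
  also have "\<dots> = (\<integral>z. h (x - \<delta> *\<^sub>R z) * poisson 1 z \<partial>lborel)"
    using d by (intro Bochner_Integration.integral_cong) (auto simp: poisson_scale)
  finally show ?thesis .
qed

text \<open>Fubini moves the averaging from the merely integrable \<open>f\<close> onto the
  continuous \<open>h\<close>, where it converges pointwise.\<close>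

lemma approximate_identity:
  fixes f h :: "real^2 \<Rightarrow> real"
  assumes f: "integrable lborel f" and h: "continuous_on UNIV h" "\<And>x. \<bar>h x\<bar> \<le> 1" "integrable lborel h"
  shows "(\<lambda>n. \<integral>y. h y * (\<integral>x. f x * poisson (1 / real (Suc n)) (x - y) \<partial>lborel) \<partial>lborel)
    \<longlonglongrightarrow> poisson_mass * (\<integral>x. h x * f x \<partial>lborel)"
proof -
  have [measurable]: "h \<in> borel_measurable borel" using h(1) by (rule borel_measurable_continuous_onI)
  have [measurable]: "f \<in> borel_measurable borel" using f by auto
  define \<delta> where "\<delta> n = 1 / real (Suc n)" for n
  have \<delta>: "\<delta> n > 0" for n by (simp add: \<delta>_def)
  have \<delta>0: "\<delta> \<longlonglongrightarrow> 0" unfolding \<delta>_def by (rule LIMSEQ_Suc[OF lim_1_over_n])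
  define H where "H n x = (\<integral>z. h (x - \<delta> n *\<^sub>R z) * poisson 1 z \<partial>lborel)" for n x
  have ip: "integrable lborel (\<lambda>z. h (x - \<delta> n *\<^sub>R z) * poisson 1 z)" for n x
    by (rule integrable_bounded_mult(2)[OF integrable_poisson _ h(2)]) measurable
  have Hlim: "(\<lambda>n. H n x) \<longlonglongrightarrow> h x * poisson_mass" for x
  proof -
    have "(\<lambda>n. H n x) \<longlonglongrightarrow> (\<integral>z. h x * poisson 1 z \<partial>lborel)"
      unfolding H_def
    proof (rule integral_dominated_convergence[where w = "poisson 1"])
      show "AE z in lborel. (\<lambda>n. h (x - \<delta> n *\<^sub>R z) * poisson 1 z) \<longlonglongrightarrow> h x * poisson 1 z"
      proof (intro AE_I2 tendsto_mult tendsto_const)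
        fix z
        have "(\<lambda>n. x - \<delta> n *\<^sub>R z) \<longlonglongrightarrow> x - 0 *\<^sub>R z" by (intro tendsto_intros \<delta>0)
        moreover have "isCont h x" using h(1) by (simp add: continuous_on_eq_continuous_at)
        ultimately show "(\<lambda>n. h (x - \<delta> n *\<^sub>R z)) \<longlonglongrightarrow> h x" by (auto intro: isCont_tendsto_compose)
      qed
      show "AE z in lborel. norm (h (x - \<delta> n *\<^sub>R z) * poisson 1 z) \<le> poisson 1 z" for n
        using h(2) by (intro AE_I2) (auto simp: abs_mult poisson_nonneg intro: mult_left_le_one_le)
    qed (use integrable_poisson in auto)
    then show ?thesis by (simp add: poisson_mass_def)
  qed
  have Hb: "\<bar>H n x\<bar> \<le> poisson_mass" for n x
  proof -
    have "\<bar>H n x\<bar> \<le> (\<integral>z. \<bar>h (x - \<delta> n *\<^sub>R z) * poisson 1 z\<bar> \<partial>lborel)"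
      unfolding H_def by (rule integral_abs_bound)
    also have "\<dots> \<le> poisson_mass"
      unfolding poisson_mass_def
      using h(2) ip by (intro integral_mono integrable_poisson integrable_abs) (auto simp: abs_mult poisson_nonneg intro: mult_left_le_one_le)
    finally show ?thesis .
  qed
  have [measurable]: "H n \<in> borel_measurable borel" for n
    unfolding H_def by measurable
  have eq: "(\<integral>y. h y * (\<integral>x. f x * poisson (\<delta> n) (x - y) \<partial>lborel) \<partial>lborel) = (\<integral>x. f x * H n x \<partial>lborel)" for n
  proof -
    \<comment> \<open>For fixed \<delta> the kernel is bounded, so joint integrability follows from
      that of \<open>f\<close> and of \<open>h\<close>.\<close>
    have intg: "integrable (lborel \<Otimes>\<^sub>M lborel) (\<lambda>(x, y). h y * (f x * poisson (\<delta> n) (x - y)))"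
    proof (rule integrableI_bounded)
      show "(\<lambda>(x, y). h y * (f x * poisson (\<delta> n) (x - y))) \<in> borel_measurable (lborel \<Otimes>\<^sub>M lborel)" by measurable
      have "(\<integral>\<^sup>+z. ennreal (norm (case z of (x, y) \<Rightarrow> h y * (f x * poisson (\<delta> n) (x - y)))) \<partial>(lborel \<Otimes>\<^sub>M lborel))
        \<le> (\<integral>\<^sup>+z. ennreal (2 / (\<delta> n)\<^sup>2) * (ennreal \<bar>f (fst z)\<bar> * ennreal \<bar>h (snd z)\<bar>) \<partial>(lborel \<Otimes>\<^sub>M lborel))"
      proof (rule nn_integral_mono)
        fix z :: "(real^2) \<times> (real^2)"
        obtain x y where z: "z = (x, y)" by (cases z)
        have "\<bar>h y\<bar> * (\<bar>f x\<bar> * \<bar>poisson (\<delta> n) (x - y)\<bar>) \<le> \<bar>h y\<bar> * (\<bar>f x\<bar> * (2 / (\<delta> n)\<^sup>2))"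
          using poisson_le[OF \<delta>, of n "x - y"] by (intro mult_left_mono) (auto simp: poisson_nonneg)
        then have "ennreal (norm (h y * (f x * poisson (\<delta> n) (x - y)))) \<le> ennreal ((2 / (\<delta> n)\<^sup>2) * (\<bar>f x\<bar> * \<bar>h y\<bar>))"
          by (intro ennreal_leI) (simp add: abs_mult mult_ac)
        also have "\<dots> = ennreal (2 / (\<delta> n)\<^sup>2) * (ennreal \<bar>f x\<bar> * ennreal \<bar>h y\<bar>)"
          by (subst ennreal_mult) (auto simp: ennreal_mult simp del: times_divide_eq_left)
        finally show "ennreal (norm (case z of (x, y) \<Rightarrow> h y * (f x * poisson (\<delta> n) (x - y))))
          \<le> ennreal (2 / (\<delta> n)\<^sup>2) * (ennreal \<bar>f (fst z)\<bar> * ennreal \<bar>h (snd z)\<bar>)"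
          by (simp add: z)
      qed
      also have "\<dots> = ennreal (2 / (\<delta> n)\<^sup>2) * (\<integral>\<^sup>+z. ennreal \<bar>f (fst z)\<bar> * ennreal \<bar>h (snd z)\<bar> \<partial>(lborel \<Otimes>\<^sub>M lborel))"
        by (rule nn_integral_cmult) measurable
      also have "(\<integral>\<^sup>+z. ennreal \<bar>f (fst z)\<bar> * ennreal \<bar>h (snd z)\<bar> \<partial>(lborel \<Otimes>\<^sub>M lborel))
          = (\<integral>\<^sup>+x. (\<integral>\<^sup>+y. ennreal \<bar>f x\<bar> * ennreal \<bar>h y\<bar> \<partial>lborel) \<partial>lborel)"
        by (subst lborel.nn_integral_fst[symmetric]) auto
      also have "\<dots> = (\<integral>\<^sup>+x. ennreal \<bar>f x\<bar> \<partial>lborel) * (\<integral>\<^sup>+y. ennreal \<bar>h y\<bar> \<partial>lborel)"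
        by (simp add: nn_integral_cmult nn_integral_multc)
      also have "ennreal (2 / (\<delta> n)\<^sup>2) * \<dots> < \<infinity>"
        using f h(3) by (simp add: integrable_iff_bounded ennreal_mult_less_top)
      finally show "(\<integral>\<^sup>+z. ennreal (norm (case z of (x, y) \<Rightarrow> h y * (f x * poisson (\<delta> n) (x - y)))) \<partial>(lborel \<Otimes>\<^sub>M lborel)) < \<infinity>" .
    qed
    have "(\<integral>y. h y * (\<integral>x. f x * poisson (\<delta> n) (x - y) \<partial>lborel) \<partial>lborel)
      = (\<integral>y. (\<integral>x. h y * (f x * poisson (\<delta> n) (x - y)) \<partial>lborel) \<partial>lborel)" by simp
    also have "\<dots> = (\<integral>x. (\<integral>y. h y * (f x * poisson (\<delta> n) (x - y)) \<partial>lborel) \<partial>lborel)"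
      using lborel_pair.Fubini_integral[OF intg] .
    also have "\<dots> = (\<integral>x. f x * (\<integral>y. h y * poisson (\<delta> n) (x - y) \<partial>lborel) \<partial>lborel)"
      by (simp add: mult.left_commute)
    also have "\<dots> = (\<integral>x. f x * H n x \<partial>lborel)"
      by (simp add: poisson_average[OF _ \<delta>] H_def)
    finally show ?thesis .
  qed
  have "(\<lambda>n. \<integral>x. f x * H n x \<partial>lborel) \<longlonglongrightarrow> (\<integral>x. f x * (h x * poisson_mass) \<partial>lborel)"
  proof (rule integral_dominated_convergence[where w = "\<lambda>x. poisson_mass * \<bar>f x\<bar>"])
    show "AE x in lborel. (\<lambda>n. f x * H n x) \<longlonglongrightarrow> f x * (h x * poisson_mass)"
      by (intro AE_I2 tendsto_mult tendsto_const Hlim)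
    show "AE x in lborel. norm (f x * H n x) \<le> poisson_mass * \<bar>f x\<bar>" for n
      using mult_left_mono[OF Hb, of "\<bar>f _\<bar>"] by (intro AE_I2) (simp add: abs_mult mult.commute)
  qed (use f in auto)
  moreover have "(\<integral>x. f x * (h x * poisson_mass) \<partial>lborel) = poisson_mass * (\<integral>x. h x * f x \<partial>lborel)"
    by (simp add: mult_ac flip: integral_mult_right_zero)
  ultimately show ?thesis unfolding \<delta>_def[symmetric] eq by (simp only:)
qed

text \<open>The averages of \<open>f\<close> converge only weakly, so the bound is carried over by
  testing both signs of \<open>f\<close> against continuous functions on \<open>G\<close>.
  Integrability of \<open>I\<close> over \<open>G\<close> makes the tested inequality meaningful in
  the reals.\<close>

lemma AE_bound_of_poisson_averages:
  fixes f :: "real^2 \<Rightarrow> real" and I :: "real^2 \<Rightarrow> ennreal"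
  assumes f: "integrable lborel f" and G: "open G" "bounded G"
    and [measurable]: "I \<in> borel_measurable borel" and I: "(\<integral>\<^sup>+y\<in>G. I y \<partial>lborel) < \<infinity>"
    and b: "\<And>n. AE y in lborel. y \<in> G \<longrightarrow> ennreal \<bar>\<integral>x. f x * poisson (1 / real (Suc n)) (x - y) \<partial>lborel\<bar> \<le> I y"
  shows "AE y in lborel. y \<in> G \<longrightarrow> ennreal (poisson_mass * \<bar>f y\<bar>) \<le> I y"
proof -
  have [measurable]: "f \<in> borel_measurable borel" using f by auto
  have [measurable]: "G \<in> sets borel" using G by simp
  \<comment> \<open>A real-valued copy of \<open>I\<close>, which may be infinite on a null subset
    of \<open>G\<close>.\<close>
  define J where "J y = indicator G y * enn2real (I y)" for y
  have [measurable]: "J \<in> borel_measurable borel" unfolding J_def by measurable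
  have fin: "AE y in lborel. I y * indicator G y \<noteq> \<infinity>"
    using I by (intro nn_integral_noteq_infinite) auto
  have J: "integrable lborel J"
  proof (rule integrableI_bounded)
    have "(\<integral>\<^sup>+y. ennreal (norm (J y)) \<partial>lborel) \<le> (\<integral>\<^sup>+y\<in>G. I y \<partial>lborel)"
    proof (rule nn_integral_mono)
      fix y
      show "ennreal (norm (J y)) \<le> I y * indicator G y"
        by (cases "I y") (auto simp: J_def split: split_indicator)
    qed
    then show "(\<integral>\<^sup>+y. ennreal (norm (J y)) \<partial>lborel) < \<infinity>" using I by (rule le_less_trans)
  qed simp
  define fn where "fn n y = (\<integral>x. f x * poisson (1 / real (Suc n)) (x - y) \<partial>lborel)" for n y
  have [measurable]: "fn n \<in> borel_measurable borel" for n unfolding fn_def by measurable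
  have fnJ: "AE y in lborel. y \<in> G \<longrightarrow> \<bar>fn n y\<bar> \<le> J y" for n
    using b[of n] fin
  proof eventually_elim
    case (elim y)
    then show ?case
      by (cases "I y") (auto simp: J_def fn_def)
  qed
  have main: "AE y in lborel. y \<in> G \<longrightarrow> 0 \<le> J y - s * (poisson_mass * f y)" if s: "s = 1 \<or> s = -1" for s
  proof (rule AE_nonneg_of_continuous_tests[OF _ G(1)])
    show "integrable lborel (\<lambda>y. J y - s * (poisson_mass * f y))"
      using J f by auto
    fix h :: "real^2 \<Rightarrow> real"
    assume h: "continuous_on UNIV h" "\<And>x. 0 \<le> h x" "\<And>x. h x \<le> 1" "\<And>x. x \<notin> G \<Longrightarrow> h x = 0"
    have hb: "\<bar>h x\<bar> \<le> 1" for x using h(2,3)[of x] by simp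
    have [measurable]: "h \<in> borel_measurable borel" using h(1) by (rule borel_measurable_continuous_onI)
    have hi: "integrable lborel h"
    proof (rule Bochner_Integration.integrable_bound)
      show "integrable lborel (indicator G :: real^2 \<Rightarrow> real)"
        using emeasure_bounded_finite[OF G(2)] by simp
      show "AE x in lborel. norm (h x) \<le> norm (indicator G x :: real)"
        using hb h(4) by (intro AE_I2) (auto split: split_indicator)
    qed simp
    have hJ: "integrable lborel (\<lambda>y. h y * J y)" and hf: "integrable lborel (\<lambda>y. h y * f y)"
      using integrable_bounded_mult(2)[OF J _ hb] integrable_bounded_mult(2)[OF f _ hb] by auto
    have le: "s * (\<integral>y. h y * fn n y \<partial>lborel) \<le> (\<integral>y. h y * J y \<partial>lborel)" for n
    proof -
      have "AE y in lborel. \<bar>h y * fn n y\<bar> \<le> h y * J y"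
        using fnJ[of n]
      proof eventually_elim
        case (elim y)
        then show ?case using h(2)[of y] h(4)[of y] by (cases "y \<in> G") (auto simp: abs_mult mult_left_mono)
      qed
      moreover from this have "integrable lborel (\<lambda>y. h y * fn n y)"
        by (intro Bochner_Integration.integrable_bound[OF hJ]) (auto elim!: eventually_mono)
      ultimately have "\<bar>\<integral>y. h y * fn n y \<partial>lborel\<bar> \<le> (\<integral>y. h y * J y \<partial>lborel)"
        by (intro order_trans[OF integral_abs_bound] integral_mono_AE hJ) auto
      then show ?thesis using s by auto
    qed
    have "(\<lambda>n. s * (\<integral>y. h y * fn n y \<partial>lborel)) \<longlonglongrightarrow> s * (poisson_mass * (\<integral>x. h x * f x \<partial>lborel))"
      unfolding fn_def by (intro tendsto_mult tendsto_const approximate_identity[OF f h(1) hb hi])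
    then have "s * (poisson_mass * (\<integral>x. h x * f x \<partial>lborel)) \<le> (\<integral>y. h y * J y \<partial>lborel)"
      by (rule LIMSEQ_le_const2) (use le in blast)
    moreover have "(\<integral>x. h x * (J x - s * (poisson_mass * f x)) \<partial>lborel)
      = (\<integral>y. h y * J y \<partial>lborel) - s * (poisson_mass * (\<integral>x. h x * f x \<partial>lborel))"
    proof -
      have "(\<integral>x. h x * (J x - s * (poisson_mass * f x)) \<partial>lborel) = (\<integral>x. h x * J x - (s * poisson_mass) * (h x * f x) \<partial>lborel)"
        by (intro Bochner_Integration.integral_cong) (auto simp: algebra_simps)
      also have "\<dots> = (\<integral>y. h y * J y \<partial>lborel) - (\<integral>x. (s * poisson_mass) * (h x * f x) \<partial>lborel)"
        using hJ hf by (intro Bochner_Integration.integral_diff) auto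
      finally show ?thesis by simp
    qed
    ultimately show "0 \<le> (\<integral>x. h x * (J x - s * (poisson_mass * f x)) \<partial>lborel)" by simp
  qed
  show ?thesis
    using main[OF disjI1[OF refl]] main[OF disjI2[OF refl]] fin
  proof eventually_elim
    case (elim y)
    show ?case
    proof
      assume y: "y \<in> G"
      have "poisson_mass * \<bar>f y\<bar> \<le> J y"
        using elim y poisson_mass_pos by (auto simp: abs_if)
      then have "ennreal (poisson_mass * \<bar>f y\<bar>) \<le> ennreal (J y)" by (rule ennreal_leI)
      also have "ennreal (J y) = I y" using elim(3) y by (simp add: J_def less_top)
      finally show "ennreal (poisson_mass * \<bar>f y\<bar>) \<le> I y" .
    qed
  qed
qed

section \<open>Recovering the velocity from divergence and vorticity\<close>

lemma grad_translate:
  assumes "smooth_on f UNIV"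
  shows "grad (\<lambda>x. f (x - y)) x = grad f (x - y)"
proof -
  have 1: "((\<lambda>x. x - y) has_derivative (\<lambda>v. v)) (at x)"
    by (auto intro!: derivative_eq_intros)
  show ?thesis
    using grad_eqI[OF has_derivative_compose[OF 1 smooth_on_has_derivative(1)[OF assms, of "x - y"]]]
    by (simp add: grad_def)
qed

lemma smooth_on_translate: "smooth_on f UNIV \<Longrightarrow> smooth_on (\<lambda>x. f (x - y)) UNIV"
  using smooth_on_compose_affine[OF _ bounded_linear_ident, of f "- y"] by simp

definition local_kernel :: "real^2 \<Rightarrow> real \<Rightarrow> real \<Rightarrow> real \<Rightarrow> real^2 \<Rightarrow> 2 \<Rightarrow> real^2 \<Rightarrow> real" where
  "local_kernel c a b \<delta> y i x = bump c a b x * smooth_kernel \<delta> i (x - y)"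

lemma local_kernel_test_function:
  assumes "0 < a" "a < b" "\<delta> > 0" "cball c b \<subseteq> \<Omega>"
  shows "local_kernel c a b \<delta> y i \<in> test_functions \<Omega>"
proof (rule test_functionsI)
  show "smooth_on (local_kernel c a b \<delta> y i) UNIV"
    unfolding local_kernel_def[abs_def]
    by (intro smooth_on_mult smooth_on_bump smooth_on_translate smooth_on_smooth_kernel assms)
  show "local_kernel c a b \<delta> y i x = 0" if "x \<notin> cball c b" for x
    using that bump_eq_0[OF assms(1,2), of x c] by (simp add: local_kernel_def dist_norm norm_minus_commute)
qed (use assms in auto)

lemma norm_vec2_le: "norm (v::real^2) \<le> \<bar>v $ 1\<bar> + \<bar>v $ 2\<bar>"
  using norm_le_l1_cart[of v] by (simp add: sum_2)

lemma inner_vec2: "(v::real^2) \<bullet> w = v $ 1 * w $ 1 + v $ 2 * w $ 2"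
  by (simp add: inner_vec_def sum_2)

text \<open>For a field \<open>e\<close> with \<open>\<partial>_2 e_1 = \<partial>_1 e_2\<close> one
  has \<open>u_1 div e = u \<bullet> grad e_1 + (u_1 \<partial>_2 e_2 - u_2 \<partial>_1
  e_2)\<close>, and similarly for \<open>u_2\<close>. With the localised kernel as test function the
  first term integrates to zero and the second to a vorticity pairing. Derivatives of the cut-off
  live at distance at least \<open>a\<close> from \<open>c\<close>, hence at least
  \<open>a - \<rho>\<close> from \<open>y\<close>, where the kernel is bounded.\<close>

lemma localized_div_curl:
  fixes u :: "real^2 \<Rightarrow> real^2" and w :: "real^2 \<Rightarrow> real"
  assumes u: "integrable lborel u" and w: "integrable lborel w"
    and r: "0 < \<rho>" "\<rho> < a" "a < b" "norm (y - c) \<le> \<rho>" "\<delta> > 0"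
    and div: "\<And>i. (\<integral>x. u x \<bullet> grad (local_kernel c a b \<delta> y i) x \<partial>lborel) = 0"
    and curl: "\<And>i. (\<integral>x. w x * local_kernel c a b \<delta> y i x \<partial>lborel)
        = (\<integral>x. u x $ 1 * grad (local_kernel c a b \<delta> y i) x $ 2 - u x $ 2 * grad (local_kernel c a b \<delta> y i) x $ 1 \<partial>lborel)"
    and M: "\<And>x. norm (grad (bump c a b) x) \<le> M" "\<And>x. norm (x - c) < a \<Longrightarrow> grad (bump c a b) x = 0"
  shows "ennreal \<bar>\<integral>x. (bump c a b x * u x $ j) * poisson \<delta> (x - y) \<partial>lborel\<bar>
    \<le> (\<integral>\<^sup>+x\<in>ball c b. ennreal (\<bar>w x\<bar> / norm (x - y)) \<partial>lborel) + ennreal (4 * M / (a - \<rho>) * (\<integral>x. norm (u x) \<partial>lborel))"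
proof -
  have a0: "0 < a" using r by simp
  define \<psi> where "\<psi> = local_kernel c a b \<delta> y"
  define \<eta> where "\<eta> = bump c a b"
  define e where "e i x = smooth_kernel \<delta> i (x - y)" for i x
  have [measurable]: "u \<in> borel_measurable borel" "w \<in> borel_measurable borel" using u w by auto
  have M0: "0 \<le> M" using M(1)[of c] norm_ge_zero order_trans by blast
  have sm: "smooth_on \<eta> UNIV" "smooth_on (e i) UNIV" for i
    unfolding \<eta>_def e_def[abs_def]
    by (intro smooth_on_bump smooth_on_translate smooth_on_smooth_kernel r)+
  have \<psi>: "\<psi> i = (\<lambda>x. \<eta> x * e i x)" for i
    by (simp add: \<psi>_def local_kernel_def[abs_def] \<eta>_def e_def)
  have g\<psi>: "grad (\<psi> i) x = \<eta> x *\<^sub>R grad (smooth_kernel \<delta> i) (x - y) + e i x *\<^sub>R grad \<eta> x" for i x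
    unfolding \<psi> grad_mult[OF sm] unfolding e_def[abs_def] by (simp add: grad_translate[OF smooth_on_smooth_kernel[OF r(5)]])
  have test: "\<psi> i \<in> test_functions UNIV" for i
    unfolding \<psi>_def by (rule local_kernel_test_function[OF a0 r(3,5)]) simp
  note test' = test_functionsD[OF test]
  have gb: "\<exists>C. \<forall>x. \<bar>grad (\<psi> i) x $ k\<bar> \<le> C" for i k
  proof -
    have "grad (\<psi> i) x $ k = 0" if "x \<notin> closure {z. \<psi> i z \<noteq> 0}" for x
      using test_functions_grad_support[OF test that] by simp
    then obtain C where "\<And>x. \<bar>grad (\<psi> i) x $ k\<bar> \<le> C"
      using continuous_compact_support_bounded[OF smooth_on_continuous[OF smooth_on_grad_nth[OF test'(1)]] test'(2)] by metis
    then show ?thesis by blast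
  qed
  have [measurable]: "(\<lambda>x. grad (\<psi> i) x $ k) \<in> borel_measurable borel" "\<psi> i \<in> borel_measurable borel" "\<eta> \<in> borel_measurable borel" for i k
    using smooth_on_continuous[OF smooth_on_grad_nth[OF test'(1)]] smooth_on_continuous[OF test'(1)] smooth_on_continuous[OF sm(1)]
    by (auto intro: borel_measurable_continuous_onI)
  have uk: "integrable lborel (\<lambda>x. u x $ k)" for k
    using integrable_bounded_linear[OF bounded_linear_vec_nth u] .
  have ug: "integrable lborel (\<lambda>x. u x $ k * grad (\<psi> i) x $ l)" for i k l
  proof -
    obtain C where "\<forall>x. \<bar>grad (\<psi> i) x $ l\<bar> \<le> C" using gb by blast
    then show ?thesis by (intro integrable_bounded_mult(1)[OF uk, where C = C]) auto
  qed
  have wi: "integrable lborel (\<lambda>x. w x * \<psi> i x)" for i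
  proof -
    obtain C where "\<And>x. \<bar>\<psi> i x\<bar> \<le> C"
      using continuous_compact_support_bounded[OF smooth_on_continuous[OF test'(1)] test'(2) test'(4)] by metis
    then show ?thesis by (intro integrable_bounded_mult(1)[OF w, where C = C]) auto
  qed
  \<comment> \<open>\<open>R1\<close> and \<open>R2\<close> collect the terms in which a derivative
    falls on the cut-off.\<close>
  define R1 where "R1 x = (u x \<bullet> grad \<eta> x) * e 1 x + (u x $ 1 * grad \<eta> x $ 2 - u x $ 2 * grad \<eta> x $ 1) * e 2 x" for x
  define R2 where "R2 x = (u x \<bullet> grad \<eta> x) * e 2 x - (u x $ 1 * grad \<eta> x $ 2 - u x $ 2 * grad \<eta> x $ 1) * e 1 x" for x
  have dk: "poisson \<delta> (x - y) = grad (smooth_kernel \<delta> 1) (x - y) $ 1 + grad (smooth_kernel \<delta> 2) (x - y) $ 2"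
    "grad (smooth_kernel \<delta> 1) (x - y) $ 2 = grad (smooth_kernel \<delta> 2) (x - y) $ 1" for x
    using div_smooth_kernel[OF r(5)] by auto
  have id1: "(\<eta> x * u x $ 1) * poisson \<delta> (x - y) = u x \<bullet> grad (\<psi> 1) x
      + (u x $ 1 * grad (\<psi> 2) x $ 2 - u x $ 2 * grad (\<psi> 2) x $ 1) - R1 x" for x
    unfolding dk(1) R1_def g\<psi> inner_vec2 using dk(2)[of x] by (simp add: algebra_simps)
  have id2: "(\<eta> x * u x $ 2) * poisson \<delta> (x - y) = u x \<bullet> grad (\<psi> 2) x
      - (u x $ 1 * grad (\<psi> 1) x $ 2 - u x $ 2 * grad (\<psi> 1) x $ 1) - R2 x" for x
    unfolding dk(1) R2_def g\<psi> inner_vec2 using dk(2)[of x] by (simp add: algebra_simps)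
  have \<eta>1: "\<bar>\<eta> x\<bar> \<le> 1" for x using bump_nonneg bump_le_1 by (simp add: \<eta>_def)
  have pint: "integrable lborel (\<lambda>x. (\<eta> x * u x $ k) * poisson \<delta> (x - y))" for k
    using poisson_le[OF r(5)] poisson_nonneg
    by (intro integrable_bounded_mult(1)[where C = "2 / \<delta>\<^sup>2"] integrable_bounded_mult(2)[OF uk _ \<eta>1]) auto
  have i\<psi>: "integrable lborel (\<lambda>x. u x \<bullet> grad (\<psi> i) x)"
    "integrable lborel (\<lambda>x. u x $ 1 * grad (\<psi> i) x $ 2 - u x $ 2 * grad (\<psi> i) x $ 1)" for i
    unfolding inner_vec2 using ug by auto
  have iR1: "integrable lborel R1"
  proof -
    have "R1 = (\<lambda>x. u x \<bullet> grad (\<psi> 1) x + (u x $ 1 * grad (\<psi> 2) x $ 2 - u x $ 2 * grad (\<psi> 2) x $ 1)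
        - (\<eta> x * u x $ 1) * poisson \<delta> (x - y))"
      using id1 by (auto simp: fun_eq_iff)
    then show ?thesis using i\<psi> pint[of 1] by simp
  qed
  have iR2: "integrable lborel R2"
  proof -
    have "R2 = (\<lambda>x. u x \<bullet> grad (\<psi> 2) x - (u x $ 1 * grad (\<psi> 1) x $ 2 - u x $ 2 * grad (\<psi> 1) x $ 1)
        - (\<eta> x * u x $ 2) * poisson \<delta> (x - y))"
      using id2 by (auto simp: fun_eq_iff)
    then show ?thesis using i\<psi> pint[of 2] by simp
  qed
  have Rb: "\<bar>R1 x\<bar> \<le> 4 * M / (a - \<rho>) * norm (u x) \<and> \<bar>R2 x\<bar> \<le> 4 * M / (a - \<rho>) * norm (u x)" for x
  proof (cases "norm (x - c) < a")
    case True
    then have "grad \<eta> x = 0" using M(2) by (simp add: \<eta>_def)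
    then show ?thesis using M0 r by (simp add: R1_def R2_def)
  next
    case False
    have "a - \<rho> \<le> norm (x - y)"
      using False r(4) norm_triangle_ineq[of "x - y" "y - c"] by simp
    then have e: "\<bar>e i x\<bar> \<le> 1 / (a - \<rho>)" for i
      using smooth_kernel_bound[of \<delta> i "x - y"] r frac_le[of 1 1 "a - \<rho>" "norm (x - y)"] by (simp add: e_def)
    define nu where "nu = norm (u x)"
    have c: "\<bar>u x $ k\<bar> \<le> nu" "\<bar>grad \<eta> x $ k\<bar> \<le> M" for k
      using component_le_norm_cart[of "u x" k] component_le_norm_cart[of "grad \<eta> x" k] M(1)[of x]
      by (auto simp: \<eta>_def nu_def intro: order_trans)
    have p: "\<bar>u x $ k * grad \<eta> x $ l\<bar> \<le> nu * M" for k l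
      unfolding abs_mult by (intro mult_mono c) (auto simp: nu_def)
    have q1: "\<bar>u x \<bullet> grad \<eta> x\<bar> \<le> 2 * (nu * M)"
      unfolding inner_vec2 using p[of 1 1] p[of 2 2] by linarith
    have q2: "\<bar>u x $ 1 * grad \<eta> x $ 2 - u x $ 2 * grad \<eta> x $ 1\<bar> \<le> 2 * (nu * M)"
      using p[of 1 2] p[of 2 1] by linarith
    have m: "\<bar>(u x \<bullet> grad \<eta> x) * e i x\<bar> \<le> 2 * (nu * M) * (1 / (a - \<rho>))"
      "\<bar>(u x $ 1 * grad \<eta> x $ 2 - u x $ 2 * grad \<eta> x $ 1) * e i x\<bar> \<le> 2 * (nu * M) * (1 / (a - \<rho>))" for i
      unfolding abs_mult using M0 by (intro mult_mono q1 q2 e; simp add: nu_def)+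
    have "4 * M / (a - \<rho>) * norm (u x) = 2 * (nu * M) * (1 / (a - \<rho>)) + 2 * (nu * M) * (1 / (a - \<rho>))"
      by (simp add: nu_def)
    then show ?thesis
      unfolding R1_def R2_def using m(1)[of 1] m(1)[of 2] m(2)[of 1] m(2)[of 2] by linarith
  qed
  have un: "integrable lborel (\<lambda>x. norm (u x))" using u by simp
  have intR: "\<bar>\<integral>x. R x \<partial>lborel\<bar> \<le> 4 * M / (a - \<rho>) * (\<integral>x. norm (u x) \<partial>lborel)"
    if "integrable lborel R" "\<And>x. \<bar>R x\<bar> \<le> 4 * M / (a - \<rho>) * norm (u x)" for R
  proof -
    have "\<bar>\<integral>x. R x \<partial>lborel\<bar> \<le> (\<integral>x. \<bar>R x\<bar> \<partial>lborel)" by (rule integral_abs_bound)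
    also have "\<dots> \<le> (\<integral>x. 4 * M / (a - \<rho>) * norm (u x) \<partial>lborel)"
      by (intro integral_mono integrable_abs that integrable_mult_right un)
    finally show ?thesis by (simp only: integral_mult_right_zero)
  qed
  have wb: "ennreal \<bar>\<integral>x. w x * \<psi> i x \<partial>lborel\<bar> \<le> (\<integral>\<^sup>+x\<in>ball c b. ennreal (\<bar>w x\<bar> / norm (x - y)) \<partial>lborel)" for i
  proof -
    have "ennreal \<bar>\<integral>x. w x * \<psi> i x \<partial>lborel\<bar> \<le> ennreal (\<integral>x. \<bar>w x * \<psi> i x\<bar> \<partial>lborel)"
      by (intro ennreal_leI integral_abs_bound)
    also have "\<dots> = (\<integral>\<^sup>+x. ennreal \<bar>w x * \<psi> i x\<bar> \<partial>lborel)"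
      using wi by (intro nn_integral_eq_integral[symmetric]) auto
    also have "\<dots> \<le> (\<integral>\<^sup>+x\<in>ball c b. ennreal (\<bar>w x\<bar> / norm (x - y)) \<partial>lborel)"
    proof (rule nn_integral_mono)
      fix x
      show "ennreal \<bar>w x * \<psi> i x\<bar> \<le> ennreal (\<bar>w x\<bar> / norm (x - y)) * indicator (ball c b) x"
      proof (cases "x \<in> ball c b")
        case True
        have "\<bar>\<eta> x\<bar> * \<bar>e i x\<bar> \<le> 1 * (1 / norm (x - y))"
          by (intro mult_mono \<eta>1) (auto simp: e_def smooth_kernel_bound)
        then have "\<bar>w x * \<psi> i x\<bar> \<le> \<bar>w x\<bar> * (1 / norm (x - y))"
          unfolding \<psi> abs_mult by (intro mult_left_mono) auto
        then show ?thesis using True by (simp add: ennreal_leI)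
      next
        case False
        then have "\<psi> i x = 0"
          using bump_eq_0[OF a0 r(3), of x c] by (simp add: \<psi> \<eta>_def dist_norm norm_minus_commute not_less)
        then show ?thesis by simp
      qed
    qed
    finally show ?thesis .
  qed
  have fin: "ennreal \<bar>X - Y\<bar> \<le> A + ennreal B" if "ennreal \<bar>X\<bar> \<le> A" "\<bar>Y\<bar> \<le> B" for X Y B :: real and A
  proof -
    have "ennreal \<bar>X - Y\<bar> \<le> ennreal (\<bar>X\<bar> + \<bar>Y\<bar>)" by (intro ennreal_leI) linarith
    also have "\<dots> = ennreal \<bar>X\<bar> + ennreal \<bar>Y\<bar>" by simp
    also have "\<dots> \<le> A + ennreal B" using that by (intro add_mono ennreal_leI)
    finally show ?thesis .
  qed
  have j1: "(\<integral>x. (\<eta> x * u x $ 1) * poisson \<delta> (x - y) \<partial>lborel) = (\<integral>x. w x * \<psi> 2 x \<partial>lborel) - (\<integral>x. R1 x \<partial>lborel)"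
    unfolding id1 using i\<psi> iR1 div curl by (simp add: \<psi>_def)
  have j2: "(\<integral>x. (\<eta> x * u x $ 2) * poisson \<delta> (x - y) \<partial>lborel) = (- (\<integral>x. w x * \<psi> 1 x \<partial>lborel)) - (\<integral>x. R2 x \<partial>lborel)"
    unfolding id2 using i\<psi> iR2 div curl by (simp add: \<psi>_def)
  have "ennreal \<bar>\<integral>x. (\<eta> x * u x $ j) * poisson \<delta> (x - y) \<partial>lborel\<bar>
    \<le> (\<integral>\<^sup>+x\<in>ball c b. ennreal (\<bar>w x\<bar> / norm (x - y)) \<partial>lborel) + ennreal (4 * M / (a - \<rho>) * (\<integral>x. norm (u x) \<partial>lborel))"
    using exhaust_2[of j]
  proof
    assume j: "j = 1"
    show ?thesis unfolding j j1 by (rule fin[OF wb intR[OF iR1 Rb[THEN conjunct1]]])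
  next
    assume j: "j = 2"
    show ?thesis unfolding j j2 by (rule fin[OF _ intR[OF iR2 Rb[THEN conjunct2]]]) (simp add: wb)
  qed
  then show ?thesis by (simp add: \<eta>_def)
qed

text \<open>The null set of times in \<open>div\<close> and \<open>curl\<close> depends on the test
  function, hence on \<open>y\<close>. The bound on averages is therefore proved for fixed
  \<open>y\<close>, all \<open>n\<close> and almost every \<open>t\<close>, then Fubini exchanges
  the quantifiers, and the limit in \<open>n\<close> is taken at a fixed time.\<close>

lemma Biot_Savart_bound:
  fixes U :: "(real^2) \<times> real \<Rightarrow> real^2" and W :: "(real^2) \<times> real \<Rightarrow> real"
  assumes U: "U \<in> borel_measurable borel" and W: "W \<in> borel_measurable borel" and [measurable]: "J \<in> sets borel"
    and slices: "AE t in lborel. t \<in> J \<longrightarrow> integrable lborel (\<lambda>x. U (x, t)) \<and> integrable lborel (\<lambda>x. W (x, t))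
      \<and> (\<integral>x. norm (U (x, t)) \<partial>lborel) \<le> A0"
    and r: "0 < \<rho>" "\<rho> < a" "a < b" "cball c b \<subseteq> \<Omega>"
    and div: "\<And>\<psi>. \<psi> \<in> test_functions \<Omega> \<Longrightarrow> AE t in lborel. t \<in> J \<longrightarrow> (\<integral>x. U (x, t) \<bullet> grad \<psi> x \<partial>lborel) = 0"
    and curl: "\<And>\<psi>. \<psi> \<in> test_functions \<Omega> \<Longrightarrow> AE t in lborel. t \<in> J \<longrightarrow> (\<integral>x. W (x, t) * \<psi> x \<partial>lborel)
        = (\<integral>x. U (x, t) $ 1 * grad \<psi> x $ 2 - U (x, t) $ 2 * grad \<psi> x $ 1 \<partial>lborel)"
  shows "\<exists>A\<ge>0. \<exists>C\<ge>0. AE t in lborel. t \<in> J \<longrightarrow> (AE y in lborel. y \<in> ball c \<rho> \<longrightarrow>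
      ennreal (norm (U (y, t))) \<le> ennreal A + ennreal C * (\<integral>\<^sup>+x\<in>ball c b. ennreal (\<bar>W (x, t)\<bar> / norm (x - y)) \<partial>lborel))"
proof -
  have a0: "0 < a" and b0: "0 < b" using r by auto
  have [measurable]: "(\<lambda>z. U z $ k) \<in> borel_measurable (borel \<Otimes>\<^sub>M borel)" "W \<in> borel_measurable (borel \<Otimes>\<^sub>M borel)" for k
    using measurable_compose[OF U borel_measurable_continuous_onI[OF linear_continuous_on[OF bounded_linear_vec_nth]]] W
    by (auto simp: borel_prod)
  obtain M where M: "M > 0"
    "\<And>c a b x. 0 < a \<Longrightarrow> a < b \<Longrightarrow> norm (grad (bump c a b) x) \<le> M / (b - a)"
    "\<And>c a b x. 0 < a \<Longrightarrow> a < b \<Longrightarrow> norm (x - c) < a \<or> b \<le> norm (x - c) \<Longrightarrow> grad (bump c a b) x = 0"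
    using bump_grad by metis
  define K where "K = max 0 (4 * (M / (b - a)) / (a - \<rho>) * A0)"
  have [measurable]: "bump c a b \<in> borel_measurable borel"
    by (rule borel_measurable_continuous_onI[OF smooth_on_continuous[OF smooth_on_bump]])
  define F where "F n k p = ennreal \<bar>\<integral>x. (bump c a b x * U (x, snd p) $ k) * poisson (1 / real (Suc n)) (x - fst p) \<partial>lborel\<bar>"
    for n k and p :: "(real^2) \<times> real"
  define G where "G p = (\<integral>\<^sup>+x\<in>ball c b. ennreal (\<bar>W (x, snd p)\<bar> / norm (x - fst p)) \<partial>lborel) + ennreal K" for p
  have [measurable]: "F n k \<in> borel_measurable (lborel \<Otimes>\<^sub>M lborel)" for n k
    unfolding F_def by measurable
  have [measurable]: "G \<in> borel_measurable (lborel \<Otimes>\<^sub>M lborel)"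
    unfolding G_def by measurable
  \<comment> \<open>Only countably many conditions, each a comparison of jointly measurable
    functions, so the set of pairs is measurable.\<close>
  define P where "P y t \<longleftrightarrow> (\<forall>n k. t \<in> J \<longrightarrow> y \<in> ball c \<rho> \<longrightarrow> F n k (y, t) \<le> G (y, t))" for y t
  have "AE t in lborel. P y t" for y
  proof (cases "y \<in> ball c \<rho>")
    case False
    then show ?thesis by (simp add: P_def)
  next
    case True
    define \<psi> where "\<psi> n i = local_kernel c a b (1 / real (Suc n)) y i" for n i
    have \<psi>: "\<psi> n i \<in> test_functions \<Omega>" for n i
      unfolding \<psi>_def using r a0 by (intro local_kernel_test_function) auto
    have D: "AE t in lborel. \<forall>n i. t \<in> J \<longrightarrow> (\<integral>x. U (x, t) \<bullet> grad (\<psi> n i) x \<partial>lborel) = 0"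
      unfolding AE_all_countable using div[OF \<psi>] by blast
    have Cu: "AE t in lborel. \<forall>n i. t \<in> J \<longrightarrow> (\<integral>x. W (x, t) * \<psi> n i x \<partial>lborel)
        = (\<integral>x. U (x, t) $ 1 * grad (\<psi> n i) x $ 2 - U (x, t) $ 2 * grad (\<psi> n i) x $ 1 \<partial>lborel)"
      unfolding AE_all_countable using curl[OF \<psi>] by blast
    show ?thesis
      using slices D Cu
    proof eventually_elim
      case (elim t)
      show ?case
        unfolding P_def
      proof (intro allI impI)
        fix n k assume t: "t \<in> J"
        have "F n k (y, t) \<le> (\<integral>\<^sup>+x\<in>ball c b. ennreal (\<bar>W (x, t)\<bar> / norm (x - y)) \<partial>lborel)
            + ennreal (4 * (M / (b - a)) / (a - \<rho>) * (\<integral>x. norm (U (x, t)) \<partial>lborel))"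
          unfolding F_def fst_conv snd_conv
        proof (rule localized_div_curl)
          show "norm (y - c) \<le> \<rho>" using True by (simp add: dist_norm norm_minus_commute)
          show "norm (grad (bump c a b) x) \<le> M / (b - a)" for x by (rule M(2)[OF a0 r(3)])
          show "norm (x - c) < a \<Longrightarrow> grad (bump c a b) x = 0" for x by (rule M(3)[OF a0 r(3)]) simp
        qed (use elim t r in \<open>auto simp: \<psi>_def\<close>)
        also have "\<dots> \<le> G (y, t)"
        proof -
          have "4 * (M / (b - a)) / (a - \<rho>) * (\<integral>x. norm (U (x, t)) \<partial>lborel) \<le> 4 * (M / (b - a)) / (a - \<rho>) * A0"
            using elim t M(1) r by (intro mult_left_mono) auto
          also have "\<dots> \<le> K" by (simp add: K_def)
          finally show ?thesis unfolding G_def fst_conv snd_conv by (intro add_left_mono ennreal_leI)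
        qed
        finally show "F n k (y, t) \<le> G (y, t)" .
      qed
    qed
  qed
  then have "AE y in lborel. AE t in lborel. P y t" by simp
  \<comment> \<open>The exchange of the exceptional sets, by Fubini for the measurable set of pairs
    satisfying \<open>P\<close>.\<close>
  then have "AE t in lborel. AE y in lborel. P y t"
  proof (subst (asm) lborel_pair.AE_commute)
    have "Measurable.pred (lborel \<Otimes>\<^sub>M lborel) (\<lambda>p. P (fst p) (snd p))"
      unfolding P_def prod.collapse by measurable
    then show "{x \<in> space (lborel \<Otimes>\<^sub>M lborel). P (fst x) (snd x)} \<in> sets (lborel \<Otimes>\<^sub>M lborel)"
      by (simp add: pred_def)
  qed
  then have main: "AE t in lborel. t \<in> J \<longrightarrow> (AE y in lborel. y \<in> ball c \<rho> \<longrightarrow>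
      ennreal (norm (U (y, t))) \<le> ennreal (2 / poisson_mass) * G (y, t))"
    using slices
  proof eventually_elim
    case (elim t)
    show ?case
    proof
      assume t: "t \<in> J"
      have iU: "integrable lborel (\<lambda>x. U (x, t))" and iW: "integrable lborel (\<lambda>x. W (x, t))"
        using elim t by auto
      have Ws [measurable]: "(\<lambda>x. W (x, t)) \<in> borel_measurable borel" using iW by auto
      have [measurable]: "(\<lambda>y. G (y, t)) \<in> borel_measurable borel" unfolding G_def by simp
      define R where "R = 2 * b"
      have R: "R > 0" using b0 by (simp add: R_def)
      obtain Kk where Kk: "Kk > 0" "\<And>\<sigma>. 0 < \<sigma> \<Longrightarrow> \<sigma> < 2 \<Longrightarrow>
          (\<integral>\<^sup>+z. ennreal (riesz_kernel R z powr \<sigma>) \<partial>lborel) \<le> ennreal (Kk / (2 - \<sigma>))"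
        using riesz_kernel_powr_integral[OF R] by metis
      have rk: "(\<integral>\<^sup>+z. ennreal (riesz_kernel R z) \<partial>lborel) \<le> ennreal Kk"
        using Kk(2)[of 1] by (simp add: riesz_kernel_nonneg)
      \<comment> \<open>The majorant is integrable over the ball, being a convolution of an
        integrable slice with the integrable truncated kernel plus a constant.\<close>
      have Gfin: "(\<integral>\<^sup>+y\<in>ball c \<rho>. G (y, t) \<partial>lborel) < \<infinity>"
      proof -
        have "(\<integral>\<^sup>+y\<in>ball c \<rho>. G (y, t) \<partial>lborel)
          \<le> (\<integral>\<^sup>+y. (\<integral>\<^sup>+x. ennreal \<bar>W (x, t)\<bar> * ennreal (riesz_kernel R (x - y)) \<partial>lborel) + ennreal K * indicator (ball c \<rho>) y \<partial>lborel)"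
        proof (rule nn_integral_mono)
          fix y
          show "G (y, t) * indicator (ball c \<rho>) y
            \<le> (\<integral>\<^sup>+x. ennreal \<bar>W (x, t)\<bar> * ennreal (riesz_kernel R (x - y)) \<partial>lborel) + ennreal K * indicator (ball c \<rho>) y"
          proof (cases "y \<in> ball c \<rho>")
            case True
            have "(\<integral>\<^sup>+x\<in>ball c b. ennreal (\<bar>W (x, t)\<bar> / norm (x - y)) \<partial>lborel)
              \<le> (\<integral>\<^sup>+x. ennreal \<bar>W (x, t)\<bar> * ennreal (riesz_kernel R (x - y)) \<partial>lborel)"
            proof (rule nn_integral_mono)
              fix x
              show "ennreal (\<bar>W (x, t)\<bar> / norm (x - y)) * indicator (ball c b) x
                \<le> ennreal \<bar>W (x, t)\<bar> * ennreal (riesz_kernel R (x - y))"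
              proof (cases "x \<in> ball c b")
                case x: True
                have "norm (x - y) < R"
                  using x True r norm_triangle_ineq4[of "x - c" "y - c"] by (simp add: R_def dist_norm norm_minus_commute)
                then show ?thesis
                  using x by (simp add: riesz_kernel_def ennreal_mult[symmetric])
              qed simp
            qed
            then show ?thesis using True by (auto simp: G_def intro: add_right_mono)
          qed simp
        qed
        also have "\<dots> = (\<integral>\<^sup>+y. (\<integral>\<^sup>+x. ennreal \<bar>W (x, t)\<bar> * ennreal (riesz_kernel R (x - y)) \<partial>lborel) \<partial>lborel)
            + ennreal K * emeasure lborel (ball c \<rho>)"
          by (subst nn_integral_add) (auto simp: nn_integral_cmult_indicator)
        also have "(\<integral>\<^sup>+y. (\<integral>\<^sup>+x. ennreal \<bar>W (x, t)\<bar> * ennreal (riesz_kernel R (x - y)) \<partial>lborel) \<partial>lborel)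
          = (\<integral>\<^sup>+x. (\<integral>\<^sup>+y. ennreal \<bar>W (x, t)\<bar> * ennreal (riesz_kernel R (x - y)) \<partial>lborel) \<partial>lborel)"
          by (rule lborel_pair.Fubini') simp
        also have "\<dots> = (\<integral>\<^sup>+x. ennreal \<bar>W (x, t)\<bar> \<partial>lborel) * (\<integral>\<^sup>+z. ennreal (riesz_kernel R z) \<partial>lborel)"
          using nn_integral_lborel_reflect_translate(2)[of "\<lambda>z. ennreal (riesz_kernel R z)"]
          by (simp add: nn_integral_cmult nn_integral_multc)
        also have "\<dots> + ennreal K * emeasure lborel (ball c \<rho>) < \<infinity>"
          using iW rk emeasure_bounded_finite[OF bounded_ball, of c \<rho>]
          by (auto simp: integrable_iff_bounded ennreal_mult_less_top intro: le_less_trans)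
        finally show ?thesis .
      qed
      have comp: "AE y in lborel. y \<in> ball c \<rho> \<longrightarrow> ennreal (poisson_mass * \<bar>bump c a b y * U (y, t) $ k\<bar>) \<le> G (y, t)" for k
      proof (rule AE_bound_of_poisson_averages)
        have "\<bar>bump c a b x\<bar> \<le> 1" for x using bump_nonneg bump_le_1 by simp
        then show "integrable lborel (\<lambda>x. bump c a b x * U (x, t) $ k)"
          by (intro integrable_bounded_mult(2)[where C = 1] integrable_bounded_linear[OF bounded_linear_vec_nth iU]) auto
        show "AE y in lborel. y \<in> ball c \<rho> \<longrightarrow> ennreal \<bar>\<integral>x. (bump c a b x * U (x, t) $ k) * poisson (1 / real (Suc n)) (x - y) \<partial>lborel\<bar> \<le> G (y, t)" for n
          using elim(1) by (rule eventually_mono) (use t in \<open>auto simp: P_def F_def\<close>)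
      qed (use Gfin in auto)
      show "AE y in lborel. y \<in> ball c \<rho> \<longrightarrow> ennreal (norm (U (y, t))) \<le> ennreal (2 / poisson_mass) * G (y, t)"
        using comp[of 1] comp[of 2]
      proof eventually_elim
        case (elim y)
        show ?case
        proof
          assume y: "y \<in> ball c \<rho>"
          have b1: "bump c a b y = 1"
            using y r by (intro bump_eq_1) (auto simp: dist_norm norm_minus_commute)
          have k: "ennreal (poisson_mass * \<bar>U (y, t) $ 1\<bar>) \<le> G (y, t)" "ennreal (poisson_mass * \<bar>U (y, t) $ 2\<bar>) \<le> G (y, t)"
            using elim y by (simp_all add: b1)
          have "ennreal (norm (U (y, t))) \<le> ennreal ((1 / poisson_mass) * (poisson_mass * \<bar>U (y, t) $ 1\<bar> + poisson_mass * \<bar>U (y, t) $ 2\<bar>))"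
            using norm_vec2_le[of "U (y, t)"] poisson_mass_pos by (intro ennreal_leI) (simp flip: distrib_left)
          also have "\<dots> = ennreal (1 / poisson_mass) * (ennreal (poisson_mass * \<bar>U (y, t) $ 1\<bar>) + ennreal (poisson_mass * \<bar>U (y, t) $ 2\<bar>))"
            using poisson_mass_pos by (subst ennreal_mult) auto
          also have "\<dots> \<le> ennreal (1 / poisson_mass) * (G (y, t) + G (y, t))"
            by (intro mult_left_mono add_mono k) auto
          also have "\<dots> = ennreal (1 / poisson_mass) * 2 * G (y, t)" by (simp add: mult_2[symmetric] mult.assoc)
          also have "ennreal (1 / poisson_mass) * 2 = ennreal (1 / poisson_mass * 2)"
            using poisson_mass_pos by (subst ennreal_mult) auto
          finally show "ennreal (norm (U (y, t))) \<le> ennreal (2 / poisson_mass) * G (y, t)" by simp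
        qed
      qed
    qed
  qed
  have eqG: "ennreal (2 / poisson_mass) * G (y, t) = ennreal (2 / poisson_mass * K)
      + ennreal (2 / poisson_mass) * (\<integral>\<^sup>+x\<in>ball c b. ennreal (\<bar>W (x, t)\<bar> / norm (x - y)) \<partial>lborel)" for y t
  proof -
    have "ennreal (2 / poisson_mass * K) = ennreal (2 / poisson_mass) * ennreal K"
      using poisson_mass_pos by (intro ennreal_mult) (auto simp: K_def)
    then show ?thesis by (simp only: G_def fst_conv snd_conv distrib_left add.commute)
  qed
  show ?thesis
    using main unfolding eqG
    by (intro exI[of _ "2 / poisson_mass * K"] exI[of _ "2 / poisson_mass"] conjI)
      (use poisson_mass_pos in \<open>auto simp: K_def\<close>)
qed

subsection \<open>Reduction to Borel functions\<close>

text \<open>Preimages under \<open>f\<close> and \<open>g\<close> differ by subsets of a null set,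
  which the completion measures.\<close>

lemma measurable_completion_AE:
  assumes "AE x in M. f x = g x" and [measurable]: "g \<in> measurable M N" and sp: "\<And>x. x \<in> space M \<Longrightarrow> f x \<in> space N"
  shows "f \<in> measurable (completion M) N"
proof (rule measurableI)
  show "f x \<in> space N" if "x \<in> space (completion M)" for x using sp that by simp
  fix A assume [measurable]: "A \<in> sets N"
  have "AE x in M. \<not> (f x \<in> A \<and> f x \<noteq> g x)" using assms(1) by (rule eventually_mono) simp
  from sets_completion_AE[OF this] have 0: "Measurable.pred (completion M) (\<lambda>x. f x \<in> A \<and> f x \<noteq> g x)" .
  have "AE x in M. \<not> (g x \<in> A \<and> f x \<noteq> g x)" using assms(1) by (rule eventually_mono) simp
  from sets_completion_AE[OF this] have 1: "Measurable.pred (completion M) (\<lambda>x. g x \<in> A \<and> f x \<noteq> g x)" .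
  have "g -` A \<inter> space M \<in> sets (completion M)"
    by (rule sets_completionI_sets) measurable
  then have 2: "Measurable.pred (completion M) (\<lambda>x. g x \<in> A)"
    by (simp add: pred_def vimage_def Collect_conj_eq Int_commute)
  have "Measurable.pred (completion M) (\<lambda>x. (f x \<in> A \<and> f x \<noteq> g x) \<or> (g x \<in> A \<and> \<not> (g x \<in> A \<and> f x \<noteq> g x)))"
    by (intro pred_intros_logic 0 1 2)
  also have "(\<lambda>x. (f x \<in> A \<and> f x \<noteq> g x) \<or> (g x \<in> A \<and> \<not> (g x \<in> A \<and> f x \<noteq> g x))) = (\<lambda>x. f x \<in> A)" by auto
  finally show "f -` A \<inter> space (completion M) \<in> sets (completion M)"
    by (simp add: pred_def vimage_def Collect_conj_eq Int_commute)
qed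

lemma integral_lebesgue_AE_eq:
  fixes f g :: "'a::euclidean_space \<Rightarrow> real"
  assumes "AE x in lborel. f x = g x" "g \<in> borel_measurable borel"
  shows "(\<integral>x. f x \<partial>lebesgue) = (\<integral>x. g x \<partial>lborel)"
proof -
  have "(\<integral>x. f x \<partial>lebesgue) = (\<integral>x. g x \<partial>lebesgue)"
    using assms by (intro integral_cong_AE measurable_completion_AE[OF assms(1)] measurable_completion)
      (auto simp: AE_completion_iff)
  also have "\<dots> = (\<integral>x. g x \<partial>lborel)" using assms(2) by (intro integral_completion) simp
  finally show ?thesis .
qed

lemma nn_integral_lebesgue_AE_eq:
  assumes "AE x in lborel. f x = g x"
  shows "(\<integral>\<^sup>+x. f x \<partial>lebesgue) = (\<integral>\<^sup>+x. g x \<partial>lborel)"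
  using assms by (simp add: nn_integral_completion cong: nn_integral_cong_AE)

text \<open>Lebesgue measurability on a product does not pass to every slice, Borel measurability
  does. The real-valued statement is applied to each coordinate, and the result is cut to zero
  outside \<open>K\<close>.\<close>

lemma ex_borel_version:
  fixes f :: "'a::euclidean_space \<Rightarrow> 'b::euclidean_space"
  assumes f: "set_borel_measurable lebesgue K f" and K: "K \<in> sets borel"
  shows "\<exists>g\<in>borel_measurable borel. (AE z in lborel. z \<in> K \<longrightarrow> f z = g z) \<and> (\<forall>z. z \<notin> K \<longrightarrow> g z = 0)"
proof -
  have "\<exists>g\<in>borel_measurable lborel. AE z in lborel. (indicator K z *\<^sub>R f z) \<bullet> i = g z" for i :: 'b
    using borel_measurable_inner[OF f[unfolded set_borel_measurable_def] borel_measurable_const, of i]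
    by (rule completion_ex_borel_measurable_real)
  then obtain G where G: "\<And>i. G i \<in> borel_measurable lborel" "\<And>i. AE z in lborel. (indicator K z *\<^sub>R f z) \<bullet> i = G i z"
    by metis
  define g where "g z = (\<Sum>i\<in>Basis. (indicator K z * G i z) *\<^sub>R i)" for z
  have "g \<in> borel_measurable borel"
    unfolding g_def using G(1) K by (intro borel_measurable_sum borel_measurable_scaleR borel_measurable_times) auto
  moreover have "AE z in lborel. \<forall>i\<in>Basis. (indicator K z *\<^sub>R f z) \<bullet> i = G i z"
    using G(2) by (simp add: AE_finite_all)
  then have "AE z in lborel. z \<in> K \<longrightarrow> f z = g z"
  proof eventually_elim
    case (elim z)
    show ?case
    proof
      assume "z \<in> K"
      then have "g z = (\<Sum>i\<in>Basis. (f z \<bullet> i) *\<^sub>R i)"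
        unfolding g_def using elim by (intro sum.cong) auto
      then show "f z = g z" by (simp add: euclidean_representation)
    qed
  qed
  moreover have "\<forall>z. z \<notin> K \<longrightarrow> g z = 0" by (simp add: g_def)
  ultimately show ?thesis by blast
qed

text \<open>The exceptional set is first enlarged to a measurable null set, since the exchange of
  the variables requires measurability.\<close>

lemma AE_slices:
  fixes P :: "(real^2) \<times> real \<Rightarrow> bool"
  assumes "AE z in lborel. P z"
  shows "AE t in lborel. AE x in lborel. P (x, t)"
proof -
  from AE_E[OF assms] obtain N where N: "{z \<in> space lborel. \<not> P z} \<subseteq> N" "emeasure lborel N = 0" "N \<in> sets lborel"
    by blast
  have "AE z in lborel. z \<notin> N" using N by (intro AE_not_in) (simp add: null_setsI)
  then have "AE z in lborel \<Otimes>\<^sub>M lborel. z \<notin> N" by (simp only: lborel_prod)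
  from lborel_pair.AE_pair[OF this] have "AE x in lborel. AE t in lborel. (x, t) \<notin> N" .
  then have "AE t in lborel. AE x in lborel. (x, t) \<notin> N"
  proof (subst (asm) lborel_pair.AE_commute)
    have [measurable]: "N \<in> sets (lborel \<Otimes>\<^sub>M lborel)" using N(3) by (simp only: lborel_prod)
    show "{z \<in> space (lborel \<Otimes>\<^sub>M lborel). (fst z, snd z) \<notin> N} \<in> sets (lborel \<Otimes>\<^sub>M lborel)"
      unfolding prod.collapse by measurable
  qed
  then show ?thesis
    by (rule eventually_mono) (rule eventually_mono, assumption, use N(1) in auto)
qed

lemma AE_lebesgue_on:
  "S \<in> sets borel \<Longrightarrow> (AE t in lebesgue_on S. P t) \<longleftrightarrow> (AE t in lborel. t \<in> S \<longrightarrow> P t)"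
  by (subst AE_restrict_space_iff) (auto simp: AE_completion_iff)

lemma test_functions_product:
  fixes \<psi> :: "real^2 \<Rightarrow> real" and \<eta> :: "real \<Rightarrow> real"
  assumes \<psi>: "\<psi> \<in> test_functions A" and \<eta>: "\<eta> \<in> test_functions I"
  shows "(\<lambda>z. \<psi> (fst z) * \<eta> (snd z)) \<in> test_functions (A \<times> I)"
proof (rule test_functionsI)
  note \<psi>' = test_functionsD[OF \<psi>] and \<eta>' = test_functionsD[OF \<eta>]
  show "smooth_on (\<lambda>z. \<psi> (fst z) * \<eta> (snd z)) UNIV"
    by (intro smooth_on_mult smooth_on_fst smooth_on_snd \<psi>'(1) \<eta>'(1))
  show "compact (closure {x. \<psi> x \<noteq> 0} \<times> closure {t. \<eta> t \<noteq> 0})"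
    by (intro compact_Times \<psi>'(2) \<eta>'(2))
  show "closure {x. \<psi> x \<noteq> 0} \<times> closure {t. \<eta> t \<noteq> 0} \<subseteq> A \<times> I"
    using \<psi>'(3) \<eta>'(3) by blast
  show "\<psi> (fst z) * \<eta> (snd z) = 0" if "z \<notin> closure {x. \<psi> x \<noteq> 0} \<times> closure {t. \<eta> t \<noteq> 0}" for z
    using that \<psi>'(4)[of "fst z"] \<eta>'(4)[of "snd z"] by (cases z) auto
qed

text \<open>When \<open>t0 < T\<close>, \<open>b\<close> lies halfway to \<open>T\<close>, so
  \<open>{t0..b}\<close> is a compact time interval on which the local \<open>L^2\<close> bound
  applies; otherwise \<open>b = T = t0\<close>. Space and past keep a margin \<open>r\<close> inside
  the given cylinder of size \<open>4 * r\<close>. \<open>S\<close> is a real bound for the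
  \<open>L^1\<close> norms of the slices before \<open>t0\<close>.\<close>

locale euler_cylinder =
  fixes \<Omega> :: "(real^2) set" and T :: real and u :: "(real^2) \<times> real \<Rightarrow> real^2" and \<omega> :: "(real^2) \<times> real \<Rightarrow> real"
    and Vo \<epsilon> :: real and x0 :: "real^2" and t0 r S :: real
    and U :: "(real^2) \<times> real \<Rightarrow> real^2" and W :: "(real^2) \<times> real \<Rightarrow> real"
    and b :: real and K :: "((real^2) \<times> real) set" and J :: "real set"
  defines "b \<equiv> if t0 < T then (t0 + T) / 2 else T"
    and "K \<equiv> cball x0 (3 * r) \<times> {t0 - 3 * r..b}"
    and "J \<equiv> {t0 - 3 * r<..<b}"
  assumes open_dom: "open \<Omega>" and eps: "\<epsilon> > 0" and Vo: "Vo > 0"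
    and u_loc: "Linfty_loc_L2_loc \<Omega> T u" and u_sol: "weak_solution \<Omega> T u"
    and u_VE: "vorticity_estimates \<Omega> T u \<omega> Vo" and u_Lp: "Lp_loc (2 + \<epsilon>) (Omega_T \<Omega> T) u"
    and r: "r > 0" and cyl: "cball x0 (4 * r) \<subseteq> \<Omega>" "0 < t0 - 4 * r" "t0 \<le> T"
    and sup: "AE t in lborel. t \<in> {t0 - 4 * r<..<t0} \<longrightarrow>
      (\<integral>\<^sup>+x\<in>ball x0 (4 * r). ennreal (norm (u (x, t))) \<partial>lebesgue) \<le> ennreal S"
    and U [measurable]: "U \<in> borel_measurable borel" and W [measurable]: "W \<in> borel_measurable borel"
    and U_eq: "AE z in lborel. z \<in> K \<longrightarrow> u z = U z" and W_eq: "AE z in lborel. z \<in> K \<longrightarrow> \<omega> z = W z"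
    and U_out: "\<And>z. z \<notin> K \<Longrightarrow> U z = 0" and W_out: "\<And>z. z \<notin> K \<Longrightarrow> W z = 0"
begin

section \<open>Slices of the solution on the compact cylinder\<close>

lemma end_time_bounds: "t0 \<le> b" "b \<le> T" "t0 < T \<Longrightarrow> t0 < b" "t0 < T \<Longrightarrow> b < T" "\<not> t0 < T \<Longrightarrow> b = t0"
  using cyl(3) by (auto simp: b_def)

lemma ball_subset: "cball x0 (3 * r) \<subseteq> \<Omega>"
  using cyl(1) r by (auto simp: subset_iff)

lemma domain_compact: "compact K" "K \<subseteq> Omega_T \<Omega> T" "K \<in> sets borel"
proof -
  show "compact K" unfolding K_def by (intro compact_Times compact_cball compact_Icc)
  then show "K \<in> sets borel" by (auto dest: compact_imp_closed)
  show "K \<subseteq> Omega_T \<Omega> T" using ball_subset cyl end_time_bounds r by (auto simp: K_def Omega_T_def)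
qed

lemma K_measurable [measurable]: "K \<in> sets borel" by (rule domain_compact(3))

lemma slices_eq: "AE t in lborel. AE x in lborel. (x, t) \<in> K \<longrightarrow> u (x, t) = U (x, t) \<and> \<omega> (x, t) = W (x, t)"
  by (rule AE_slices) (rule eventually_elim2[OF U_eq W_eq], auto)

lemma U_powr_finite: "(\<integral>\<^sup>+z. ennreal (norm (U z) powr (2 + \<epsilon>)) \<partial>lborel) < \<infinity>"
proof -
  have "Lp (2 + \<epsilon>) K u" using u_Lp domain_compact unfolding Lp_loc_def by blast
  then have "(\<integral>\<^sup>+z. ennreal (norm (indicator K z *\<^sub>R (norm (u z) powr (2 + \<epsilon>)))) \<partial>lebesgue) < \<infinity>"
    unfolding Lp_def set_integrable_def integrable_iff_bounded by blast
  also have "(\<integral>\<^sup>+z. ennreal (norm (indicator K z *\<^sub>R (norm (u z) powr (2 + \<epsilon>)))) \<partial>lebesgue)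
      = (\<integral>\<^sup>+z. ennreal (norm (U z) powr (2 + \<epsilon>)) \<partial>lborel)"
    by (rule nn_integral_lebesgue_AE_eq, rule eventually_mono[OF U_eq]) (auto simp: U_out split: split_indicator)
  finally show ?thesis .
qed

lemma W_sq_finite: "(\<integral>\<^sup>+z. ennreal (\<bar>W z\<bar> powr 2) \<partial>lborel) < \<infinity>"
proof -
  have "Lp 2 K \<omega>" using u_VE domain_compact unfolding vorticity_estimates_def Lp_loc_def by blast
  then have "(\<integral>\<^sup>+z. ennreal (norm (indicator K z *\<^sub>R (norm (\<omega> z) powr 2))) \<partial>lebesgue) < \<infinity>"
    unfolding Lp_def set_integrable_def integrable_iff_bounded by blast
  also have "(\<integral>\<^sup>+z. ennreal (norm (indicator K z *\<^sub>R (norm (\<omega> z) powr 2))) \<partial>lebesgue)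
      = (\<integral>\<^sup>+z. ennreal (\<bar>W z\<bar> powr 2) \<partial>lborel)"
    by (rule nn_integral_lebesgue_AE_eq, rule eventually_mono[OF W_eq]) (auto simp: W_out split: split_indicator)
  finally show ?thesis .
qed

lemma integrable_of_powr:
  fixes f :: "(real^2) \<times> real \<Rightarrow> 'b::{banach, second_countable_topology}"
  assumes [measurable]: "f \<in> borel_measurable borel" and f: "\<And>z. z \<notin> K \<Longrightarrow> f z = 0" and "p \<ge> 1"
    and fin: "(\<integral>\<^sup>+z. ennreal (norm (f z) powr p) \<partial>lborel) < \<infinity>"
  shows "integrable lborel f"
proof (rule integrableI_bounded)
  have "(\<integral>\<^sup>+z. ennreal (norm (f z)) \<partial>lborel) \<le> (\<integral>\<^sup>+z. ennreal (norm (f z) powr p) + indicator K z \<partial>lborel)"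
  proof (rule nn_integral_mono)
    fix z
    show "ennreal (norm (f z)) \<le> ennreal (norm (f z) powr p) + indicator K z"
    proof (cases "z \<in> K")
      case True
      have "norm (f z) \<le> norm (f z) powr p + 1"
      proof (cases "norm (f z) \<le> 1")
        case False
        then have "norm (f z) powr 1 \<le> norm (f z) powr p" using \<open>p \<ge> 1\<close> by (intro powr_mono) auto
        then show ?thesis using False by simp
      qed (simp add: add_increasing)
      then have "ennreal (norm (f z)) \<le> ennreal (norm (f z) powr p + 1)" by (rule ennreal_leI)
      then show ?thesis using True by simp
    qed (simp add: f)
  qed
  also have "\<dots> = (\<integral>\<^sup>+z. ennreal (norm (f z) powr p) \<partial>lborel) + emeasure lborel K"
    by (subst nn_integral_add) auto
  also have "\<dots> < \<infinity>" using fin emeasure_compact_finite[OF domain_compact(1)] by simp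
  finally show "(\<integral>\<^sup>+z. ennreal (norm (f z)) \<partial>lborel) < \<infinity>" .
qed simp

lemma U_integrable: "integrable lborel U" and W_integrable: "integrable lborel W"
proof -
  show "integrable lborel U"
    by (rule integrable_of_powr[where p = "2 + \<epsilon>"]) (use U_out eps U_powr_finite in auto)
  show "integrable lborel W"
    by (rule integrable_of_powr[where p = 2]) (use W_out W_sq_finite in \<open>auto simp del: powr_numeral\<close>)
qed

lemma slices_integrable: "AE t in lborel. integrable lborel (\<lambda>x. U (x, t)) \<and> integrable lborel (\<lambda>x. W (x, t))"
proof -
  have "integrable (lborel \<Otimes>\<^sub>M lborel) (\<lambda>(x, t). U (x, t))" "integrable (lborel \<Otimes>\<^sub>M lborel) (\<lambda>(x, t). W (x, t))"
    using U_integrable W_integrable by (simp_all add: lborel_prod)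
  from lborel_pair.AE_integrable_snd[OF this(1)] lborel_pair.AE_integrable_snd[OF this(2)]
  show ?thesis by eventually_elim simp
qed

text \<open>Before \<open>t0\<close> the bound \<open>S\<close> applies. After \<open>t0\<close>,
  which occurs only if \<open>t0 < T\<close>, the local \<open>L^2\<close> bound on slices takes
  over through \<open>|u| \<le> |u|^2 + 1\<close>.\<close>

lemma U_L1_bound: "\<exists>A0. AE t in lborel. t \<in> J \<longrightarrow> (\<integral>x. norm (U (x, t)) \<partial>lborel) \<le> A0"
proof -
  obtain S2 where S2: "AE t in lborel. t \<in> J \<and> t0 \<le> t \<longrightarrow>
      (\<integral>\<^sup>+x\<in>cball x0 (3 * r). ennreal ((norm (u (x, t)))\<^sup>2) \<partial>lebesgue) \<le> ennreal S2"
  proof (cases "t0 < T")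
    case True
    \<comment> \<open>Finite by \<open>u_loc\<close>, because \<open>b < T\<close> strictly.\<close>
    define E where "E = esssup (lebesgue_on {t0..b}) (\<lambda>t. \<integral>\<^sup>+x\<in>cball x0 (3 * r). ennreal ((norm (u (x, t)))\<^sup>2) \<partial>lebesgue)"
    have "E < \<infinity>"
      using u_loc ball_subset True cyl(2) r end_time_bounds unfolding Linfty_loc_L2_loc_def E_def by auto
    then have "E = ennreal (enn2real E)" by simp
    moreover have "AE t in lborel. t \<in> {t0..b} \<longrightarrow> (\<integral>\<^sup>+x\<in>cball x0 (3 * r). ennreal ((norm (u (x, t)))\<^sup>2) \<partial>lebesgue) \<le> E"
      unfolding E_def by (subst AE_lebesgue_on[symmetric]) (auto intro: esssup_AE)
    ultimately have "AE t in lborel. t \<in> J \<and> t0 \<le> t \<longrightarrow>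
      (\<integral>\<^sup>+x\<in>cball x0 (3 * r). ennreal ((norm (u (x, t)))\<^sup>2) \<partial>lebesgue) \<le> ennreal (enn2real E)"
      by (auto elim!: eventually_mono simp: J_def)
    then show thesis by (rule that)
  next
    case False
    then show thesis using end_time_bounds(5) by (intro that[of 0]) (auto simp: J_def)
  qed
  define m where "m = measure lborel (cball x0 (3 * r))"
  have m: "emeasure lborel (cball x0 (3 * r)) = ennreal m"
    using emeasure_compact_finite[OF compact_cball, of x0 "3 * r"] by (simp add: m_def emeasure_eq_ennreal_measure less_top)
  define A0 where "A0 = max 0 S + (max 0 S2 + m)"
  have m0: "m \<ge> 0" by (simp add: m_def)
  have [measurable]: "cball x0 (3 * r) \<in> sets borel" by simp
  have "AE t in lborel. t \<in> J \<longrightarrow> (\<integral>x. norm (U (x, t)) \<partial>lborel) \<le> A0"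
    using sup S2 slices_eq slices_integrable
  proof eventually_elim
    case (elim t)
    show ?case
    proof
      assume t: "t \<in> J"
      have K': "(x, t) \<in> K \<longleftrightarrow> x \<in> cball x0 (3 * r)" for x using t by (auto simp: K_def J_def)
      have "(\<integral>\<^sup>+x. ennreal (norm (U (x, t))) \<partial>lborel) = (\<integral>\<^sup>+x\<in>cball x0 (3 * r). ennreal (norm (u (x, t))) \<partial>lebesgue)"
        by (rule nn_integral_lebesgue_AE_eq[symmetric], rule eventually_mono[OF elim(3)])
            (auto simp: K' U_out split: split_indicator)
      also have "\<dots> \<le> ennreal A0"
      proof (cases "t < t0")
        case True
        have "(\<integral>\<^sup>+x\<in>cball x0 (3 * r). ennreal (norm (u (x, t))) \<partial>lebesgue)
          \<le> (\<integral>\<^sup>+x\<in>ball x0 (4 * r). ennreal (norm (u (x, t))) \<partial>lebesgue)"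
          using r by (intro nn_integral_mono) (auto split: split_indicator)
        also have "\<dots> \<le> ennreal S" using elim(1) True t r by (auto simp: J_def)
        also have "\<dots> \<le> ennreal A0" using m0 by (intro ennreal_leI) (simp add: A0_def)
        finally show ?thesis .
      next
        case False
        have "(\<integral>\<^sup>+x\<in>cball x0 (3 * r). ennreal (norm (u (x, t))) \<partial>lebesgue)
          \<le> (\<integral>\<^sup>+x. ennreal ((norm (u (x, t)))\<^sup>2) * indicator (cball x0 (3 * r)) x + indicator (cball x0 (3 * r)) x \<partial>lebesgue)"
        proof (rule nn_integral_mono)
          fix x
          have "norm (u (x, t)) \<le> (norm (u (x, t)))\<^sup>2 + 1"
            using sum_squares_bound[of "norm (u (x, t))" 1] norm_ge_zero[of "u (x, t)"] unfolding power_one by linarith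
          then have "ennreal (norm (u (x, t))) \<le> ennreal ((norm (u (x, t)))\<^sup>2) + 1"
            by (metis ennreal_1 ennreal_leI ennreal_plus zero_le_one zero_le_power2)
          then show "ennreal (norm (u (x, t))) * indicator (cball x0 (3 * r)) x
            \<le> ennreal ((norm (u (x, t)))\<^sup>2) * indicator (cball x0 (3 * r)) x + indicator (cball x0 (3 * r)) x"
            by (auto split: split_indicator)
        qed
        also have "\<dots> = (\<integral>\<^sup>+x. ennreal ((norm (U (x, t)))\<^sup>2) + indicator (cball x0 (3 * r)) x \<partial>lborel)"
          by (rule nn_integral_lebesgue_AE_eq, rule eventually_mono[OF elim(3)])
            (auto simp: K' U_out split: split_indicator)
        also have "\<dots> = (\<integral>\<^sup>+x. ennreal ((norm (U (x, t)))\<^sup>2) \<partial>lborel) + emeasure lborel (cball x0 (3 * r))"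
          using borel_measurable_slice(1)[OF U, of t] by (subst nn_integral_add) auto
        also have "(\<integral>\<^sup>+x. ennreal ((norm (U (x, t)))\<^sup>2) \<partial>lborel) = (\<integral>\<^sup>+x\<in>cball x0 (3 * r). ennreal ((norm (u (x, t)))\<^sup>2) \<partial>lebesgue)"
          by (rule nn_integral_lebesgue_AE_eq[symmetric], rule eventually_mono[OF elim(3)])
            (auto simp: K' U_out split: split_indicator)
        also have "\<dots> + emeasure lborel (cball x0 (3 * r)) \<le> ennreal (max 0 S2) + ennreal m"
          unfolding m using elim(2) t False by (intro add_right_mono) (auto intro: order_trans ennreal_leI)
        also have "\<dots> = ennreal (max 0 S2 + m)" using m0 by simp
        also have "\<dots> \<le> ennreal A0" by (intro ennreal_leI) (simp add: A0_def)
        finally show ?thesis .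
      qed
      finally have le: "(\<integral>\<^sup>+x. ennreal (norm (U (x, t))) \<partial>lborel) \<le> ennreal A0" .
      have "ennreal (\<integral>x. norm (U (x, t)) \<partial>lborel) \<le> ennreal A0"
        using le elim(4) by (subst nn_integral_eq_integral[symmetric]) auto
      then show "(\<integral>x. norm (U (x, t)) \<partial>lborel) \<le> A0"
        using m0 by (subst (asm) ennreal_le_iff) (auto simp: A0_def)
    qed
  qed
  then show ?thesis ..
qed

lemma divergence_free:
  assumes \<psi>: "\<psi> \<in> test_functions (cball x0 (3 * r))"
  shows "AE t in lborel. t \<in> J \<longrightarrow> (\<integral>x. U (x, t) \<bullet> grad \<psi> x \<partial>lborel) = 0"
proof -
  have \<psi>\<Omega>: "\<psi> \<in> test_functions \<Omega>"
    using \<psi> ball_subset by (auto simp: test_functions_def)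
  have "AE t in lebesgue_on {0..T}. (LINT x:\<Omega>|lebesgue. u (x, t) \<bullet> grad \<psi> x) = 0"
    using u_sol test_function_in_H10[OF \<psi>\<Omega> open_dom] weak_gradient_test_function[OF \<psi>\<Omega>]
    unfolding weak_solution_def by blast
  then have "AE t in lborel. t \<in> {0..T} \<longrightarrow> (LINT x:\<Omega>|lebesgue. u (x, t) \<bullet> grad \<psi> x) = 0"
    by (subst (asm) AE_lebesgue_on) auto
  then show ?thesis
    using slices_eq
  proof eventually_elim
    case (elim t)
    show ?case
    proof
      assume t: "t \<in> J"
      have K': "(x, t) \<in> K \<longleftrightarrow> x \<in> cball x0 (3 * r)" for x using t by (auto simp: K_def J_def)
      have tT: "t \<in> {0..T}" using t cyl(2) r end_time_bounds by (auto simp: J_def)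
      have g0: "grad \<psi> x = 0" if "x \<notin> cball x0 (3 * r)" for x
        using test_functions_grad_support[OF \<psi>, of x] test_functionsD(3)[OF \<psi>] that by blast
      have "(LINT x:\<Omega>|lebesgue. u (x, t) \<bullet> grad \<psi> x) = (\<integral>x. U (x, t) \<bullet> grad \<psi> x \<partial>lborel)"
        unfolding set_lebesgue_integral_def
      proof (rule integral_lebesgue_AE_eq)
        show "AE x in lborel. indicator \<Omega> x *\<^sub>R (u (x, t) \<bullet> grad \<psi> x) = U (x, t) \<bullet> grad \<psi> x"
          using elim(2)
        proof eventually_elim
          case (elim x)
          then show ?case using K'[of x] g0[of x] ball_subset by (cases "x \<in> cball x0 (3 * r)") auto
        qed
        have "grad \<psi> \<in> borel_measurable borel"
          by (rule borel_measurable_continuous_onI[OF continuous_on_grad[OF test_functionsD(1)[OF \<psi>]]])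
        then show "(\<lambda>x. U (x, t) \<bullet> grad \<psi> x) \<in> borel_measurable borel"
          using borel_measurable_slice(1)[OF U, of t] by simp
      qed
      then show "(\<integral>x. U (x, t) \<bullet> grad \<psi> x \<partial>lborel) = 0" using elim(1) tT by simp
    qed
  qed
qed

text \<open>The vorticity is given as a space-time distribution only. Testing with products of
  \<psi> and a function of time shows that the defect \<open>g\<close> annihilates all smooth tests
  in time, so it vanishes almost everywhere.\<close>

lemma vorticity_slices:
  assumes \<psi>: "\<psi> \<in> test_functions (cball x0 (3 * r))"
  shows "AE t in lborel. t \<in> J \<longrightarrow> (\<integral>x. W (x, t) * \<psi> x \<partial>lborel)
    = (\<integral>x. U (x, t) $ 1 * grad \<psi> x $ 2 - U (x, t) $ 2 * grad \<psi> x $ 1 \<partial>lborel)"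
proof -
  note \<psi>' = test_functionsD[OF \<psi>]
  have g0: "grad \<psi> x = 0" if "x \<notin> closure {z. \<psi> z \<noteq> 0}" for x
    by (rule test_functions_grad_support[OF \<psi> that])
  have cont: "continuous_on UNIV \<psi>" "continuous_on UNIV (\<lambda>x. grad \<psi> x $ k)" for k
    by (rule smooth_on_continuous[OF \<psi>'(1)], rule smooth_on_continuous[OF smooth_on_grad_nth[OF \<psi>'(1)]])
  have [measurable]: "\<psi> \<in> borel_measurable borel" "(\<lambda>x. grad \<psi> x $ k) \<in> borel_measurable borel" for k
    using cont by (auto intro: borel_measurable_continuous_onI)
  obtain C0 where C0: "\<And>x. \<bar>\<psi> x\<bar> \<le> C0"
    using continuous_compact_support_bounded[OF cont(1) \<psi>'(2,4)] by metis
  have "\<exists>C. \<forall>x. \<bar>grad \<psi> x $ k\<bar> \<le> C" for k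
  proof -
    have "grad \<psi> x $ k = 0" if "x \<notin> closure {z. \<psi> z \<noteq> 0}" for x using g0[OF that] by simp
    then show ?thesis
      using continuous_compact_support_bounded[OF cont(2) \<psi>'(2)] by metis
  qed
  then obtain C where C: "\<And>k x. \<bar>grad \<psi> x $ k\<bar> \<le> C k" by metis
  have fst_meas: "fst \<in> measurable (borel :: ((real^2) \<times> real) measure) borel"
    by (intro borel_measurable_continuous_onI continuous_on_fst continuous_on_id)
  have snd_meas: "snd \<in> measurable (borel :: ((real^2) \<times> real) measure) borel"
    by (intro borel_measurable_continuous_onI continuous_on_snd continuous_on_id)
  note fst_meas[measurable] snd_meas[measurable]
  have Uk: "integrable lborel (\<lambda>z. U z $ k)" for k
    by (rule integrable_bounded_linear[OF bounded_linear_vec_nth U_integrable])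
  have [measurable]: "(\<lambda>z. U z $ k) \<in> borel_measurable borel" for k using Uk[of k] by auto
  define \<Phi> where "\<Phi> z = W z * \<psi> (fst z) - (U z $ 1 * grad \<psi> (fst z) $ 2 - U z $ 2 * grad \<psi> (fst z) $ 1)" for z
  have i: "integrable lborel (\<lambda>z. W z * \<psi> (fst z))" "integrable lborel (\<lambda>z. U z $ k * grad \<psi> (fst z) $ l)" for k l
  proof -
    show "integrable lborel (\<lambda>z. W z * \<psi> (fst z))"
      by (rule integrable_bounded_mult(1)[OF W_integrable _ C0]) measurable
    show "integrable lborel (\<lambda>z. U z $ k * grad \<psi> (fst z) $ l)"
      by (rule integrable_bounded_mult(1)[OF Uk _ C]) measurable
  qed
  have \<Phi>: "integrable lborel \<Phi>" unfolding \<Phi>_def using i by auto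
  define g where "g t = (\<integral>x. \<Phi> (x, t) \<partial>lborel)" for t
  have \<Phi>': "integrable (lborel \<Otimes>\<^sub>M lborel) (\<lambda>(x, t). \<Phi> (x, t))" using \<Phi> by (simp add: lborel_prod)
  have g: "integrable lborel g" unfolding g_def by (rule lborel_pair.integrable_snd[OF \<Phi>'])
  have "AE t in lborel. t \<in> {t0 - 3 * r<..<b} \<longrightarrow> g t = 0"
  proof (rule AE_zero_of_test_functions_real[OF g])
    fix \<eta> :: "real \<Rightarrow> real" assume \<eta>: "\<eta> \<in> test_functions {t0 - 3 * r<..<b}"
    note \<eta>' = test_functionsD[OF \<eta>]
    define \<phi> where "\<phi> z = \<psi> (fst z) * \<eta> (snd z)" for z
    have ceta: "continuous_on UNIV \<eta>" by (rule smooth_on_continuous[OF \<eta>'(1)])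
    have [measurable]: "\<eta> \<in> borel_measurable borel" using ceta by (rule borel_measurable_continuous_onI)
    obtain C1 where C1: "\<And>t. \<bar>\<eta> t\<bar> \<le> C1"
      using continuous_compact_support_bounded[OF ceta \<eta>'(2,4)] by metis
    have "cball x0 (3 * r) \<times> {t0 - 3 * r<..<b} \<subseteq> \<Omega> \<times> {0<..<T}"
      using ball_subset cyl(2) r end_time_bounds by auto
    then have test: "\<phi> \<in> test_functions (\<Omega> \<times> {0<..<T})"
      using test_functions_product[OF \<psi> \<eta>] unfolding \<phi>_def[abs_def] test_functions_def by auto
    have gx: "grad_x \<phi> z = \<eta> (snd z) *\<^sub>R grad \<psi> (fst z)" for z
      unfolding \<phi>_def[abs_def] by (rule grad_x_product[OF \<psi>'(1)])
    \<comment> \<open>Outside \<open>K\<close> the product test and its spatial gradient vanish, so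
      replacing the solution by its Borel versions changes no integral.\<close>
    have out: "\<eta> (snd z) = 0 \<or> (\<psi> (fst z) = 0 \<and> grad \<psi> (fst z) = 0)" if "z \<notin> K" for z
    proof (cases "fst z \<in> cball x0 (3 * r)")
      case True
      then have "snd z \<notin> {t0 - 3 * r<..<b}" using that by (cases z) (auto simp: K_def)
      then show ?thesis using \<eta>'(3) \<eta>'(4)[of "snd z"] by blast
    next
      case False
      then show ?thesis using \<psi>'(3) \<psi>'(4)[of "fst z"] g0[of "fst z"] by blast
    qed
    have eq: "(LINT z:Omega_T \<Omega> T|lebesgue. \<omega> z * \<phi> z) =
        (LINT z:Omega_T \<Omega> T|lebesgue. u z $ 1 * grad_x \<phi> z $ 2 - u z $ 2 * grad_x \<phi> z $ 1)"
      using u_VE test unfolding vorticity_estimates_def is_vorticity_def by blast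
    have "(LINT z:Omega_T \<Omega> T|lebesgue. \<omega> z * \<phi> z) = (\<integral>z. (W z * \<psi> (fst z)) * \<eta> (snd z) \<partial>lborel)"
      unfolding set_lebesgue_integral_def
    proof (rule integral_lebesgue_AE_eq)
      show "AE z in lborel. indicator (Omega_T \<Omega> T) z *\<^sub>R (\<omega> z * \<phi> z) = (W z * \<psi> (fst z)) * \<eta> (snd z)"
        using W_eq
      proof eventually_elim
        case (elim z)
        then show ?case using out[of z] W_out[of z] domain_compact(2) by (cases "z \<in> K") (auto simp: \<phi>_def)
      qed
    qed measurable
    moreover have "(LINT z:Omega_T \<Omega> T|lebesgue. u z $ 1 * grad_x \<phi> z $ 2 - u z $ 2 * grad_x \<phi> z $ 1)
      = (\<integral>z. (U z $ 1 * grad \<psi> (fst z) $ 2 - U z $ 2 * grad \<psi> (fst z) $ 1) * \<eta> (snd z) \<partial>lborel)"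
      unfolding set_lebesgue_integral_def
    proof (rule integral_lebesgue_AE_eq)
      show "AE z in lborel. indicator (Omega_T \<Omega> T) z *\<^sub>R (u z $ 1 * grad_x \<phi> z $ 2 - u z $ 2 * grad_x \<phi> z $ 1)
        = (U z $ 1 * grad \<psi> (fst z) $ 2 - U z $ 2 * grad \<psi> (fst z) $ 1) * \<eta> (snd z)"
        using U_eq
      proof eventually_elim
        case (elim z)
        then show ?case using out[of z] U_out[of z] domain_compact(2)
          by (cases "z \<in> K") (auto simp: gx algebra_simps)
      qed
    qed measurable
    moreover have "(\<integral>z. (W z * \<psi> (fst z)) * \<eta> (snd z) \<partial>lborel)
        - (\<integral>z. (U z $ 1 * grad \<psi> (fst z) $ 2 - U z $ 2 * grad \<psi> (fst z) $ 1) * \<eta> (snd z) \<partial>lborel)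
      = (\<integral>z. \<Phi> z * \<eta> (snd z) \<partial>lborel)"
    proof (subst Bochner_Integration.integral_diff[symmetric])
      show "integrable lborel (\<lambda>z. (W z * \<psi> (fst z)) * \<eta> (snd z))"
        by (rule integrable_bounded_mult(1)[OF i(1) _ C1]) measurable
      show "integrable lborel (\<lambda>z. (U z $ 1 * grad \<psi> (fst z) $ 2 - U z $ 2 * grad \<psi> (fst z) $ 1) * \<eta> (snd z))"
        by (rule integrable_bounded_mult(1)[OF Bochner_Integration.integrable_diff[OF i(2) i(2)] _ C1]) measurable
    qed (simp add: \<Phi>_def left_diff_distrib)
    ultimately have "(\<integral>z. \<Phi> z * \<eta> (snd z) \<partial>lborel) = 0" using eq by simp
    moreover have "(\<integral>z. \<Phi> z * \<eta> (snd z) \<partial>lborel) = (\<integral>t. g t * \<eta> t \<partial>lborel)"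
    proof -
      have "integrable lborel (\<lambda>z. \<Phi> z * \<eta> (snd z))"
        by (rule integrable_bounded_mult(1)[OF \<Phi> _ C1]) measurable
      then have "integrable (lborel \<Otimes>\<^sub>M lborel) (\<lambda>(x, t). \<Phi> (x, t) * \<eta> t)" by (simp add: lborel_prod split_def)
      from lborel_pair.integral_snd[OF this]
      have "(\<integral>t. (\<integral>x. \<Phi> (x, t) * \<eta> t \<partial>lborel) \<partial>lborel) = (\<integral>z. \<Phi> z * \<eta> (snd z) \<partial>lborel)"
        by (simp add: lborel_prod split_def)
      then show ?thesis by (simp add: g_def)
    qed
    ultimately show "(\<integral>t. g t * \<eta> t \<partial>lborel) = 0" by simp
  qed
  then show ?thesis
    using slices_integrable
  proof eventually_elim
    case (elim t)
    show ?case
    proof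
      assume "t \<in> J"
      then have "g t = 0" using elim by (simp add: J_def)
      have iW: "integrable lborel (\<lambda>x. W (x, t) * \<psi> x)"
        using elim by (intro integrable_bounded_mult(1)[OF _ _ C0]) auto
      have "integrable lborel (\<lambda>x. U (x, t) $ k)" for k
        using elim by (intro integrable_bounded_linear[OF bounded_linear_vec_nth]) auto
      then have iU: "integrable lborel (\<lambda>x. U (x, t) $ k * grad \<psi> x $ l)" for k l
        by (rule integrable_bounded_mult(1)[OF _ _ C]) measurable
      have "g t = (\<integral>x. W (x, t) * \<psi> x \<partial>lborel)
          - (\<integral>x. U (x, t) $ 1 * grad \<psi> x $ 2 - U (x, t) $ 2 * grad \<psi> x $ 1 \<partial>lborel)"
        unfolding g_def \<Phi>_def fst_conv
        by (rule Bochner_Integration.integral_diff[OF iW Bochner_Integration.integrable_diff[OF iU iU]])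
      then show "(\<integral>x. W (x, t) * \<psi> x \<partial>lborel)
        = (\<integral>x. U (x, t) $ 1 * grad \<psi> x $ 2 - U (x, t) $ 2 * grad \<psi> x $ 1 \<partial>lborel)"
        using \<open>g t = 0\<close> by simp
    qed
  qed
qed

section \<open>The vorticity estimate on concentric cylinders\<close>

definition h :: real where "h = (if t0 < T then min (r / 3) ((b - t0) / 3) else r / 3)"

text \<open>The parameter of the cylinders runs up to 3, hence the thirds in \<open>h\<close>. The
  largest radius is then at most \<open>2 * r\<close>, and the forward end \<open>t0 + 3 * h\<close>
  stays below \<open>b\<close> unless \<open>b\<close> is the final time, where the cap at
  \<open>b\<close> acts.\<close>

lemma scale_bounds: "h > 0" "3 * h \<le> r" "t0 + 3 * h \<le> b \<or> b = T"
proof -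
  show "h > 0" "3 * h \<le> r" using r end_time_bounds(3) by (auto simp: h_def)
  show "t0 + 3 * h \<le> b \<or> b = T"
  proof (cases "t0 < T")
    case True
    then have "h \<le> (b - t0) / 3"
      using min.cobounded2[of "r / 3" "(b - t0) / 3"] by (simp only: h_def if_True)
    then show ?thesis by simp
  next
    case False
    then show ?thesis by (simp add: b_def)
  qed
qed

lemma h_mult: "s \<le> 3 \<Longrightarrow> h * s \<le> r"
  using mult_left_mono[of s 3 h] scale_bounds by linarith

text \<open>The cut-off is a product of a radial bump and a time window, both equal to 1 on the
  smaller cylinder and with transitions of width \<open>h * (s - s')\<close>. If
  \<open>b = T\<close>, the window closes only after \<open>T\<close>, which is admissible because
  cut-offs have to vanish only near the lateral and initial boundary. \<open>V\<close> is
  independent of \<alpha>.\<close>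

lemma local_vorticity_estimate:
  "\<exists>V\<ge>1. \<forall>\<alpha> s s'. 0 \<le> \<alpha> \<longrightarrow> \<alpha> < 1 \<longrightarrow> 0 \<le> s' \<longrightarrow> s' < s \<longrightarrow> s \<le> 3 \<longrightarrow>
    (AE t in lborel. t \<in> {t0 - r - h * s'<..<t0 + h * s'} \<inter> {..b} \<longrightarrow>
      (\<integral>\<^sup>+x\<in>ball x0 (r + h * s'). ennreal (\<bar>W (x, t)\<bar> powr (1 + \<alpha>)) \<partial>lborel)
        \<le> ennreal (V / (s - s')) * (\<integral>\<^sup>+z\<in>ball x0 (r + h * s) \<times> ({t0 - r - h * s<..<t0 + h * s} \<inter> {..b}).
            ennreal (\<bar>W z\<bar> powr (1 + \<alpha>) * (norm (U z) + 1)) \<partial>lborel))"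
proof -
  obtain M1 where M1: "M1 > 0"
    "\<And>c a b x. 0 < a \<Longrightarrow> a < b \<Longrightarrow> norm (grad (bump c a b) x) \<le> M1 / (b - a)"
    "\<And>c a b x. 0 < a \<Longrightarrow> a < b \<Longrightarrow> norm (x - c) < a \<or> b \<le> norm (x - c) \<Longrightarrow> grad (bump c a b) x = 0"
    using bump_grad by metis
  obtain M2 where M2: "M2 > 0" "\<And>x. (smooth_step has_real_derivative deriv smooth_step x) (at x)"
    "\<And>x. \<bar>deriv smooth_step x\<bar> \<le> M2" "\<And>x. x < 1/2 \<Longrightarrow> deriv smooth_step x = 0"
    using smooth_step_derivative_bounded by metis
  define M where "M = (M1 + 2 * M2) / h"
  have M0: "M > 0" using M1(1) M2(1) scale_bounds by (simp add: M_def)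
  define V where "V = max 1 (Vo * M)"
  have main: "AE t in lborel. t \<in> {t0 - r - h * s'<..<t0 + h * s'} \<inter> {..b} \<longrightarrow>
      (\<integral>\<^sup>+x\<in>ball x0 (r + h * s'). ennreal (\<bar>W (x, t)\<bar> powr (1 + \<alpha>)) \<partial>lborel)
        \<le> ennreal (V / (s - s')) * (\<integral>\<^sup>+z\<in>ball x0 (r + h * s) \<times> ({t0 - r - h * s<..<t0 + h * s} \<inter> {..b}).
            ennreal (\<bar>W z\<bar> powr (1 + \<alpha>) * (norm (U z) + 1)) \<partial>lborel)"
    if al: "0 \<le> \<alpha>" "\<alpha> < 1" and s: "0 \<le> s'" "s' < s" "s \<le> 3" for \<alpha> s s'
  proof -
    define ra rb where "ra = r + h * s'" and "rb = r + h * s"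
    define d where "d = h * (s - s')"
    have d: "d > 0" "rb - ra = d" using s scale_bounds by (simp_all add: d_def ra_def rb_def right_diff_distrib)
    have hs: "0 \<le> h * s'" using scale_bounds s by simp
    have hs3: "h * s \<le> r" "h * s' \<le> r" using h_mult s by auto
    have rab: "0 < ra" "ra < rb" "rb \<le> 2 * r" using d hs r hs3 by (auto simp: ra_def rb_def)
    define \<xi> where "\<xi> = bump x0 ra rb"
    \<comment> \<open>Each argument is 0 at an end of the larger time interval and reaches 1 at the
      corresponding end of the smaller one.\<close>
    define a1 a2 where "a1 t = (t - (t0 - r - h * s)) / d" and "a2 t = (t0 + h * s - t) / d" for t
    define \<theta> where "\<theta> t = smooth_step (a1 t) * smooth_step (a2 t)" for t
    define \<theta>' where "\<theta>' t = (deriv smooth_step (a1 t) * smooth_step (a2 t) - smooth_step (a1 t) * deriv smooth_step (a2 t)) / d" for t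
    have \<theta>D: "(\<theta> has_real_derivative \<theta>' t) (at t)" for t
    proof -
      have 1: "(a1 has_real_derivative 1 / d) (at t)" "(a2 has_real_derivative - 1 / d) (at t)"
        unfolding a1_def a2_def using d(1) by (auto intro!: derivative_eq_intros)
      have 2: "((\<lambda>t. smooth_step (a1 t)) has_real_derivative deriv smooth_step (a1 t) * (1 / d)) (at t)"
        "((\<lambda>t. smooth_step (a2 t)) has_real_derivative deriv smooth_step (a2 t) * (- 1 / d)) (at t)"
        by (rule DERIV_chain2[OF M2(2) 1(1)], rule DERIV_chain2[OF M2(2) 1(2)])
      from DERIV_mult[OF this] show ?thesis
        unfolding \<theta>_def[abs_def] \<theta>'_def using d by (simp add: field_simps)
    qed
    have \<theta>_out: "\<theta> t = 0" "\<theta>' t = 0" if "t \<notin> {t0 - r - h * s<..<t0 + h * s}" for t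
    proof -
      have "a1 t \<le> 0 \<or> a2 t \<le> 0" using that d by (auto simp: a1_def a2_def divide_le_0_iff)
      then show "\<theta> t = 0" "\<theta>' t = 0"
        using smooth_step_eq_0[of "a1 t"] smooth_step_eq_0[of "a2 t"] M2(4)[of "a1 t"] M2(4)[of "a2 t"] by (auto simp: \<theta>_def \<theta>'_def)
    qed
    have \<theta>01: "0 \<le> \<theta> t" "\<theta> t \<le> 1" for t
      using smooth_step_nonneg smooth_step_le_1 by (auto simp: \<theta>_def intro: mult_le_one)
    have \<theta>'b: "\<bar>\<theta>' t\<bar> \<le> 2 * M2 / d" for t
    proof -
      have p: "\<bar>deriv smooth_step x * smooth_step y\<bar> \<le> M2 * 1" "\<bar>smooth_step y * deriv smooth_step x\<bar> \<le> 1 * M2" for x y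
        unfolding abs_mult using M2(1,3) smooth_step_nonneg smooth_step_le_1 by (intro mult_mono; simp)+
      have "\<bar>deriv smooth_step (a1 t) * smooth_step (a2 t) - smooth_step (a1 t) * deriv smooth_step (a2 t)\<bar> \<le> 2 * M2"
        using p(1)[of "a1 t" "a2 t"] p(2)[of "a1 t" "a2 t"] by linarith
      then show ?thesis using d by (simp add: \<theta>'_def divide_right_mono)
    qed
    have \<theta>_one: "\<theta> t = 1" if "t \<in> {t0 - r - h * s'<..<t0 + h * s'}" for t
    proof -
      have "1 \<le> a1 t" "1 \<le> a2 t" using that d by (auto simp: a1_def a2_def d_def right_diff_distrib)
      then show ?thesis by (simp add: \<theta>_def smooth_step_eq_1)
    qed
    have \<theta>s: "smooth_on \<theta> UNIV"
    proof -
      have "smooth_on (\<lambda>t. smooth_step ((1 / d) * t + (- (t0 - r - h * s) / d))) UNIV"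
        "smooth_on (\<lambda>t. smooth_step ((- 1 / d) * t + (t0 + h * s) / d)) UNIV"
        by (rule smooth_on_compose_affine[OF smooth_on_smooth_step bounded_linear_mult_right])+
      then have "smooth_on (\<lambda>t. smooth_step ((1 / d) * t + (- (t0 - r - h * s) / d)) * smooth_step ((- 1 / d) * t + (t0 + h * s) / d)) UNIV"
        by (rule smooth_on_mult)
      moreover have "(1 / d) * t + (- (t0 - r - h * s) / d) = a1 t" "(- 1 / d) * t + (t0 + h * s) / d = a2 t" for t
        by (simp_all add: a1_def a2_def diff_divide_distrib add_divide_distrib)
      ultimately show ?thesis by (simp only: \<theta>_def[abs_def])
    qed
    define \<zeta> where "\<zeta> z = \<xi> (fst z) * \<theta> (snd z)" for z
    have \<xi>s: "smooth_on \<xi> UNIV" unfolding \<xi>_def by (rule smooth_on_bump)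
    have \<xi>01: "0 \<le> \<xi> x" "\<xi> x \<le> 1" for x by (simp_all add: \<xi>_def bump_nonneg bump_le_1)
    have \<xi>_out: "\<xi> x = 0" "grad \<xi> x = 0" if "x \<notin> ball x0 rb" for x
      using that bump_eq_0[OF rab(1,2), of x x0] M1(3)[OF rab(1,2), of x x0]
      by (auto simp: \<xi>_def dist_norm norm_minus_commute)
    have gz: "grad_x \<zeta> z = \<theta> (snd z) *\<^sub>R grad \<xi> (fst z)" for z
      unfolding \<zeta>_def[abs_def] by (rule grad_x_product[OF \<xi>s])
    have dz: "d_t \<zeta> z = \<xi> (fst z) * \<theta>' (snd z)" for z
      unfolding \<zeta>_def[abs_def] by (rule d_t_product[OF \<theta>D])
    define D where "D = ball x0 rb \<times> ({t0 - r - h * s<..<t0 + h * s} \<inter> {..b})"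
    have DK: "D \<subseteq> K"
    proof
      fix z assume z: "z \<in> D"
      obtain x t where xt: "z = (x, t)" by (cases z)
      have "dist x0 x \<le> 3 * r" "t0 - 3 * r \<le> t" "t \<le> b"
        using z rab(3) hs3 r unfolding xt D_def by auto
      then show "z \<in> K" unfolding xt K_def by auto
    qed
    have cut: "\<zeta> \<in> VE_cutoffs \<Omega> T"
      unfolding VE_cutoffs_def
    proof (intro CollectI conjI)
      have "smooth_on \<zeta> UNIV"
        unfolding \<zeta>_def[abs_def] by (intro smooth_on_mult smooth_on_fst smooth_on_snd \<xi>s \<theta>s)
      then show "\<exists>W. open W \<and> Omega_T \<Omega> T \<subseteq> W \<and> smooth_on \<zeta> W" by (intro exI[of _ UNIV]) auto
      show "\<forall>z\<in>Omega_T \<Omega> T. 0 \<le> \<zeta> z" by (simp add: \<zeta>_def \<xi>01 \<theta>01)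
      \<comment> \<open>The removed closed set is unbounded in the future: the parabolic boundary
        has no final face from which it would have to stay away.\<close>
      define N where "N = - (cball x0 rb \<times> {t0 - r - h * s..})"
      have "open N" unfolding N_def by (intro open_Compl closed_Times) auto
      moreover have "parabolic_boundary \<Omega> T \<subseteq> N"
      proof -
        have "cball x0 rb \<subseteq> \<Omega>" using ball_subset rab(3) r by (auto simp: subset_iff)
        moreover have "frontier \<Omega> \<inter> \<Omega> = {}" using open_dom by (auto simp: frontier_def interior_open)
        ultimately have "frontier \<Omega> \<inter> cball x0 rb = {}" by blast
        moreover have "t0 - r - h * s > 0" using cyl(2) hs3 r by simp
        ultimately show ?thesis unfolding parabolic_boundary_def N_def by auto
      qed
      moreover have "\<forall>z\<in>N \<inter> Omega_T \<Omega> T. \<zeta> z = 0"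
      proof
        fix z assume "z \<in> N \<inter> Omega_T \<Omega> T"
        then have "fst z \<notin> cball x0 rb \<or> snd z \<notin> {t0 - r - h * s<..<t0 + h * s}"
          by (cases z) (auto simp: N_def)
        then show "\<zeta> z = 0" using \<xi>_out(1)[of "fst z"] \<theta>_out(1)[of "snd z"] by (auto simp: \<zeta>_def)
      qed
      ultimately show "\<exists>N. open N \<and> parabolic_boundary \<Omega> T \<subseteq> N \<and> (\<forall>z\<in>N \<inter> Omega_T \<Omega> T. \<zeta> z = 0)" by blast
    qed
    define f where "f t = (\<integral>\<^sup>+x\<in>\<Omega>. ennreal (\<bar>\<omega> (x, t)\<bar> powr (1 + \<alpha>) * \<zeta> (x, t)) \<partial>lebesgue)" for t
    define RHS where "RHS = (\<integral>\<^sup>+z\<in>Omega_T \<Omega> T. ennreal (\<bar>\<omega> z\<bar> powr (1 + \<alpha>) *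
             (norm (u z) * norm (grad_x \<zeta> z) + \<bar>d_t \<zeta> z\<bar>)) \<partial>lebesgue)"
    define I where "I = (\<integral>\<^sup>+z\<in>D. ennreal (\<bar>W z\<bar> powr (1 + \<alpha>) * (norm (U z) + 1)) \<partial>lborel)"
    have ess: "esssup (lebesgue_on {0..T}) f \<le> ennreal Vo * RHS"
      using u_VE cut al unfolding vorticity_estimates_def f_def[abs_def] RHS_def by auto
    have "AE t in lebesgue_on {0..T}. f t \<le> esssup (lebesgue_on {0..T}) f" by (rule esssup_AE)
    then have "AE t in lborel. t \<in> {0..T} \<longrightarrow> f t \<le> esssup (lebesgue_on {0..T}) f"
      by (subst (asm) AE_lebesgue_on) auto
    then have fle: "AE t in lborel. t \<in> {0..T} \<longrightarrow> f t \<le> ennreal Vo * RHS"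
      by (rule eventually_mono) (use ess in \<open>auto intro: order_trans\<close>)
    have [measurable]: "D \<in> sets borel"
      unfolding D_def borel_prod[symmetric] by (intro pair_measureI) auto
    have pw: "\<bar>w\<bar> powr (1 + \<alpha>) * (nu * norm (grad_x \<zeta> z) + \<bar>d_t \<zeta> z\<bar>) \<le> M / (s - s') * (\<bar>w\<bar> powr (1 + \<alpha>) * (nu + 1))"
      if "nu \<ge> 0" for w nu z
    proof -
      have "norm (grad_x \<zeta> z) \<le> 1 * (M1 / d)"
        unfolding gz norm_scaleR using \<theta>01[of "snd z"] M1(1) d(1) M1(2)[OF rab(1,2), of x0 "fst z"]
        by (intro mult_mono) (auto simp: \<xi>_def d(2))
      also have "\<dots> \<le> M / (s - s')"
        unfolding M_def d_def using scale_bounds s M1(1) M2(1) by (simp add: divide_right_mono)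
      finally have 1: "nu * norm (grad_x \<zeta> z) \<le> nu * (M / (s - s'))" using that by (rule mult_left_mono)
      have "\<bar>d_t \<zeta> z\<bar> \<le> 1 * (2 * M2 / d)"
        unfolding dz abs_mult using \<xi>01[of "fst z"] \<theta>'b[of "snd z"] by (intro mult_mono) auto
      also have "\<dots> \<le> M / (s - s')"
        unfolding M_def d_def using scale_bounds s M1(1) M2(1) by (simp add: divide_right_mono)
      finally have 2: "\<bar>d_t \<zeta> z\<bar> \<le> M / (s - s')" .
      have "k * (nu + 1) = nu * k + k" for k :: real by (simp add: algebra_simps)
      then have "nu * norm (grad_x \<zeta> z) + \<bar>d_t \<zeta> z\<bar> \<le> M / (s - s') * (nu + 1)"
        using add_mono[OF 1 2] by simp
      then have "\<bar>w\<bar> powr (1 + \<alpha>) * (nu * norm (grad_x \<zeta> z) + \<bar>d_t \<zeta> z\<bar>) \<le> \<bar>w\<bar> powr (1 + \<alpha>) * (M / (s - s') * (nu + 1))"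
        by (rule mult_left_mono) simp
      then show ?thesis by (simp only: mult_ac)
    qed
    \<comment> \<open>The cap at \<open>b\<close> costs nothing: times in the window are below
      \<open>b\<close> when \<open>t0 + 3 * h \<le> b\<close>, and otherwise \<open>b = T\<close>
      bounds all times of the domain.\<close>
    have zero: "grad_x \<zeta> z = 0 \<and> d_t \<zeta> z = 0" if "z \<in> Omega_T \<Omega> T" "z \<notin> D" for z
    proof (cases "fst z \<in> ball x0 rb \<and> snd z \<in> {t0 - r - h * s<..<t0 + h * s}")
      case True
      have "h * s \<le> 3 * h" using s scale_bounds mult_left_mono[of s 3 h] by simp
      then have "snd z \<le> b" using True that(1) scale_bounds(3) by (cases z) (auto simp: Omega_T_def)
      then have "z \<in> D" using True by (cases z) (auto simp: D_def)
      then show ?thesis using that by simp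
    next
      case False
      then show ?thesis using \<xi>_out[of "fst z"] \<theta>_out[of "snd z"] by (auto simp: gz dz)
    qed
    have "RHS \<le> (\<integral>\<^sup>+z\<in>D. ennreal (M / (s - s') * (\<bar>W z\<bar> powr (1 + \<alpha>) * (norm (U z) + 1))) \<partial>lborel)"
      unfolding RHS_def nn_integral_completion
    proof (rule nn_integral_mono_AE)
      show "AE z in lborel. ennreal (\<bar>\<omega> z\<bar> powr (1 + \<alpha>) * (norm (u z) * norm (grad_x \<zeta> z) + \<bar>d_t \<zeta> z\<bar>)) * indicator (Omega_T \<Omega> T) z
        \<le> ennreal (M / (s - s') * (\<bar>W z\<bar> powr (1 + \<alpha>) * (norm (U z) + 1))) * indicator D z"
        using U_eq W_eq
      proof eventually_elim
        case (elim z)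
        show ?case
        proof (cases "z \<in> D")
          case True
          then have "z \<in> K" "z \<in> Omega_T \<Omega> T" using DK domain_compact(2) by auto
          then have "u z = U z" "\<omega> z = W z" using elim by auto
          then show ?thesis
            using True \<open>z \<in> Omega_T \<Omega> T\<close> ennreal_leI[OF pw[of "norm (U z)" "W z" z]] by simp
        next
          case False
          then show ?thesis using zero[of z] by (cases "z \<in> Omega_T \<Omega> T") auto
        qed
      qed
    qed
    also have "\<dots> = ennreal (M / (s - s')) * I"
    proof -
      have "(\<integral>\<^sup>+z\<in>D. ennreal (M / (s - s') * (\<bar>W z\<bar> powr (1 + \<alpha>) * (norm (U z) + 1))) \<partial>lborel)
        = (\<integral>\<^sup>+z. ennreal (M / (s - s')) * (ennreal (\<bar>W z\<bar> powr (1 + \<alpha>) * (norm (U z) + 1)) * indicator D z) \<partial>lborel)"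
        using M0 s by (intro nn_integral_cong) (simp add: ennreal_mult mult.assoc del: times_divide_eq_left)
      also have "\<dots> = ennreal (M / (s - s')) * I" unfolding I_def by (rule nn_integral_cmult) measurable
      finally show ?thesis .
    qed
    finally have "ennreal Vo * RHS \<le> ennreal Vo * (ennreal (M / (s - s')) * I)" by (rule mult_left_mono) simp
    also have "\<dots> = ennreal (Vo * M / (s - s')) * I"
      using Vo M0 s by (simp add: ennreal_mult[symmetric] flip: mult.assoc)
    also have "\<dots> \<le> ennreal (V / (s - s')) * I"
      using s by (intro mult_right_mono ennreal_leI divide_right_mono) (auto simp: V_def)
    finally have R: "ennreal Vo * RHS \<le> ennreal (V / (s - s')) * I" .
    show ?thesis
      using fle slices_eq
    proof eventually_elim
      case (elim t)
      show ?case
      proof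
        assume t: "t \<in> {t0 - r - h * s'<..<t0 + h * s'} \<inter> {..b}"
        have tT: "t \<in> {0..T}" using t cyl(2) hs3 r end_time_bounds by auto
        have "(\<integral>\<^sup>+x\<in>ball x0 (r + h * s'). ennreal (\<bar>W (x, t)\<bar> powr (1 + \<alpha>)) \<partial>lborel) \<le> f t"
          unfolding f_def nn_integral_completion
        proof (rule nn_integral_mono_AE)
          show "AE x in lborel. ennreal (\<bar>W (x, t)\<bar> powr (1 + \<alpha>)) * indicator (ball x0 (r + h * s')) x
            \<le> ennreal (\<bar>\<omega> (x, t)\<bar> powr (1 + \<alpha>) * \<zeta> (x, t)) * indicator \<Omega> x"
            using elim(2)
          proof eventually_elim
            case (elim x)
            show ?case
            proof (cases "x \<in> ball x0 (r + h * s')")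
              case True
              then have "norm (x - x0) \<le> ra" by (simp add: ra_def dist_norm norm_minus_commute)
              then have x1: "\<xi> x = 1" unfolding \<xi>_def by (intro bump_eq_1 rab)
              have t1: "\<theta> t = 1" by (rule \<theta>_one) (use t in simp)
              have xx: "x \<in> cball x0 (3 * r)" using True hs3 r by auto
              then have "(x, t) \<in> K" using t hs3 r by (auto simp: K_def)
              then have "\<omega> (x, t) = W (x, t)" using elim by simp
              then show ?thesis using True xx ball_subset by (auto simp: \<zeta>_def x1 t1)
            qed simp
          qed
        qed
        also have "\<dots> \<le> ennreal Vo * RHS" using elim(1) tT by simp
        also have "\<dots> \<le> ennreal (V / (s - s')) * I" by (rule R)
        finally show "(\<integral>\<^sup>+x\<in>ball x0 (r + h * s'). ennreal (\<bar>W (x, t)\<bar> powr (1 + \<alpha>)) \<partial>lborel)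
          \<le> ennreal (V / (s - s')) * (\<integral>\<^sup>+z\<in>ball x0 (r + h * s) \<times> ({t0 - r - h * s<..<t0 + h * s} \<inter> {..b}).
            ennreal (\<bar>W z\<bar> powr (1 + \<alpha>) * (norm (U z) + 1)) \<partial>lborel)"
          by (simp only: I_def D_def rb_def)
      qed
    qed
  qed
  show ?thesis by (rule exI[of _ V]) (use main in \<open>auto simp: V_def\<close>)
qed

lemma exponential_bound:
  assumes \<gamma>: "\<gamma> \<ge> exp_constant (2 + \<epsilon>)"
  shows "\<exists>M. AE t in lborel. t \<in> {t0 - r<..<t0} \<longrightarrow>
    (\<integral>\<^sup>+x\<in>ball x0 r. ennreal (exp (norm (U (x, t)) powr (1 / \<gamma>))) \<partial>lborel) \<le> ennreal M"
proof -
  obtain V where V: "V \<ge> 1" "\<forall>\<alpha> s s'. 0 \<le> \<alpha> \<longrightarrow> \<alpha> < 1 \<longrightarrow> 0 \<le> s' \<longrightarrow> s' < s \<longrightarrow> s \<le> 3 \<longrightarrow>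
    (AE t in lborel. t \<in> {t0 - r - h * s'<..<t0 + h * s'} \<inter> {..b} \<longrightarrow>
      (\<integral>\<^sup>+x\<in>ball x0 (r + h * s'). ennreal (\<bar>W (x, t)\<bar> powr (1 + \<alpha>)) \<partial>lborel)
        \<le> ennreal (V / (s - s')) * (\<integral>\<^sup>+z\<in>ball x0 (r + h * s) \<times> ({t0 - r - h * s<..<t0 + h * s} \<inter> {..b}).
            ennreal (\<bar>W z\<bar> powr (1 + \<alpha>) * (norm (U z) + 1)) \<partial>lborel))"
    using local_vorticity_estimate by (elim exE conjE)
  obtain A0 where A0: "AE t in lborel. t \<in> J \<longrightarrow> (\<integral>x. norm (U (x, t)) \<partial>lborel) \<le> A0"
    using U_L1_bound ..
  have slices: "AE t in lborel. t \<in> J \<longrightarrow> integrable lborel (\<lambda>x. U (x, t)) \<and> integrable lborel (\<lambda>x. W (x, t))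
      \<and> (\<integral>x. norm (U (x, t)) \<partial>lborel) \<le> A0"
    using A0 slices_integrable by eventually_elim simp
  have "J \<in> sets borel" by (simp add: J_def)
  \<comment> \<open>The inner and outer radii are those of \<open>B 1\<close> and
    \<open>B 2\<close>; the cut-off in between equals 1 up to \<open>r + h * (3/2)\<close>.\<close>
  moreover have "0 < r + h * 1" "r + h * 1 < r + h * (3/2)" "r + h * (3/2) < r + h * 2" "cball x0 (r + h * 2) \<subseteq> cball x0 (3 * r)"
    using r scale_bounds by auto
  ultimately obtain A c where Ac: "A \<ge> 0" "c \<ge> 0"
    "AE t in lborel. t \<in> J \<longrightarrow> (AE y in lborel. y \<in> ball x0 (r + h * 1) \<longrightarrow>
      ennreal (norm (U (y, t))) \<le> ennreal A + ennreal c * (\<integral>\<^sup>+x\<in>ball x0 (r + h * 2). ennreal (\<bar>W (x, t)\<bar> / norm (x - y)) \<partial>lborel))"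
    using Biot_Savart_bound[OF U W _ slices _ _ _ _ divergence_free vorticity_slices] by blast
  interpret vorticity_iteration U W x0 t0 r h b "2 + \<epsilon>" V A c
    "\<lambda>s. ball x0 (r + h * s)" "\<lambda>s. {t0 - r - h * s<..<t0 + h * s} \<inter> {..b}"
    "\<lambda>s. ball x0 (r + h * s) \<times> ({t0 - r - h * s<..<t0 + h * s} \<inter> {..b})"
  proof (unfold_locales)
    show "U \<in> borel_measurable borel" "W \<in> borel_measurable borel" by (rule U W)+
    show "r > 0" "h > 0" "2 + \<epsilon> > 2" "V \<ge> 1" "A \<ge> 0" "c \<ge> 0" using r scale_bounds eps V Ac by auto
    show "AE t in lborel. t \<in> {t0 - r - h * s'<..<t0 + h * s'} \<inter> {..b} \<longrightarrow>
      (\<integral>\<^sup>+x\<in>ball x0 (r + h * s'). ennreal (\<bar>W (x, t)\<bar> powr (1 + \<alpha>)) \<partial>lborel)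
        \<le> ennreal (V / (s - s')) * (\<integral>\<^sup>+z\<in>ball x0 (r + h * s) \<times> ({t0 - r - h * s<..<t0 + h * s} \<inter> {..b}).
            ennreal (\<bar>W z\<bar> powr (1 + \<alpha>) * (norm (U z) + 1)) \<partial>lborel)"
      if "0 \<le> \<alpha>" "\<alpha> < 1" "0 \<le> s'" "s' < s" "s \<le> 3" for \<alpha> s s'
      using V(2) that by blast
    have le: "(\<integral>\<^sup>+z\<in>D. g z \<partial>lborel) < \<infinity>" if "(\<integral>\<^sup>+z. g z \<partial>lborel) < \<infinity>" for D and g :: "(real^2) \<times> real \<Rightarrow> ennreal"
      using that by (rule le_less_trans[rotated]) (auto intro!: nn_integral_mono split: split_indicator)
    show "(\<integral>\<^sup>+z\<in>ball x0 (r + h * 3) \<times> ({t0 - r - h * 3<..<t0 + h * 3} \<inter> {..b}). ennreal (\<bar>W z\<bar> powr 2) \<partial>lborel) < \<infinity>"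
      by (rule le[OF W_sq_finite])
    show "(\<integral>\<^sup>+z\<in>ball x0 (r + h * 3) \<times> ({t0 - r - h * 3<..<t0 + h * 3} \<inter> {..b}). ennreal (norm (U z) powr (2 + \<epsilon>)) \<partial>lborel) < \<infinity>"
      by (rule le[OF U_powr_finite])
    show "AE t in lborel. t \<in> {t0 - r - h * 1<..<t0 + h * 1} \<inter> {..b} \<longrightarrow> (AE y in lborel. y \<in> ball x0 (r + h * 1) \<longrightarrow>
      ennreal (norm (U (y, t))) \<le> ennreal A + ennreal c * (\<integral>\<^sup>+x\<in>ball x0 (r + h * 2). ennreal (\<bar>W (x, t)\<bar> / norm (x - y)) \<partial>lborel))"
      \<comment> \<open>The interval of the iteration may contain its endpoint \<open>b\<close>,
        which the open \<open>J\<close> excludes; a single time is negligible.\<close>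
      using Ac(3) AE_lborel_singleton[of b]
    proof eventually_elim
      case (elim t)
      have "t \<in> J" if "t \<in> {t0 - r - h * 1<..<t0 + h * 1} \<inter> {..b}"
        using that elim(2) scale_bounds r by (auto simp: J_def)
      then show ?case using elim(1) by blast
    qed
  qed
  obtain M where "AE t in lborel. t \<in> {t0 - r - h * 0<..<t0 + h * 0} \<inter> {..b} \<longrightarrow>
      (\<integral>\<^sup>+x\<in>ball x0 (r + h * 0). ennreal (exp (norm (U (x, t)) powr (1 / \<gamma>))) \<partial>lborel) \<le> ennreal M"
    using exponential_integrability[OF \<gamma>] ..
  then have "AE t in lborel. t \<in> {t0 - r<..<t0} \<longrightarrow>
      (\<integral>\<^sup>+x\<in>ball x0 r. ennreal (exp (norm (U (x, t)) powr (1 / \<gamma>))) \<partial>lborel) \<le> ennreal M"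
    using end_time_bounds(1) by (auto elim!: eventually_mono)
  then show ?thesis ..
qed

text \<open>\<open>esssup_I\<close> asks for a measurable function of time. Measurability is
  inherited from the Borel version through equality almost everywhere, and the bound comes from
  \<open>exponential_bound\<close>.\<close>

lemma exponential_class:
  assumes \<gamma>: "\<gamma> \<ge> exp_constant (2 + \<epsilon>)"
  shows "Linfty_exp \<gamma> (time_interval t0 r) (ball x0 r) u"
proof -
  obtain M where M: "AE t in lborel. t \<in> {t0 - r<..<t0} \<longrightarrow>
      (\<integral>\<^sup>+x\<in>ball x0 r. ennreal (exp (norm (U (x, t)) powr (1 / \<gamma>))) \<partial>lborel) \<le> ennreal M"
    using exponential_bound[OF \<gamma>] ..
  define I where "I = {t0 - r<..<t0}"
  have I: "I \<in> sets borel" by (simp add: I_def)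
  define F where "F t = (\<integral>\<^sup>+x\<in>ball x0 r. ennreal (exp (norm (u (x, t)) powr (1 / \<gamma>))) \<partial>lebesgue)" for t
  define G where "G t = (\<integral>\<^sup>+x\<in>ball x0 r. ennreal (exp (norm (U (x, t)) powr (1 / \<gamma>))) \<partial>lborel)" for t
  have FG: "AE t in lborel. t \<in> I \<longrightarrow> F t = G t"
    using slices_eq
  proof eventually_elim
    case (elim t)
    show ?case
    proof
      assume t: "t \<in> I"
      have "(x, t) \<in> K" if "x \<in> ball x0 r" for x
        using that t r end_time_bounds(1) by (auto simp: K_def I_def)
      then show "F t = G t"
        unfolding F_def G_def
        by (intro nn_integral_lebesgue_AE_eq eventually_mono[OF elim]) (auto split: split_indicator)
    qed
  qed
  have Um: "(\<lambda>(t, x). U (x, t)) \<in> borel_measurable (borel \<Otimes>\<^sub>M borel)"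
    using measurable_compose[OF measurable_pair_swap' U[folded borel_prod]] by (simp add: split_def)
  then have [measurable]: "(\<lambda>p. U (snd p, fst p)) \<in> borel_measurable (borel \<Otimes>\<^sub>M borel)" by (simp add: split_def)
  have [measurable]: "G \<in> borel_measurable borel"
  proof -
    have "(\<lambda>t. \<integral>\<^sup>+x. ennreal (exp (norm (U (snd (t, x), fst (t, x))) powr (1 / \<gamma>))) * indicator (ball x0 r) x \<partial>lborel)
        \<in> borel_measurable borel"
      by (rule lborel.borel_measurable_nn_integral) measurable
    then show ?thesis unfolding G_def by simp
  qed
  have "AE t in lborel. (if t \<in> I then F t else 0) = (if t \<in> I then G t else 0)"
    using FG by (rule eventually_mono) simp
  then have "(\<lambda>t. if t \<in> I then F t else 0) \<in> borel_measurable lebesgue"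
    by (rule measurable_completion_AE) (use I in auto)
  then have "(\<lambda>t. if t \<in> I then F t else 0) \<in> borel_measurable (lebesgue_on I)"
    by (rule measurable_restrict_space1)
  then have Fm: "F \<in> borel_measurable (lebesgue_on I)"
    by (rule measurable_cong[THEN iffD1, rotated]) (simp add: space_restrict_space)
  have "AE t in lborel. t \<in> I \<longrightarrow> F t \<le> ennreal M"
    using FG M by eventually_elim (simp add: G_def I_def)
  then have "AE t in lebesgue_on I. F t \<le> ennreal M" by (simp add: AE_lebesgue_on[OF I])
  then have "esssup (lebesgue_on I) F \<le> ennreal M" by (rule esssup_I[OF Fm])
  also have "\<dots> < \<infinity>" by simp
  finally show ?thesis unfolding Linfty_exp_def time_interval_def F_def[abs_def] I_def .
qed

end

theorem theorem2p5:
  fixes \<epsilon> Vo :: real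
  assumes "\<epsilon> > 0" and "Vo > 0"
  shows "\<exists>C::real. C > 0 \<and>
    (\<forall>(\<Omega> :: (real^2) set) (T :: real)
       (u :: (real^2) \<times> real \<Rightarrow> real^2) (\<omega> :: (real^2) \<times> real \<Rightarrow> real).
      open \<Omega> \<and> T > 0 \<and> Linfty_loc_L2_loc \<Omega> T u \<and> weak_solution \<Omega> T u \<and>
      vorticity_estimates \<Omega> T u \<omega> Vo \<and> Lp_loc (2 + \<epsilon>) (Omega_T \<Omega> T) u \<longrightarrow>
      (\<forall>(x0 :: real^2) (t0 :: real) (r :: real) (\<gamma> :: real).
        r > 0 \<and> compactly_contained (cylinder x0 t0 (4 * r)) (Omega_T \<Omega> T) \<and>
        ennreal \<gamma> = ennreal C *
          (ennreal
             ((r\<^sup>2 * average (cylinder x0 t0 (4 * r)) (\<lambda>z. \<bar>\<omega> z\<bar>\<^sup>2) + 1) powr (1 / 2) *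
              (average (cylinder x0 t0 (4 * r)) (\<lambda>z. norm (u z) powr (2 + \<epsilon>)) + 1)
                powr (1 / (2 + \<epsilon>)))
           + esssup (lebesgue_on (time_interval t0 (4 * r)))
               (\<lambda>t. ennreal (1 / measure lebesgue (ball x0 (4 * r))) *
                  (\<integral>\<^sup>+x\<in>ball x0 (4 * r). ennreal (norm (u (x, t))) \<partial>lebesgue)))
        \<longrightarrow> Linfty_exp \<gamma> (time_interval t0 r) (ball x0 r) u))"
proof (intro exI[of _ "exp_constant (2 + \<epsilon>)"] conjI allI impI; (elim conjE)?)
  show C: "0 < exp_constant (2 + \<epsilon>)" using assms by (intro exp_constant_pos) simp
  fix \<Omega> :: "(real^2) set" and T :: real and u :: "(real^2) \<times> real \<Rightarrow> real^2" and \<omega> :: "(real^2) \<times> real \<Rightarrow> real"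
    and x0 :: "real^2" and t0 r \<gamma> :: real
  assume op: "open \<Omega>" and "T > 0" and u: "Linfty_loc_L2_loc \<Omega> T u" "weak_solution \<Omega> T u"
    "vorticity_estimates \<Omega> T u \<omega> Vo" "Lp_loc (2 + \<epsilon>) (Omega_T \<Omega> T) u"
    and r: "r > 0" and cc: "compactly_contained (cylinder x0 t0 (4 * r)) (Omega_T \<Omega> T)"
  define P where "P = (r\<^sup>2 * average (cylinder x0 t0 (4 * r)) (\<lambda>z. \<bar>\<omega> z\<bar>\<^sup>2) + 1) powr (1 / 2) *
              (average (cylinder x0 t0 (4 * r)) (\<lambda>z. norm (u z) powr (2 + \<epsilon>)) + 1) powr (1 / (2 + \<epsilon>))"
  define E where "E = esssup (lebesgue_on (time_interval t0 (4 * r)))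
               (\<lambda>t. ennreal (1 / measure lebesgue (ball x0 (4 * r))) *
                  (\<integral>\<^sup>+x\<in>ball x0 (4 * r). ennreal (norm (u (x, t))) \<partial>lebesgue))"
  assume "ennreal \<gamma> = ennreal (exp_constant (2 + \<epsilon>)) *
          (ennreal
             ((r\<^sup>2 * average (cylinder x0 t0 (4 * r)) (\<lambda>z. \<bar>\<omega> z\<bar>\<^sup>2) + 1) powr (1 / 2) *
              (average (cylinder x0 t0 (4 * r)) (\<lambda>z. norm (u z) powr (2 + \<epsilon>)) + 1)
                powr (1 / (2 + \<epsilon>)))
           + esssup (lebesgue_on (time_interval t0 (4 * r)))
               (\<lambda>t. ennreal (1 / measure lebesgue (ball x0 (4 * r))) *
                  (\<integral>\<^sup>+x\<in>ball x0 (4 * r). ennreal (norm (u (x, t))) \<partial>lebesgue)))"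
  then have g: "ennreal \<gamma> = ennreal (exp_constant (2 + \<epsilon>)) * (ennreal P + E)"
    unfolding P_def E_def .
  have avg: "0 \<le> average S f" if "\<And>z. 0 \<le> f z" for S :: "((real^2) \<times> real) set" and f
    unfolding average_def set_lebesgue_integral_def using that by (intro mult_nonneg_nonneg integral_nonneg) auto
  have "0 \<le> r\<^sup>2 * average (cylinder x0 t0 (4 * r)) (\<lambda>z. \<bar>\<omega> z\<bar>\<^sup>2)"
    "0 \<le> average (cylinder x0 t0 (4 * r)) (\<lambda>z. norm (u z) powr (2 + \<epsilon>))"
    by (intro mult_nonneg_nonneg avg; simp)+
  then have "1 * 1 \<le> P"
    unfolding P_def using assms(1) by (intro mult_mono ge_one_powr_ge_zero) auto
  then have "ennreal (exp_constant (2 + \<epsilon>)) * ennreal 1 \<le> ennreal (exp_constant (2 + \<epsilon>)) * (ennreal P + E)"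
    by (intro mult_left_mono) (auto intro: add_increasing2 ennreal_leI)
  then have \<gamma>: "exp_constant (2 + \<epsilon>) \<le> \<gamma>"
    unfolding g[symmetric] using C by (simp add: ennreal_le_iff2)
  \<comment> \<open>Since \<gamma> is a real number, the essential supremum in its formula is
    finite. This supplies the \<open>L^1\<close> bound on the slices before
    \<open>t0\<close>.\<close>
  have "E \<noteq> \<infinity>"
  proof
    assume "E = \<infinity>"
    then have "ennreal \<gamma> = \<infinity>" unfolding g using C by (simp add: ennreal_mult_eq_top_iff ennreal_eq_0_iff)
    then show False by simp
  qed
  then obtain e where e: "E = ennreal e" "e \<ge> 0" by (cases E) auto
  define m where "m = measure lebesgue (ball x0 (4 * r))"
  have m: "m > 0" unfolding m_def using r by (simp add: content_ball_pos)
  have sup: "AE t in lborel. t \<in> {t0 - 4 * r<..<t0} \<longrightarrow>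
      (\<integral>\<^sup>+x\<in>ball x0 (4 * r). ennreal (norm (u (x, t))) \<partial>lebesgue) \<le> ennreal (m * e)"
  proof -
    have "AE t in lebesgue_on (time_interval t0 (4 * r)). ennreal (1 / m) *
        (\<integral>\<^sup>+x\<in>ball x0 (4 * r). ennreal (norm (u (x, t))) \<partial>lebesgue) \<le> E"
      unfolding E_def m_def by (rule esssup_AE)
    then have "AE t in lborel. t \<in> {t0 - 4 * r<..<t0} \<longrightarrow> ennreal (1 / m) *
        (\<integral>\<^sup>+x\<in>ball x0 (4 * r). ennreal (norm (u (x, t))) \<partial>lebesgue) \<le> E"
      unfolding time_interval_def by (subst (asm) AE_lebesgue_on) auto
    moreover have "X \<le> ennreal (m * e)" if "ennreal (1 / m) * X \<le> E" for X
    proof -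
      have "ennreal m * (ennreal (1 / m) * X) \<le> ennreal m * ennreal e"
        using that unfolding e by (rule mult_left_mono) simp
      moreover have "ennreal m * (ennreal (1 / m) * X) = X"
        using m by (simp add: mult.assoc[symmetric] ennreal_mult[symmetric])
      ultimately show "X \<le> ennreal (m * e)" using m e by (simp add: ennreal_mult)
    qed
    ultimately show ?thesis by (auto elim: eventually_mono)
  qed
  \<comment> \<open>The closed cylinder contains its bottom and top faces, while \<Omega>_T omits
    time 0 but not \<open>T\<close>: hence \<open>0 < t0 - 4 * r\<close> strictly, and
    \<open>t0 = T\<close> is allowed.\<close>
  have "closure (cylinder x0 t0 (4 * r)) = cball x0 (4 * r) \<times> {t0 - 4 * r..t0}"
    unfolding cylinder_def time_interval_def closure_Times using r by (simp add: closure_ball)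
  then have sub: "cball x0 (4 * r) \<times> {t0 - 4 * r..t0} \<subseteq> Omega_T \<Omega> T"
    using cc by (simp add: compactly_contained_def)
  then have mem: "(x, t0 - 4 * r) \<in> Omega_T \<Omega> T" "(x, t0) \<in> Omega_T \<Omega> T" if "x \<in> cball x0 (4 * r)" for x
    using that r by (auto simp: subset_iff)
  have cyl: "cball x0 (4 * r) \<subseteq> \<Omega>" "0 < t0 - 4 * r" "t0 \<le> T"
    using mem[of x0] mem r by (auto simp: Omega_T_def)
  define b where "b = (if t0 < T then (t0 + T) / 2 else T)"
  define K where "K = cball x0 (3 * r) \<times> {t0 - 3 * r..b}"
  have b: "t0 \<le> b" "b \<le> T" using cyl(3) by (auto simp: b_def)
  have K: "compact K" unfolding K_def by (intro compact_Times compact_cball compact_Icc)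
  have KT: "K \<subseteq> Omega_T \<Omega> T"
    using cyl b r by (auto simp: K_def Omega_T_def subset_iff)
  have Kb: "K \<in> sets borel" using K by (auto dest: compact_imp_closed)
  have "Lp (2 + \<epsilon>) K u" "Lp 2 K \<omega>"
    using u(3,4) K KT unfolding vorticity_estimates_def Lp_loc_def by blast+
  then have m1: "set_borel_measurable lebesgue K u" and m2: "set_borel_measurable lebesgue K \<omega>"
    by (simp_all only: Lp_def)
  obtain U where U: "U \<in> borel_measurable borel" "AE z in lborel. z \<in> K \<longrightarrow> u z = U z" "\<forall>z. z \<notin> K \<longrightarrow> U z = 0"
    using ex_borel_version[OF m1 Kb] by (elim bexE conjE)
  obtain W where W: "W \<in> borel_measurable borel" "AE z in lborel. z \<in> K \<longrightarrow> \<omega> z = W z" "\<forall>z. z \<notin> K \<longrightarrow> W z = 0"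
    using ex_borel_version[OF m2 Kb] by (elim bexE conjE)
  have "euler_cylinder \<Omega> T u \<omega> Vo \<epsilon> x0 t0 r (m * e) U W"
    unfolding euler_cylinder_def b_def[symmetric] K_def[symmetric]
    using op assms u r cyl sup U W by (intro conjI) auto
  from euler_cylinder.exponential_class[OF this \<gamma>]
  show "Linfty_exp \<gamma> (time_interval t0 r) (ball x0 r) u" .
qed

end
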